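(* Let $K$ be a commutative $\mathbb C$-algebra, $\Bbbk=K[[\gamma]]$, $q=e^\gamma$, $\omega=q-q^{-1}$, and let $\mathcal U=\mathcal U_q(gl(3))$ be the quasitriangular Hopf algebra over $\Bbbk$ with coproduct $\Delta$, counit $\varepsilon$ and universal $R$-matrix $\mathcal R_S$ described in the context. Let $\mu,B\in\gamma\Bbbk$ be arbitrary, put $\tilde e_1=e_1q^{\frac12(e_{11}+e_{22})}$, $\tilde f_2=f_2q^{\frac12(e_{22}+e_{33})}$, and $$\mathcal F^{(1)}=\exp\Big(\tfrac{\gamma}{2}\big[e_{11}\wedge e_{22}+e_{11}\wedge e_{33}+e_{22}\wedge e_{33}\big]\Big),\quad \mathcal F^{(2)}=\exp_{q^2}(\mu\,\tilde e_1\otimes\tilde f_2)\,q^{2e_{11}\otimes e_{33}},\quad \mathcal F^{(3)}=\exp\big(B\,(e_{11}-e_{33})\wedge C\big).$$ Then $\mathcal F=\mathcal F^{(3)}\mathcal F^{(2)}\mathcal F^{(1)}$ is a twisting element, i.e. it is invertible and $$(\varepsilon\otimes\mathrm{id})(\mathcal F)=(\mathrm{id}\otimes\varepsilon)(\mathcal F)=1,\qquad \mathcal F_{12}(\Delta\otimes\mathrm{id})(\mathcal F)=\mathcal F_{23}(\mathrm{id}\otimes\Delta)(\mathcal F),$$ and the universal $R$-matrix $\mathcal F_{21}\mathcal R_S\mathcal F^{-1}$ of the twisted Hopf algebra (depending on the three parameters $\gamma,\mu,B$) reduces in the fundamental representation $\rho$ to the Cremmer-Gervais $R$-matrix: there are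 an invertible scalar $c\in\Bbbk$, an invertible $p\in\Bbbk$ and $\nu\in\Bbbk$ (depending on $\gamma,\mu,B$) such that $(\rho\otimes\rho)(\mathcal F_{21}\mathcal R_S\mathcal F^{-1})=c\,R_{CG}$, where $$\begin{aligned}R_{CG}={}&R_S+(p-1)(E_{11}\otimes E_{22}+E_{22}\otimes E_{33})+(p^{-1}-1)(E_{22}\otimes E_{11}+E_{33}\otimes E_{22})\\&+(p^2/q-1)E_{11}\otimes E_{33}+(q/p^2-1)E_{33}\otimes E_{11}+q\nu\big(E_{32}\otimes E_{12}-(p^2/q^2)\,E_{12}\otimes E_{32}\big),\end{aligned}$$ $$R_S=q\sum_{i}E_{ii}\otimes E_{ii}+\sum_{i\ne j}E_{ii}\otimes E_{jj}+\omega\sum_{i<j}E_{ij}\otimes E_{ji},\qquad i,j\in\{1,2,3\}.$$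
   Context: All algebras are $\gamma$-adically complete over $\Bbbk$ and tensor products are completed. $E_{ij}$ are the $3\times3$ matrix units; $\mathcal F_{21}$ is $\mathcal F$ with tensor factors permuted; $x\wedge y=x\otimes y-y\otimes x$; $\exp_s(x)=\sum_{n\ge0}x^n/[n;s]!$ with $[n;s]!=\prod_{m=1}^n\frac{s^m-1}{s-1}$. $\mathcal U_q(gl(3))$ is $\mathcal U_q(sl(3))$ extended by a central primitive element $C$. Its generators are $e_{11},e_{22},e_{33},e_1,e_2,f_1,f_2$, with $C=e_{11}+e_{22}+e_{33}$, $h_1=e_{11}-e_{22}$, $h_2=e_{22}-e_{33}$. The relations are: the $e_{ii}$ commute with each other; $[e_{ii},e_j]=(\delta_{ij}-\delta_{i,j+1})e_j$; $[e_{ii},f_j]=-(\delta_{ij}-\delta_{i,j+1})f_j$; $[e_i,f_j]=\delta_{ij}\frac{q^{h_i}-q^{-h_i}}{q-q^{-1}}$; and, for $k\ne l$, $e_k^2e_l-(q+q^{-1})e_ke_le_k+e_le_k^2=0$, $f_k^2f_l-(q+q^{-1})f_kf_lf_k+f_lf_k^2=0$. The coproduct is $\Delta(e_{ii})=e_{ii}\otimes1+1\otimes e_{ii}$, $\Delta(e_i)=e_i\otimes q^{h_i}+1\otimes e_i$, $\Delta(f_i)=f_i\otimes1+q^{-h_i}\otimes f_i$; the counit vanishes on generators. The standard universal $R$-matrix is $$\mathcal R_S=q^{t_0}\exp_{q^{-2}}(\omega e_2\otimes f_2)\exp_{q^{-2}}(\omega e_{13}\otimes f_{13})\exp_{q^{-2}}(\omega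 e_1\otimes f_1),$$ with $e_{13}=e_1e_2-qe_2e_1$, $f_{13}=f_2f_1-q^{-1}f_1f_2$, $t_0=\sum_{i,j=1}^2(a^{-1})_{ij}h_i\otimes h_j$, and $a$ the Cartan matrix of $sl(3)$. The twisted Hopf algebra is $\mathcal U$ with the same multiplication and counit and with coproduct $\Delta_t(a)=\mathcal F\Delta(a)\mathcal F^{-1}$. The fundamental representation is $\rho(e_i)=E_{i,i+1}$, $\rho(f_i)=E_{i+1,i}$, $\rho(e_{ii})=E_{ii}$. *)

theory Defs
  imports
    "HOL-Analysis.Analysis"
    "HOL-Computational_Algebra.Formal_Power_Series"
    "HOL-Library.Poly_Mapping"
    "HOL-Library.Product_Plus"
begin

section \<open>The base ring\<close>

class comm_complex_algebra = comm_ring_1 +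
  fixes of_cplx :: "complex \<Rightarrow> 'a"
  assumes of_cplx_1: "of_cplx 1 = 1"
    and of_cplx_add: "of_cplx (x + y) = of_cplx x + of_cplx y"
    and of_cplx_mult: "of_cplx (x * y) = of_cplx x * of_cplx y"

instantiation complex :: comm_complex_algebra
begin
definition of_cplx_complex :: "complex \<Rightarrow> complex" where "of_cplx_complex x = x"
instance by standard (simp_all add: of_cplx_complex_def)
end

text \<open>Exact quotient. In the uses below the divisor is a central element which is not a zero
  divisor and which divides the dividend (it need not be a unit: \<open>q - q\<^sup>-\<^sup>1\<close> and \<open>s - 1\<close> are
  divisible by \<open>\<gamma>\<close>), so the quotient exists and is unique.\<close>

definition quo :: "'a::ring_1 \<Rightarrow> 'a \<Rightarrow> 'a" (infixl "\<oslash>" 70) where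
  "a \<oslash> b = (THE x. b * x = a)"

text \<open>The base ring is \<open>'k fps\<close>, whose variable \<^const>\<open>fps_X\<close> is \<open>\<gamma>\<close>.\<close>

definition qq :: "'k::comm_complex_algebra fps" where
  "qq = Abs_fps (\<lambda>n. of_cplx (1 / fact n))"

definition omega :: "'k::comm_complex_algebra fps" where
  "omega = qq - 1 \<oslash> qq"

definition q_fact :: "nat \<Rightarrow> 'k::comm_complex_algebra fps \<Rightarrow> 'k fps" where
  "q_fact n s = (\<Prod>m = 1..n. (s ^ m - 1) \<oslash> (s - 1))"


section \<open>Completed free algebras and their tensor powers\<close>

text \<open>The \<open>\<gamma>\<close>-adic completion of the monoid algebra of a monoid \<open>'m\<close> (written additively) over
  \<open>'k fps\<close> is \<open>('m \<Rightarrow>\<^sub>0 'k) fps\<close>; the metric which the library puts on \<^typ>\<open>'a fps\<close> is the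
  \<open>\<gamma>\<close>-adic one, so that \<^const>\<open>suminf\<close> and \<^const>\<open>closure\<close> below refer to the \<open>\<gamma>\<close>-adic topology.
  With 'm the monoid of words in the generators this is the completed free algebra, and with
  'm the product of n copies of that monoid it is the n-th completed tensor power of the
  completed free algebra.\<close>

datatype generator = E11 | E22 | E33 | E1 | E2 | F1 | F2

datatype gword = Word "generator list"

instantiation gword :: monoid_add
begin
definition zero_gword :: gword where "0 = Word []"
fun plus_gword :: "gword \<Rightarrow> gword \<Rightarrow> gword" where "Word u + Word v = Word (u @ v)"
instance
proof
  fix a b c :: gword
  show "a + b + c = a + (b + c)" by (cases a; cases b; cases c) simp
  show "0 + a = a" "a + 0 = a" by (cases a; simp add: zero_gword_def)+
qed
end

type_synonym 'k cfree = "(gword \<Rightarrow>\<^sub>0 'k) fps"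
type_synonym 'k cfree2 = "(gword \<times> gword \<Rightarrow>\<^sub>0 'k) fps"
type_synonym 'k cfree3 = "(gword \<times> gword \<times> gword \<Rightarrow>\<^sub>0 'k) fps"

definition scal :: "'k::comm_ring_1 fps \<Rightarrow> ('m::monoid_add \<Rightarrow>\<^sub>0 'k) fps" where
  "scal c = Abs_fps (\<lambda>n. Poly_Mapping.single 0 (fps_nth c n))"

definition cst :: "complex \<Rightarrow> ('m::monoid_add \<Rightarrow>\<^sub>0 'k::comm_complex_algebra) fps" where
  "cst z = scal (fps_const (of_cplx z))"

definition mono_of :: "'m::monoid_add \<Rightarrow> ('m \<Rightarrow>\<^sub>0 'k::comm_ring_1) fps" where
  "mono_of w = fps_const (Poly_Mapping.single w 1)"

text \<open>The continuous \<open>'k fps\<close>-linear extension of a map given on the monoid.\<close>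

definition lin_ext ::
  "('m \<Rightarrow> ('n::monoid_add \<Rightarrow>\<^sub>0 'k::comm_ring_1) fps) \<Rightarrow> ('m \<Rightarrow>\<^sub>0 'k) fps \<Rightarrow> ('n \<Rightarrow>\<^sub>0 'k) fps" where
  "lin_ext \<phi> x =
     suminf (\<lambda>n. \<Sum>w\<in>Poly_Mapping.keys (fps_nth x n).
        scal (fps_const (Poly_Mapping.lookup (fps_nth x n) w) * fps_X ^ n) * \<phi> w)"

text \<open>Exponentials; the series converge for arguments divisible by \<open>\<gamma>\<close>.\<close>

definition exp_ad ::
  "('m::monoid_add \<Rightarrow>\<^sub>0 'k::comm_complex_algebra) fps \<Rightarrow> ('m \<Rightarrow>\<^sub>0 'k) fps" where
  "exp_ad x = suminf (\<lambda>n. cst (1 / fact n) * x ^ n)"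

definition q_pow ::
  "('m::monoid_add \<Rightarrow>\<^sub>0 'k::comm_complex_algebra) fps \<Rightarrow> ('m \<Rightarrow>\<^sub>0 'k) fps" where
  "q_pow x = exp_ad (scal fps_X * x)"

definition q_exp :: "'k::comm_complex_algebra fps \<Rightarrow>
    ('m::monoid_add \<Rightarrow>\<^sub>0 'k) fps \<Rightarrow> ('m \<Rightarrow>\<^sub>0 'k) fps" where
  "q_exp s x = suminf (\<lambda>n. scal (1 \<oslash> q_fact n s) * x ^ n)"

definition leg1 :: "'k::comm_ring_1 cfree \<Rightarrow> 'k cfree2" where
  "leg1 = lin_ext (\<lambda>u. mono_of (u, 0))"

definition leg2 :: "'k::comm_ring_1 cfree \<Rightarrow> 'k cfree2" where
  "leg2 = lin_ext (\<lambda>u. mono_of (0, u))"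

definition tens :: "'k::comm_ring_1 cfree \<Rightarrow> 'k cfree \<Rightarrow> 'k cfree2" (infix "\<otimes>" 75) where
  "a \<otimes> b = leg1 a * leg2 b"

definition wedge :: "'k::comm_ring_1 cfree \<Rightarrow> 'k cfree \<Rightarrow> 'k cfree2" (infix "\<and>\<^sub>\<otimes>" 75) where
  "a \<and>\<^sub>\<otimes> b = a \<otimes> b - b \<otimes> a"

definition flip :: "'k::comm_ring_1 cfree2 \<Rightarrow> 'k cfree2" where
  "flip = lin_ext (\<lambda>(u, v). mono_of (v, u))"

definition leg12 :: "'k::comm_ring_1 cfree2 \<Rightarrow> 'k cfree3" where
  "leg12 = lin_ext (\<lambda>(u, v). mono_of (u, v, 0))"

definition leg13 :: "'k::comm_ring_1 cfree2 \<Rightarrow> 'k cfree3" where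
  "leg13 = lin_ext (\<lambda>(u, v). mono_of (u, 0, v))"

definition leg23 :: "'k::comm_ring_1 cfree2 \<Rightarrow> 'k cfree3" where
  "leg23 = lin_ext (\<lambda>(u, v). mono_of (0, u, v))"


section \<open>The algebra \<open>U_q(gl(3))\<close> and its completed tensor powers\<close>

definition gen :: "generator \<Rightarrow> 'k::comm_ring_1 cfree" where
  "gen g = mono_of (Word [g])"

definition ee :: "nat \<Rightarrow> 'k::comm_ring_1 cfree" where
  "ee i = gen (if i = 1 then E11 else if i = 2 then E22 else E33)"

definition er :: "nat \<Rightarrow> 'k::comm_ring_1 cfree" where
  "er i = gen (if i = 1 then E1 else E2)"

definition fr :: "nat \<Rightarrow> 'k::comm_ring_1 cfree" where
  "fr i = gen (if i = 1 then F1 else F2)"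

definition hh :: "nat \<Rightarrow> 'k::comm_ring_1 cfree" where
  "hh i = ee i - ee (i + 1)"

definition CC :: "'k::comm_ring_1 cfree" where
  "CC = ee 1 + ee 2 + ee 3"

definition comm :: "'a::ring \<Rightarrow> 'a \<Rightarrow> 'a" where
  "comm x y = x * y - y * x"

definition wt :: "nat \<Rightarrow> nat \<Rightarrow> complex" where
  "wt i j = of_bool (i = j) - of_bool (i = j + 1)"

definition q_serre :: "'k::comm_complex_algebra cfree \<Rightarrow> 'k cfree \<Rightarrow> 'k cfree" where
  "q_serre x y = x ^ 2 * y - scal (qq + 1 \<oslash> qq) * (x * y * x) + y * x ^ 2"

text \<open>The elements which are set to zero.\<close>

definition relators :: "'k::comm_complex_algebra cfree set" where
  "relators =
     {comm (ee i) (ee j) | i j. i \<in> {1..3} \<and> j \<in> {1..3}} \<union>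
     {comm (ee i) (er j) - cst (wt i j) * er j | i j. i \<in> {1..3} \<and> j \<in> {1..2}} \<union>
     {comm (ee i) (fr j) + cst (wt i j) * fr j | i j. i \<in> {1..3} \<and> j \<in> {1..2}} \<union>
     {comm (er i) (fr j) - cst (of_bool (i = j)) * ((q_pow (hh i) - q_pow (- hh i)) \<oslash> scal omega)
        | i j. i \<in> {1..2} \<and> j \<in> {1..2}} \<union>
     {q_serre (er k) (er l) | k l. k \<in> {1..2} \<and> l \<in> {1..2} \<and> k \<noteq> l} \<union>
     {q_serre (fr k) (fr l) | k l. k \<in> {1..2} \<and> l \<in> {1..2} \<and> k \<noteq> l}"

inductive_set two_sided_ideal :: "'a::ring_1 set \<Rightarrow> 'a set" for S where
  zero: "0 \<in> two_sided_ideal S"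
| gen: "r \<in> S \<Longrightarrow> a * r * b \<in> two_sided_ideal S"
| add: "\<lbrakk>x \<in> two_sided_ideal S; y \<in> two_sided_ideal S\<rbrakk> \<Longrightarrow> x + y \<in> two_sided_ideal S"

text \<open>The \<open>\<gamma>\<close>-adically complete algebra U defined by the generators and relations is the quotient
  of \<open>'k cfree\<close> by the \<open>\<gamma>\<close>-adic closure of the ideal generated by the relators. Likewise the
  completed tensor square and cube of U are the quotients of \<open>'k cfree2\<close> and \<open>'k cfree3\<close> by the
  closed ideal generated by the relators placed in any one of the tensor factors.
  Elements of these quotients are handled through representatives, and equality in
  the n-th completed tensor power of U is the congruence \<open>\<approx>\<^sub>n\<close>. Accordingly the structure maps
  are given on the completed free algebras, by their values on the generators.\<close>

definition eqU1 :: "'k::comm_complex_algebra cfree \<Rightarrow> 'k cfree \<Rightarrow> bool" (infix "\<approx>\<^sub>1" 50) where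
  "x \<approx>\<^sub>1 y \<longleftrightarrow> x - y \<in> closure (two_sided_ideal relators)"

definition eqU2 :: "'k::comm_complex_algebra cfree2 \<Rightarrow> 'k cfree2 \<Rightarrow> bool" (infix "\<approx>\<^sub>2" 50) where
  "x \<approx>\<^sub>2 y \<longleftrightarrow> x - y \<in> closure (two_sided_ideal (leg1 ` relators \<union> leg2 ` relators))"

definition eqU3 :: "'k::comm_complex_algebra cfree3 \<Rightarrow> 'k cfree3 \<Rightarrow> bool" (infix "\<approx>\<^sub>3" 50) where
  "x \<approx>\<^sub>3 y \<longleftrightarrow> x - y \<in> closure (two_sided_ideal
     (leg12 ` leg1 ` relators \<union> leg12 ` leg2 ` relators \<union> leg23 ` leg2 ` relators))"


section \<open>Coproduct, counit, twisting, universal R-matrices\<close>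

fun Delta_gen :: "generator \<Rightarrow> 'k::comm_complex_algebra cfree2" where
  "Delta_gen E11 = ee 1 \<otimes> 1 + 1 \<otimes> ee 1"
| "Delta_gen E22 = ee 2 \<otimes> 1 + 1 \<otimes> ee 2"
| "Delta_gen E33 = ee 3 \<otimes> 1 + 1 \<otimes> ee 3"
| "Delta_gen E1 = er 1 \<otimes> q_pow (hh 1) + 1 \<otimes> er 1"
| "Delta_gen E2 = er 2 \<otimes> q_pow (hh 2) + 1 \<otimes> er 2"
| "Delta_gen F1 = fr 1 \<otimes> 1 + q_pow (- hh 1) \<otimes> fr 1"
| "Delta_gen F2 = fr 2 \<otimes> 1 + q_pow (- hh 2) \<otimes> fr 2"

fun Delta_word :: "gword \<Rightarrow> 'k::comm_complex_algebra cfree2" where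
  "Delta_word (Word gs) = prod_list (map Delta_gen gs)"

definition Delta :: "'k::comm_complex_algebra cfree \<Rightarrow> 'k cfree2" where
  "Delta = lin_ext Delta_word"

fun counit_gen :: "generator \<Rightarrow> 'k::comm_ring_1 fps" where
  "counit_gen _ = 0"

fun counit_word :: "gword \<Rightarrow> 'k::comm_ring_1 fps" where
  "counit_word (Word gs) = prod_list (map counit_gen gs)"

definition counit_tens_id :: "'k::comm_ring_1 cfree2 \<Rightarrow> 'k cfree" where
  "counit_tens_id = lin_ext (\<lambda>(u, v). scal (counit_word u) * mono_of v)"

definition id_tens_counit :: "'k::comm_ring_1 cfree2 \<Rightarrow> 'k cfree" where
  "id_tens_counit = lin_ext (\<lambda>(u, v). scal (counit_word v) * mono_of u)"

definition tens_id :: "('k::comm_ring_1 cfree \<Rightarrow> 'k cfree2) \<Rightarrow> 'k cfree2 \<Rightarrow> 'k cfree3" where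
  "tens_id D = lin_ext (\<lambda>(u, v). leg12 (D (mono_of u)) * mono_of (0, 0, v))"

definition id_tens :: "('k::comm_ring_1 cfree \<Rightarrow> 'k cfree2) \<Rightarrow> 'k cfree2 \<Rightarrow> 'k cfree3" where
  "id_tens D = lin_ext (\<lambda>(u, v). mono_of (u, 0, 0) * leg23 (D (mono_of v)))"

definition inverse_in_U2 :: "'k::comm_complex_algebra cfree2 \<Rightarrow> 'k cfree2 \<Rightarrow> bool" where
  "inverse_in_U2 x y \<longleftrightarrow> x * y \<approx>\<^sub>2 1 \<and> y * x \<approx>\<^sub>2 1"

definition twisting_element :: "'k::comm_complex_algebra cfree2 \<Rightarrow> bool" where
  "twisting_element F \<longleftrightarrow>
     (\<exists>G. inverse_in_U2 F G) \<and>
     counit_tens_id F \<approx>\<^sub>1 1 \<and> id_tens_counit F \<approx>\<^sub>1 1 \<and>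
     leg12 F * tens_id Delta F \<approx>\<^sub>3 leg23 F * id_tens Delta F"

text \<open>The twisted coproduct; G represents the inverse of F.\<close>

definition twisted_Delta ::
  "'k::comm_complex_algebra cfree2 \<Rightarrow> 'k cfree2 \<Rightarrow> 'k cfree \<Rightarrow> 'k cfree2" where
  "twisted_Delta F G a = F * Delta a * G"

definition universal_R_matrix ::
  "('k::comm_complex_algebra cfree \<Rightarrow> 'k cfree2) \<Rightarrow> 'k cfree2 \<Rightarrow> bool" where
  "universal_R_matrix D R \<longleftrightarrow>
     (\<exists>R'. inverse_in_U2 R R') \<and>
     (\<forall>a. R * D a \<approx>\<^sub>2 flip (D a) * R) \<and>
     tens_id D R \<approx>\<^sub>3 leg13 R * leg23 R \<and>
     id_tens D R \<approx>\<^sub>3 leg13 R * leg12 R"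

text \<open>\<open>cartan_inv\<close> is the inverse of the Cartan matrix with diagonal entries 2 and off-diagonal
  entries -1.\<close>

definition cartan_inv :: "nat \<Rightarrow> nat \<Rightarrow> complex" where
  "cartan_inv i j = (if i = j then 2/3 else 1/3)"

definition t0 :: "'k::comm_complex_algebra cfree2" where
  "t0 = (\<Sum>i = 1..2. \<Sum>j = 1..2. cst (cartan_inv i j) * (hh i \<otimes> hh j))"

definition e13 :: "'k::comm_complex_algebra cfree" where
  "e13 = er 1 * er 2 - scal qq * (er 2 * er 1)"

definition f13 :: "'k::comm_complex_algebra cfree" where
  "f13 = fr 2 * fr 1 - scal (1 \<oslash> qq) * (fr 1 * fr 2)"

definition RS_univ :: "'k::comm_complex_algebra cfree2" where
  "RS_univ = q_pow t0 *
     q_exp (1 \<oslash> qq ^ 2) (scal omega * (er 2 \<otimes> fr 2)) *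
     q_exp (1 \<oslash> qq ^ 2) (scal omega * (e13 \<otimes> f13)) *
     q_exp (1 \<oslash> qq ^ 2) (scal omega * (er 1 \<otimes> fr 1))"


section \<open>The twist\<close>

definition e1_tilde :: "'k::comm_complex_algebra cfree" where
  "e1_tilde = er 1 * q_pow (cst (1/2) * (ee 1 + ee 2))"

definition f2_tilde :: "'k::comm_complex_algebra cfree" where
  "f2_tilde = fr 2 * q_pow (cst (1/2) * (ee 2 + ee 3))"

definition twist1 :: "'k::comm_complex_algebra cfree2" where
  "twist1 = exp_ad (cst (1/2) * scal fps_X *
     (ee 1 \<and>\<^sub>\<otimes> ee 2 + ee 1 \<and>\<^sub>\<otimes> ee 3 + ee 2 \<and>\<^sub>\<otimes> ee 3))"

definition twist2 :: "'k::comm_complex_algebra fps \<Rightarrow> 'k cfree2" where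
  "twist2 \<mu> = q_exp (qq ^ 2) (scal \<mu> * (e1_tilde \<otimes> f2_tilde)) * q_pow (2 * (ee 1 \<otimes> ee 3))"

definition twist3 :: "'k::comm_complex_algebra fps \<Rightarrow> 'k cfree2" where
  "twist3 B = exp_ad (scal B * ((ee 1 - ee 3) \<and>\<^sub>\<otimes> CC))"

definition twist :: "'k::comm_complex_algebra fps \<Rightarrow> 'k fps \<Rightarrow> 'k cfree2" where
  "twist \<mu> B = twist3 B * twist2 \<mu> * twist1"


section \<open>The fundamental representation and the Cremmer-Gervais R-matrix\<close>

text \<open>The index set is the numeral type \<^typ>\<open>3\<close>, in which \<open>3 = 0\<close>; the matrix units are therefore
  indexed by natural numbers 1, 2, 3 and all order comparisons are made on \<^typ>\<open>nat\<close>.\<close>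

definition mat_unit :: "nat \<Rightarrow> nat \<Rightarrow> 'a::zero_neq_one ^ 3 ^ 3" where
  "mat_unit i j = (\<chi> a b. if a = of_nat i \<and> b = of_nat j then 1 else 0)"

definition kron :: "'a::times ^ 3 ^ 3 \<Rightarrow> 'a ^ 3 ^ 3 \<Rightarrow> 'a ^ (3 \<times> 3) ^ (3 \<times> 3)" (infix "\<otimes>\<^sub>m" 75) where
  "A \<otimes>\<^sub>m B = (\<chi> a b. vec_nth (vec_nth A (fst a)) (fst b) * vec_nth (vec_nth B (snd a)) (snd b))"

definition mat_scale :: "'a::times \<Rightarrow> 'a ^ 'n ^ 'm \<Rightarrow> 'a ^ 'n ^ 'm" (infixr "\<cdot>\<^sub>m" 72) where
  "c \<cdot>\<^sub>m A = (\<chi> a b. c * vec_nth (vec_nth A a) b)"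

fun rho_gen :: "generator \<Rightarrow> 'k::comm_ring_1 ^ 3 ^ 3" where
  "rho_gen E11 = mat_unit 1 1"
| "rho_gen E22 = mat_unit 2 2"
| "rho_gen E33 = mat_unit 3 3"
| "rho_gen E1 = mat_unit 1 2"
| "rho_gen E2 = mat_unit 2 3"
| "rho_gen F1 = mat_unit 2 1"
| "rho_gen F2 = mat_unit 3 2"

fun rho_word :: "gword \<Rightarrow> 'k::comm_ring_1 ^ 3 ^ 3" where
  "rho_word (Word gs) = foldr (\<lambda>g M. rho_gen g ** M) gs (mat 1)"

text \<open>\<open>\<rho> \<otimes> \<rho>\<close>, extended coefficientwise in \<open>\<gamma>\<close> (the matrices of words do not involve \<open>\<gamma>\<close>).\<close>

definition rho2 :: "'k::comm_ring_1 cfree2 \<Rightarrow> 'k fps ^ (3 \<times> 3) ^ (3 \<times> 3)" where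
  "rho2 x = (\<chi> a b. Abs_fps (\<lambda>n.
     \<Sum>(u, v)\<in>Poly_Mapping.keys (fps_nth x n).
       Poly_Mapping.lookup (fps_nth x n) (u, v) * vec_nth (vec_nth (rho_word u \<otimes>\<^sub>m rho_word v) a) b))"

definition RS_mat :: "'k::comm_complex_algebra fps ^ (3 \<times> 3) ^ (3 \<times> 3)" where
  "RS_mat = qq \<cdot>\<^sub>m (\<Sum>i = 1..3. mat_unit i i \<otimes>\<^sub>m mat_unit i i)
     + (\<Sum>(i, j) | i \<in> {1..3} \<and> j \<in> {1..3} \<and> i \<noteq> j. mat_unit i i \<otimes>\<^sub>m mat_unit j j)
     + omega \<cdot>\<^sub>m (\<Sum>(i, j) | i \<in> {1..3} \<and> j \<in> {1..3} \<and> i < j. mat_unit i j \<otimes>\<^sub>m mat_unit j i)"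

definition RCG_mat ::
  "'k::comm_complex_algebra fps \<Rightarrow> 'k fps \<Rightarrow> 'k fps ^ (3 \<times> 3) ^ (3 \<times> 3)" where
  "RCG_mat p \<nu> = RS_mat
     + (p - 1) \<cdot>\<^sub>m (mat_unit 1 1 \<otimes>\<^sub>m mat_unit 2 2 + mat_unit 2 2 \<otimes>\<^sub>m mat_unit 3 3)
     + (1 \<oslash> p - 1) \<cdot>\<^sub>m (mat_unit 2 2 \<otimes>\<^sub>m mat_unit 1 1 + mat_unit 3 3 \<otimes>\<^sub>m mat_unit 2 2)
     + (p ^ 2 \<oslash> qq - 1) \<cdot>\<^sub>m (mat_unit 1 1 \<otimes>\<^sub>m mat_unit 3 3)
     + (qq \<oslash> p ^ 2 - 1) \<cdot>\<^sub>m (mat_unit 3 3 \<otimes>\<^sub>m mat_unit 1 1)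
     + (qq * \<nu>) \<cdot>\<^sub>m (mat_unit 3 2 \<otimes>\<^sub>m mat_unit 1 2
          - (p ^ 2 \<oslash> qq ^ 2) \<cdot>\<^sub>m (mat_unit 1 2 \<otimes>\<^sub>m mat_unit 3 2))"

end

theory Submission
  imports Defs
begin

text \<open>Every exponential is a \<open>\<gamma>\<close>-adically convergent series, and identities between them hold modulo
  the closed ideal of relations because they hold term by term. The one non-formal input is the
  q-binomial theorem \<open>exp\<^sub>s(u + v) = exp\<^sub>s(v) exp\<^sub>s(u)\<close> for \<open>u v = s v u\<close>. Moving the Cartan factors of
  \<open>F\<close> to the outside splits each of the two iterated coproducts of the middle factor into two
  summands, and both sides of the cocycle identity become
  \<open>K exp\<^sub>s(\<mu>P) exp\<^sub>s(\<mu>M) exp\<^sub>s(\<mu>Q) K'\<close> with \<open>s = q\<^sup>2\<close>, \<open>P = e \<otimes> f \<otimes> 1\<close>, \<open>M = 1 \<otimes> e \<otimes> f\<close>,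
  \<open>Q = e \<otimes> q\<^bsup>2(e11 + e33)\<^esup> \<otimes> f\<close> (\<open>e\<close>, \<open>f\<close> being the modified generators), \<open>QP = s PQ\<close>,
  \<open>QM = s MQ\<close> and \<open>PM = MP\<close>. The axioms of the twisted R-matrix follow
  from those of the original one by permuting tensor factors in the cocycle identity. In the
  fundamental representation the twist is diagonal apart from one matrix unit, and
  the parameters are \<open>c = q\<^bsup>-1/3\<^esup>\<close>, \<open>p = q\<^sup>-\<^sup>1 e\<^bsup>-2B\<^esup>\<close>, \<open>\<nu> = q e\<^bsup>2B\<^esup> \<mu>\<close>.\<close>

text \<open>No basis of U is established, so a priori the quotient may have \<gamma>-torsion and
  omega may be a zero divisor in it. Divisions are therefore carried out in the completed free
  algebra, where \<gamma> cancels, and only their results are projected. For the same reason the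
  coproduct, the permutations of tensor factors and the representation live on representatives, and
  each has to be shown to send relators into the closed ideal. Since \<mu> and B are multiples of
  \<gamma>, every series is a sum of \<gamma>^n t_n with arbitrary t_n, so convergence is automatic.
  The base q^2 fits because e_1 and f_2 both raise e_11 + e_33 by one. The constants are read off
  from matrix entries: c comes from t_0, which acts as the sum of the E_ii \<otimes> E_ii minus 1/3;
  p is the quotient of the eigenvalues of the twist on v_2 \<otimes> v_1 and v_1 \<otimes> v_2;
  \<nu> is the off-diagonal entry of the twist. That R_S is a universal R-matrix for the untwisted
  coproduct belongs to the given data and enters as a hypothesis.\<close>

unbundle no vec_syntax
unbundle fps_syntax

section \<open>Convergent series in rings of formal power series\<close>

text \<open>The \<gamma>-adic topology is separated. Identities between infinite sums are proved by
  this test, the tails being divisible by \<gamma>^N.\<close>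

lemma fps_eqI_mod:
  fixes x y :: "'a::ring_1 fps"
  assumes "\<And>N. \<exists>z. x - y = fps_X ^ N * z"
  shows "x = y"
proof (rule fps_ext)
  fix n
  obtain z where "x - y = fps_X ^ Suc n * z" using assms by blast
  then have "(x - y) $ n = 0" by (simp only: fps_X_power_mult_nth) simp
  then show "x $ n = y $ n" by simp
qed

text \<open>Compatibility with addition and with multiplication by \<gamma> already forces
  \<gamma>-adic continuity, since multiples of \<gamma>^N go to multiples of \<gamma>^N. Linearity
  over K is not included.\<close>

definition X_linear :: "('a::ring_1 fps \<Rightarrow> 'b::ring_1 fps) \<Rightarrow> bool" where
  "X_linear f \<longleftrightarrow> (\<forall>x y. f (x + y) = f x + f y) \<and> (\<forall>x. f (fps_X * x) = fps_X * f x)"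

lemma X_linear_add: "X_linear f \<Longrightarrow> f (x + y) = f x + f y"
  by (simp add: X_linear_def)

lemma X_linear_X: "X_linear f \<Longrightarrow> f (fps_X * x) = fps_X * f x"
  by (simp add: X_linear_def)

lemma X_linear_zero: "X_linear f \<Longrightarrow> f 0 = 0"
  using X_linear_add[of f 0 0] by simp

lemma X_linear_sum: "X_linear f \<Longrightarrow> f (\<Sum>i\<in>A. g i) = (\<Sum>i\<in>A. f (g i))"
  by (induction A rule: infinite_finite_induct) (simp_all add: X_linear_zero X_linear_add)

lemma X_linear_X_power: "X_linear f \<Longrightarrow> f (fps_X ^ n * x) = fps_X ^ n * f x"
  by (induction n) (simp_all add: mult.assoc X_linear_X)

lemma X_linear_mult_right: "X_linear (\<lambda>x. x * y)"
  by (simp add: X_linear_def distrib_right mult.assoc)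

lemma X_linear_mult_left: "X_linear (\<lambda>x. y * x)"
  unfolding X_linear_def by (metis distrib_left fps_mult_fps_X_commute mult.assoc)

lemma X_linear_comp: "X_linear f \<Longrightarrow> X_linear g \<Longrightarrow> X_linear (\<lambda>x. f (g x))"
  by (simp add: X_linear_def)

lemma mult_X_power_left: "y * (fps_X ^ n * x) = fps_X ^ n * (y * (x::'a::ring_1 fps))"
  by (metis fps_mult_fps_X_power_commute mult.assoc)

lemma X_mult_power: "(fps_X * x) ^ n = fps_X ^ n * (x::'a::ring_1 fps) ^ n"
proof (induction n)
  case (Suc n)
  then have "(fps_X * x) ^ Suc n = fps_X * (x * (fps_X ^ n * x ^ n))" by (simp add: mult.assoc)
  then show ?case by (simp add: mult_X_power_left mult.assoc)
qed simp

text \<open>The sum of \<gamma>^n t_n, where the t_n may themselves involve \<gamma>. Coefficient k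
  receives contributions from n \<le> k only, so the sum exists for every sequence and no
  convergence condition has to be carried along.\<close>

definition xser :: "(nat \<Rightarrow> 'a::ring_1 fps) \<Rightarrow> 'a fps" where
  "xser t = Abs_fps (\<lambda>k. \<Sum>n\<le>k. t n $ (k - n))"

lemma suminf_eq_xser: "suminf (\<lambda>n. fps_X ^ n * t n) = xser t"
proof (rule sums_unique[symmetric])
  show "(\<lambda>n. fps_X ^ n * t n) sums xser t"
    unfolding sums_def
  proof (rule tendsto_fpsI)
    fix k
    show "\<forall>\<^sub>F N in sequentially. (\<Sum>n<N. fps_X ^ n * t n) $ k = xser t $ k"
    proof (rule eventually_sequentiallyI[of "Suc k"])
      fix N assume N: "Suc k \<le> N"
      have "(\<Sum>n<N. fps_X ^ n * t n) $ k = (\<Sum>n<N. if k < n then 0 else t n $ (k - n))"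
        by (simp add: fps_sum_nth fps_X_power_mult_nth)
      also have "\<dots> = (\<Sum>n\<le>k. t n $ (k - n))"
        by (rule sum.mono_neutral_cong_right) (use N in auto)
      finally show "(\<Sum>n<N. fps_X ^ n * t n) $ k = xser t $ k" by (simp add: xser_def)
    qed
  qed
qed

lemma xser_rec: "xser t = t 0 + fps_X * xser (\<lambda>n. t (Suc n))"
proof (rule fps_ext)
  fix k
  show "xser t $ k = (t 0 + fps_X * xser (\<lambda>n. t (Suc n))) $ k"
    by (cases k) (simp_all add: xser_def sum.atMost_Suc_shift del: sum.atMost_Suc)
qed

lemma xser_split: "xser t = (\<Sum>n<N. fps_X ^ n * t n) + fps_X ^ N * xser (\<lambda>n. t (n + N))"
proof (induction N)
  case (Suc N)
  have "xser (\<lambda>n. t (n + N)) = t N + fps_X * xser (\<lambda>n. t (n + Suc N))"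
    by (subst xser_rec) simp
  with Suc show ?case
    by (simp add: distrib_left add.assoc mult.assoc) (simp add: mult.assoc[symmetric] power_commutes)
qed simp

lemma X_linear_xser: "X_linear f \<Longrightarrow> f (xser t) = xser (\<lambda>n. f (t n))"
proof (rule fps_eqI_mod)
  fix N assume f: "X_linear f"
  have "f (xser t) - xser (\<lambda>n. f (t n)) =
      fps_X ^ N * (f (xser (\<lambda>n. t (n + N))) - xser (\<lambda>n. f (t (n + N))))"
    by (subst (1 2) xser_split[where N = N])
       (simp add: f X_linear_add X_linear_sum X_linear_X_power right_diff_distrib)
  then show "\<exists>z. f (xser t) - xser (\<lambda>n. f (t n)) = fps_X ^ N * z" by blast
qed

lemma xser_mult_right: "xser t * y = xser (\<lambda>n. t n * y)"
  using X_linear_xser[OF X_linear_mult_right] .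

lemma xser_mult_left: "y * xser t = xser (\<lambda>n. y * t n)"
  using X_linear_xser[OF X_linear_mult_left] .

lemma xser_add: "xser t + xser t' = xser (\<lambda>n. t n + t' n)"
  by (rule fps_ext) (simp add: xser_def sum.distrib)

lemma xser_diff: "xser t - xser t' = xser (\<lambda>n. t n - t' n)"
  by (rule fps_ext) (simp add: xser_def sum_subtractf)

lemma xser_single: "xser (\<lambda>n. if n = 0 then a else 0) = a"
  by (subst xser_rec) (simp, simp add: xser_def fps_eq_iff)

lemma xser_two: "xser (\<lambda>n. if n = 0 then a else if n = 1 then b else 0) = a + fps_X * b"
  by (subst xser_rec) (simp add: xser_single)

text \<open>Regrouping by total degree: removing row \<open>g 0\<close> from both sides leaves the
  same claim for the shifted family, multiplied by \<gamma>, so N rounds give agreement modulo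
  \<gamma>^N.\<close>

lemma xser_xser: "xser (\<lambda>n. xser (g n)) = xser (\<lambda>n. \<Sum>k\<le>n. g k (n - k))"
proof (rule fps_eqI_mod)
  fix N
  show "\<exists>z. xser (\<lambda>n. xser (g n)) - xser (\<lambda>n. \<Sum>k\<le>n. g k (n - k)) = fps_X ^ N * z"
  proof (induction N arbitrary: g)
    case (Suc N)
    obtain z where z: "xser (\<lambda>n. xser (g (Suc n))) - xser (\<lambda>n. \<Sum>k\<le>n. g (Suc k) (n - k))
        = fps_X ^ N * z"
      using Suc[of "\<lambda>n. g (Suc n)"] by blast
    have "xser (\<lambda>n. \<Sum>k\<le>n. g k (n - k)) =
        g 0 0 + fps_X * xser (\<lambda>n. g 0 (Suc n) + (\<Sum>k\<le>n. g (Suc k) (n - k)))"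
      by (subst xser_rec) (simp add: sum.atMost_Suc_shift del: sum.atMost_Suc)
    also have "\<dots> = xser (g 0) + fps_X * xser (\<lambda>n. \<Sum>k\<le>n. g (Suc k) (n - k))"
      by (subst (2) xser_rec) (simp add: xser_add[symmetric] distrib_left add.assoc)
    finally have "xser (\<lambda>n. xser (g n)) - xser (\<lambda>n. \<Sum>k\<le>n. g k (n - k)) = fps_X ^ Suc N * z"
      by (subst xser_rec) (simp add: mult.assoc z[symmetric] right_diff_distrib)
    then show ?case by blast
  qed simp
qed

lemma xser_mult: "xser t * xser t' = xser (\<lambda>n. \<Sum>k\<le>n. t k * t' (n - k))"
  by (subst xser_mult_right) (simp add: xser_mult_left xser_xser)

lemma xser_const: "xser (\<lambda>n. fps_const (x $ n)) = x"
proof (rule fps_ext)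
  fix k
  have "(\<Sum>n\<le>k. if k - n = 0 then x $ n else 0) = (\<Sum>n\<in>{k}. x $ n)"
    by (rule sum.mono_neutral_cong_right) auto
  then show "xser (\<lambda>n. fps_const (x $ n)) $ k = x $ k" by (simp add: xser_def)
qed

text \<open>A power series is \<open>xser\<close> of its own coefficients, regarded as constants,
  and \<open>X_linear\<close> maps commute with \<open>xser\<close>.\<close>

lemma X_linear_eqI_const:
  assumes "X_linear f" "X_linear g" "\<And>a. f (fps_const a) = g (fps_const a)"
  shows "f x = g x"
  using X_linear_xser[OF assms(1), of "\<lambda>n. fps_const (x $ n)"]
    X_linear_xser[OF assms(2), of "\<lambda>n. fps_const (x $ n)"]
  by (simp add: assms(3) xser_const)


section \<open>Scalars and continuous linear extensions\<close>

lemma of_cplx_0 [simp]: "of_cplx 0 = 0"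
  using of_cplx_add[of 0 0] by simp

lemma of_cplx_minus: "of_cplx (- x) = - of_cplx x"
  using of_cplx_add[of x "- x"] by (simp add: eq_neg_iff_add_eq_0 add.commute)

lemma of_cplx_of_nat: "of_cplx (of_nat n) = of_nat n"
  by (induction n) (simp_all add: of_cplx_add of_cplx_1)

lemma single_0_commute: "Poly_Mapping.single 0 (a::'k::comm_ring_1) * p = p * Poly_Mapping.single 0 a"
proof (rule poly_mapping_eqI)
  have "p = (\<Sum>w\<in>Poly_Mapping.keys p. Poly_Mapping.single w (Poly_Mapping.lookup p w))"
    by (rule poly_mapping_eqI) (simp add: lookup_sum lookup_single when_def in_keys_iff)
  then obtain g where p: "p = (\<Sum>w\<in>Poly_Mapping.keys p. Poly_Mapping.single w (g w))" by blast
  show "Poly_Mapping.lookup (Poly_Mapping.single 0 a * p) k = Poly_Mapping.lookup (p * Poly_Mapping.single 0 a) k" for k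
    by (subst (1 2) p) (simp add: sum_distrib_left sum_distrib_right mult_single mult.commute)
qed

lemma scal_nth [simp]: "scal c $ n = Poly_Mapping.single 0 (c $ n)"
  by (simp add: scal_def)

lemma scal_add: "scal (c + d) = scal c + scal d"
  by (rule fps_ext) (simp add: single_add)

lemma scal_minus: "scal (- c) = - scal c"
  by (rule fps_ext) (simp add: single_uminus)

lemma scal_0 [simp]: "scal 0 = 0"
  by (rule fps_ext) simp

lemma scal_1 [simp]: "scal 1 = 1"
  by (rule fps_ext) simp

lemma single_0_sum: "Poly_Mapping.single 0 (sum f A) = (\<Sum>x\<in>A. Poly_Mapping.single 0 (f x))"
  by (induction A rule: infinite_finite_induct) (simp_all add: single_add)

lemma scal_mult: "scal (c * d) = scal c * scal d"
  by (rule fps_ext) (simp add: fps_mult_nth single_0_sum mult_single)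

lemma scal_power: "scal (c ^ n) = scal c ^ n"
  by (induction n) (simp_all add: scal_mult)

lemma scal_X [simp]: "scal fps_X = fps_X"
  by (rule fps_ext) simp

lemma scal_commute: "scal c * x = x * scal c"
proof (rule fps_ext)
  fix n
  have "(\<Sum>i=0..n. scal c $ i * x $ (n - i)) = (\<Sum>i=0..n. scal c $ (n - i) * x $ i)"
    by (subst sum.atLeastAtMost_rev) simp
  then show "(scal c * x) $ n = (x * scal c) $ n"
    by (simp add: fps_mult_nth single_0_commute)
qed

lemma mult_scal_left: "x * (scal c * y) = scal c * (x * y)"
  by (metis mult.assoc scal_commute)

lemma X_linear_scal: "X_linear scal"
  by (simp add: X_linear_def scal_add scal_mult)

lemma cst_1 [simp]: "cst 1 = 1"
  by (simp add: cst_def of_cplx_1)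

lemma cst_0 [simp]: "cst 0 = 0"
  by (simp add: cst_def)

lemma mono_of_0 [simp]: "mono_of 0 = 1"
  by (simp add: mono_of_def)

lemma mono_of_add: "mono_of (u + v) = mono_of u * mono_of v"
  by (simp add: mono_of_def mult_single)

lemma scal_const: "scal (fps_const a) = fps_const (Poly_Mapping.single 0 a)"
  by (rule fps_ext) simp

lemma scal_const_mono_of:
  "scal (fps_const a) * mono_of w = fps_const (Poly_Mapping.single w a)"
  by (simp add: scal_const mono_of_def mult_single)

text \<open>Every coefficient is a finite sum of scaled monomials. The scalar stays in the test
  elements because an \<open>X_linear\<close> map need not be K-linear.\<close>

lemma X_linear_eqI:
  fixes f g :: "('m::monoid_add \<Rightarrow>\<^sub>0 'k::comm_ring_1) fps \<Rightarrow> 'b::ring_1 fps"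
  assumes f: "X_linear f" and g: "X_linear g"
    and eq: "\<And>a w. f (scal (fps_const a) * mono_of w) = g (scal (fps_const a) * mono_of w)"
  shows "f x = g x"
proof (rule X_linear_eqI_const[OF f g])
  fix p :: "'m \<Rightarrow>\<^sub>0 'k"
  let ?l = "Poly_Mapping.lookup p"
  have "p = (\<Sum>w\<in>Poly_Mapping.keys p. Poly_Mapping.single w (?l w))"
    by (rule poly_mapping_eqI) (simp add: lookup_sum lookup_single when_def in_keys_iff)
  then have "fps_const p = fps_const (\<Sum>w\<in>Poly_Mapping.keys p. Poly_Mapping.single w (?l w))"
    by simp
  also have "\<dots> = (\<Sum>w\<in>Poly_Mapping.keys p. scal (fps_const (?l w)) * mono_of w)"
    by (rule fps_ext) (simp add: fps_sum_nth scal_const_mono_of)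
  finally show "f (fps_const p) = g (fps_const p)"
    by (simp add: X_linear_sum f g eq)
qed

lemma lin_ext_eq_xser:
  "lin_ext \<phi> x = xser (\<lambda>n. \<Sum>w\<in>Poly_Mapping.keys (x $ n).
     scal (fps_const (Poly_Mapping.lookup (x $ n) w)) * \<phi> w)"
proof -
  have "(\<Sum>w\<in>Poly_Mapping.keys (x $ n). scal (fps_const (Poly_Mapping.lookup (x $ n) w) * fps_X ^ n) * \<phi> w)
    = fps_X ^ n * (\<Sum>w\<in>Poly_Mapping.keys (x $ n). scal (fps_const (Poly_Mapping.lookup (x $ n) w)) * \<phi> w)" for n
    by (simp only: sum_distrib_left scal_mult scal_power scal_X mult.assoc mult_X_power_left)
  then show ?thesis unfolding lin_ext_def by (simp add: suminf_eq_xser)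
qed

lemma keys_sum_superset:
  assumes "finite S" "Poly_Mapping.keys p \<subseteq> S"
  shows "(\<Sum>w\<in>Poly_Mapping.keys p. scal (fps_const (Poly_Mapping.lookup p w)) * \<phi> w)
    = (\<Sum>w\<in>S. scal (fps_const (Poly_Mapping.lookup p w)) * \<phi> w)"
  by (rule sum.mono_neutral_left) (use assms in \<open>auto simp: in_keys_iff\<close>)

lemma X_linear_lin_ext: "X_linear (lin_ext \<phi>)"
  unfolding X_linear_def
proof (intro conjI allI)
  fix x y
  have "(\<Sum>w\<in>Poly_Mapping.keys (p + q). scal (fps_const (Poly_Mapping.lookup (p + q) w)) * \<phi> w)
    = (\<Sum>w\<in>Poly_Mapping.keys p. scal (fps_const (Poly_Mapping.lookup p w)) * \<phi> w)
    + (\<Sum>w\<in>Poly_Mapping.keys q. scal (fps_const (Poly_Mapping.lookup q w)) * \<phi> w)" for p q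
    by (subst (1 2 3) keys_sum_superset[where S = "Poly_Mapping.keys p \<union> Poly_Mapping.keys q"])
       (use keys_add[of p q] in \<open>auto simp: lookup_add sum.distrib[symmetric] distrib_right
          scal_add fps_const_add[symmetric] simp del: fps_const_add\<close>)
  then show "lin_ext \<phi> (x + y) = lin_ext \<phi> x + lin_ext \<phi> y"
    by (simp add: lin_ext_eq_xser xser_add)
  show "lin_ext \<phi> (fps_X * x) = fps_X * lin_ext \<phi> x"
    unfolding lin_ext_eq_xser by (subst xser_rec) simp
qed

lemma lin_ext_scal_const_mono_of:
  "lin_ext \<phi> (scal (fps_const a) * mono_of w) = scal (fps_const a) * \<phi> w"
  unfolding lin_ext_eq_xser scal_const_mono_of
  by (rule trans[OF _ xser_single]) (rule arg_cong[where f = xser], auto simp: fun_eq_iff)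

lemma lin_ext_mono_of [simp]: "lin_ext \<phi> (mono_of w) = \<phi> w"
  using lin_ext_scal_const_mono_of[of \<phi> 1 w] by simp

lemma lin_ext_scal_mult: "lin_ext \<phi> (scal c * x) = scal c * lin_ext \<phi> x"
proof -
  note X = X_linear_comp[OF X_linear_lin_ext X_linear_comp[OF X_linear_mult_right X_linear_scal]]
    X_linear_comp[OF X_linear_mult_right X_linear_scal]
    X_linear_comp[OF X_linear_lin_ext X_linear_mult_left]
    X_linear_comp[OF X_linear_mult_left X_linear_lin_ext]
  have "lin_ext \<phi> (scal (fps_const a) * x) = scal (fps_const a) * lin_ext \<phi> x" for a
    by (rule X_linear_eqI[OF X(3) X(4)])
       (simp add: mult.assoc[symmetric] scal_mult[symmetric] lin_ext_scal_const_mono_of)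
  then show ?thesis
    by (rule X_linear_eqI_const[OF X(1) X(2)])
qed

text \<open>Continuity need not be demanded: fixing the scalars includes fixing \<gamma>, so such a
  map is \<open>X_linear\<close> and commutes with all series.\<close>

definition alg_hom ::
  "(('m::monoid_add \<Rightarrow>\<^sub>0 'k::comm_ring_1) fps \<Rightarrow> ('n::monoid_add \<Rightarrow>\<^sub>0 'k) fps) \<Rightarrow> bool" where
  "alg_hom f \<longleftrightarrow> (\<forall>x y. f (x + y) = f x + f y) \<and> (\<forall>x y. f (x * y) = f x * f y) \<and>
     (\<forall>c. f (scal c) = scal c)"

lemma alg_hom_add: "alg_hom f \<Longrightarrow> f (x + y) = f x + f y"
  and alg_hom_mult: "alg_hom f \<Longrightarrow> f (x * y) = f x * f y"
  and alg_hom_scal: "alg_hom f \<Longrightarrow> f (scal c) = scal c"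
  by (simp_all add: alg_hom_def)

lemma alg_hom_X_linear: "alg_hom f \<Longrightarrow> X_linear f"
  unfolding X_linear_def alg_hom_def by (metis scal_X)

lemma alg_hom_1: "alg_hom f \<Longrightarrow> f 1 = 1"
  using alg_hom_scal[of f 1] by simp

lemma alg_hom_0: "alg_hom f \<Longrightarrow> f 0 = 0"
  using alg_hom_scal[of f 0] by simp

lemma alg_hom_X: "alg_hom f \<Longrightarrow> f fps_X = fps_X"
  using alg_hom_scal[of f fps_X] by simp

lemma alg_hom_cst: "alg_hom f \<Longrightarrow> f (cst z) = cst z"
  unfolding cst_def by (rule alg_hom_scal)

lemma alg_hom_minus:
  assumes f: "alg_hom f"
  shows "f (- x) = - f x"
  using alg_hom_add[OF f, of x "- x"] alg_hom_0[OF f] by (simp add: eq_neg_iff_add_eq_0 add.commute)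

lemma alg_hom_diff:
  assumes f: "alg_hom f"
  shows "f (x - y) = f x - f y"
  using alg_hom_add[OF f, of x "- y"] alg_hom_minus[OF f, of y] by simp

lemma alg_hom_power:
  assumes f: "alg_hom f"
  shows "f (x ^ n) = f x ^ n"
  by (induction n) (simp_all add: alg_hom_1[OF f] alg_hom_mult[OF f])

lemma alg_hom_numeral:
  assumes f: "alg_hom f"
  shows "f (numeral n) = numeral n"
  by (induction n) (simp_all only: numeral.simps alg_hom_1[OF f] alg_hom_add[OF f])

lemmas alg_hom_simps = alg_hom_add alg_hom_mult alg_hom_scal alg_hom_1 alg_hom_0 alg_hom_X
  alg_hom_cst alg_hom_minus alg_hom_diff alg_hom_power alg_hom_numeral

lemma alg_hom_comp: "alg_hom f \<Longrightarrow> alg_hom g \<Longrightarrow> alg_hom (\<lambda>x. f (g x))"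
  by (simp add: alg_hom_def)

lemma alg_hom_id: "alg_hom (\<lambda>x. x)"
  by (simp add: alg_hom_def)

lemma alg_hom_eqI:
  assumes "alg_hom f" "alg_hom g" "\<And>w. f (mono_of w) = g (mono_of w)"
  shows "f x = g x"
  by (rule X_linear_eqI)
     (simp_all add: assms alg_hom_X_linear alg_hom_mult[OF assms(1)] alg_hom_mult[OF assms(2)]
        alg_hom_scal[OF assms(1)] alg_hom_scal[OF assms(2)])

text \<open>Both sides of the product rule are \<open>X_linear\<close> in each argument separately,
  so they are compared on monomials, one argument after the other. Legs, permutations of factors,
  the coproduct and the counits all arise in this way.\<close>

lemma alg_hom_lin_ext:
  assumes 0: "\<phi> 0 = 1" and add: "\<And>u v. \<phi> (u + v) = \<phi> u * \<phi> v"
  shows "alg_hom (lin_ext \<phi>)"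
  unfolding alg_hom_def
proof (intro conjI allI)
  show "lin_ext \<phi> (x + y) = lin_ext \<phi> x + lin_ext \<phi> y" for x y
    by (rule X_linear_add[OF X_linear_lin_ext])
  show "lin_ext \<phi> (scal c) = scal c" for c
    using lin_ext_scal_mult[of \<phi> c 1] lin_ext_mono_of[of \<phi> 0] by (simp add: 0)
  show "lin_ext \<phi> (x * y) = lin_ext \<phi> x * lin_ext \<phi> y" for x y
  proof (rule X_linear_eqI[where x = x])
    show "X_linear (\<lambda>x. lin_ext \<phi> (x * y))"
      by (rule X_linear_comp[OF X_linear_lin_ext X_linear_mult_right])
    show "X_linear (\<lambda>x. lin_ext \<phi> x * lin_ext \<phi> y)"
      by (rule X_linear_comp[OF X_linear_mult_right X_linear_lin_ext])
    fix a u
    have "lin_ext \<phi> (mono_of u * y) = lin_ext \<phi> (mono_of u) * lin_ext \<phi> y"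
    proof (rule X_linear_eqI[where x = y])
      show "X_linear (\<lambda>y. lin_ext \<phi> (mono_of u * y))"
        by (rule X_linear_comp[OF X_linear_lin_ext X_linear_mult_left])
      show "X_linear (\<lambda>y. lin_ext \<phi> (mono_of u) * lin_ext \<phi> y)"
        by (rule X_linear_comp[OF X_linear_mult_left X_linear_lin_ext])
      fix b :: 'b and v
      have "mono_of u * (scal (fps_const b) * mono_of v) = scal (fps_const b) * mono_of (u + v)"
        by (simp only: mono_of_add mult_scal_left)
      then have "lin_ext \<phi> (mono_of u * (scal (fps_const b) * mono_of v)) =
          scal (fps_const b) * (\<phi> u * \<phi> v)"
        by (simp add: lin_ext_scal_mult add)
      also have "\<dots> = \<phi> u * (scal (fps_const b) * \<phi> v)"
        by (simp only: mult_scal_left)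
      finally show "lin_ext \<phi> (mono_of u * (scal (fps_const b) * mono_of v)) =
          lin_ext \<phi> (mono_of u) * lin_ext \<phi> (scal (fps_const b) * mono_of v)"
        by (simp add: lin_ext_scal_mult)
    qed
    then show "lin_ext \<phi> (scal (fps_const a) * mono_of u * y) =
        lin_ext \<phi> (scal (fps_const a) * mono_of u) * lin_ext \<phi> y"
      by (simp add: lin_ext_scal_mult mult.assoc)
  qed
qed

lemma q_pow_eq_xser: "q_pow x = xser (\<lambda>n. cst (1 / fact n) * x ^ n)"
  unfolding q_pow_def exp_ad_def scal_X X_mult_power mult_X_power_left by (rule suminf_eq_xser)

lemma q_exp_eq_xser: "q_exp s (fps_X * x) = xser (\<lambda>n. scal (1 \<oslash> q_fact n s) * x ^ n)"
  unfolding q_exp_def X_mult_power mult_X_power_left by (rule suminf_eq_xser)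

lemma exp_ad_X: "exp_ad (fps_X * x) = q_pow x"
  by (simp add: q_pow_def)

lemma alg_hom_q_pow:
  assumes f: "alg_hom f"
  shows "f (q_pow x) = q_pow (f x)"
  by (simp only: q_pow_eq_xser X_linear_xser[OF alg_hom_X_linear[OF f]] alg_hom_simps[OF f])

lemma alg_hom_q_exp:
  assumes f: "alg_hom f"
  shows "f (q_exp s (fps_X * x)) = q_exp s (fps_X * f x)"
  by (simp only: q_exp_eq_xser X_linear_xser[OF alg_hom_X_linear[OF f]] alg_hom_simps[OF f])

lemma q_pow_0 [simp]: "q_pow 0 = 1"
  unfolding q_pow_eq_xser
  by (rule trans[OF _ xser_single]) (rule arg_cong[where f = xser], auto simp: fun_eq_iff power_0_left)

section \<open>The quotient algebras\<close>

text \<open>\<open>legs\<close> lists the embeddings of the word monoid as a tensor factor, so that the algebra U and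
  its tensor square and cube are instances of one construction.\<close>

class rel_monoid = monoid_add +
  fixes legs :: "(gword \<Rightarrow> 'a) set"
  assumes legs_zero: "\<iota> \<in> legs \<Longrightarrow> \<iota> 0 = 0"
    and legs_add: "\<iota> \<in> legs \<Longrightarrow> \<iota> (u + v) = \<iota> u + \<iota> v"

instantiation gword :: rel_monoid
begin
definition legs_gword :: "(gword \<Rightarrow> gword) set" where "legs_gword = {\<lambda>u. u}"
instance by standard (simp_all add: legs_gword_def)
end

instantiation prod :: (rel_monoid, rel_monoid) rel_monoid
begin
definition legs_prod :: "(gword \<Rightarrow> 'a \<times> 'b) set" where
  "legs_prod = (\<lambda>\<iota> u. (\<iota> u, 0)) ` legs \<union> (\<lambda>\<iota> u. (0, \<iota> u)) ` legs"
instance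
  by standard (auto simp: legs_prod_def zero_prod_def legs_zero legs_add)
end

definition leg :: "(gword \<Rightarrow> 'm::monoid_add) \<Rightarrow> 'k::comm_ring_1 cfree \<Rightarrow> ('m \<Rightarrow>\<^sub>0 'k) fps" where
  "leg \<iota> = lin_ext (\<lambda>u. mono_of (\<iota> u))"

lemma alg_hom_leg:
  assumes "\<iota> 0 = 0" "\<And>u v. \<iota> (u + v) = \<iota> u + \<iota> v"
  shows "alg_hom (leg \<iota>)"
  unfolding leg_def by (rule alg_hom_lin_ext) (simp_all add: assms mono_of_add)

section \<open>The closed ideal of relations, tested modulo powers of \<gamma>\<close>

definition rels :: "('m::rel_monoid \<Rightarrow>\<^sub>0 'k::comm_complex_algebra) fps set" where
  "rels = (\<Union>\<iota>\<in>legs. leg \<iota> ` relators)"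

definition JJ :: "('m::rel_monoid \<Rightarrow>\<^sub>0 'k::comm_complex_algebra) fps set" where
  "JJ = closure (two_sided_ideal rels)"

lemma leg_id: "leg (\<lambda>u. u) x = x"
proof -
  have "alg_hom (leg (\<lambda>u::gword. u))" by (rule alg_hom_leg) simp_all
  then show ?thesis by (rule alg_hom_eqI[OF _ alg_hom_id]) (simp add: leg_def)
qed

lemma alg_hom_leg1: "alg_hom leg1" and alg_hom_leg2: "alg_hom leg2"
  unfolding leg1_def leg2_def
  by (rule alg_hom_lin_ext; simp add: zero_prod_def[symmetric] mono_of_add[symmetric] plus_prod_def)+

lemma alg_hom_leg12: "alg_hom leg12" and alg_hom_leg13: "alg_hom leg13" and alg_hom_leg23: "alg_hom leg23"
  unfolding leg12_def leg13_def leg23_def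
  by (rule alg_hom_lin_ext; simp add: case_prod_beta zero_prod_def[symmetric] mono_of_add[symmetric] plus_prod_def)+

lemma alg_hom_flip: "alg_hom flip"
  unfolding flip_def
  by (rule alg_hom_lin_ext; simp add: case_prod_beta zero_prod_def[symmetric] mono_of_add[symmetric] plus_prod_def)

lemma leg_legs:
  "leg (\<lambda>u. (u, 0)) x = leg1 x" "leg (\<lambda>u. (0, u)) x = leg2 x"
  "leg (\<lambda>u. (u, 0, 0)) x = leg12 (leg1 x)"
  "leg (\<lambda>u. (0, u, 0)) x = leg12 (leg2 x)"
  "leg (\<lambda>u. (0, 0, u)) x = leg23 (leg2 x)"
proof -
  have h: "alg_hom (leg (\<lambda>u::gword. (u, 0::gword, 0::gword)))"
    "alg_hom (leg (\<lambda>u::gword. (0::gword, u, 0::gword)))"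
    "alg_hom (leg (\<lambda>u::gword. (0::gword, 0::gword, u)))"
    by (rule alg_hom_leg; simp add: zero_prod_def)+
  note e = alg_hom_eqI[OF h(1) alg_hom_comp[OF alg_hom_leg12 alg_hom_leg1]]
    alg_hom_eqI[OF h(2) alg_hom_comp[OF alg_hom_leg12 alg_hom_leg2]]
    alg_hom_eqI[OF h(3) alg_hom_comp[OF alg_hom_leg23 alg_hom_leg2]]
  show "leg (\<lambda>u. (u, 0)) x = leg1 x" "leg (\<lambda>u. (0, u)) x = leg2 x"
    by (simp_all add: leg_def leg1_def leg2_def)
  show "leg (\<lambda>u. (u, 0, 0)) x = leg12 (leg1 x)"
    by (rule e) (simp add: leg_def leg1_def leg2_def leg12_def leg23_def)
  show "leg (\<lambda>u. (0, u, 0)) x = leg12 (leg2 x)"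
    by (rule e) (simp add: leg_def leg1_def leg2_def leg12_def leg23_def)
  show "leg (\<lambda>u. (0, 0, u)) x = leg23 (leg2 x)"
    by (rule e) (simp add: leg_def leg1_def leg2_def leg12_def leg23_def)
qed

lemma rels_gword: "rels = relators"
  by (auto simp: rels_def legs_gword_def leg_id)

lemma rels_prod: "rels = leg1 ` relators \<union> leg2 ` relators"
  by (auto simp: rels_def legs_gword_def legs_prod_def leg_legs)

lemma rels_prod3:
  "rels = leg12 ` leg1 ` relators \<union> leg12 ` leg2 ` relators \<union> leg23 ` leg2 ` relators"
  by (auto simp: rels_def legs_gword_def legs_prod_def leg_legs image_Un image_image zero_prod_def)

text \<open>The series agreeing with x in degrees below N form an open neighbourhood of x, and these
  neighbourhoods are cofinal. This turns the topological closure into a divisibility condition, the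
  form in which the ideal is used afterwards.\<close>

lemma mem_closure_fps:
  fixes S :: "'a::ring_1 fps set"
  shows "x \<in> closure S \<longleftrightarrow> (\<forall>N. \<exists>y\<in>S. \<exists>z. x = y + fps_X ^ N * z)"
proof (intro iffI allI)
  fix N assume x: "x \<in> closure S"
  have "{H. fps_cutoff N H = fps_cutoff N x} \<inter> closure S \<noteq> {}" using x by blast
  then have "{H. fps_cutoff N H = fps_cutoff N x} \<inter> S \<noteq> {}"
    using open_Int_closure_eq_empty[OF open_fps_cutoff, of N x S] by simp
  then obtain y where y: "y \<in> S" "fps_cutoff N y = fps_cutoff N x" by blast
  have "x = y + fps_X ^ N * fps_shift N (x - y)"
  proof (rule fps_ext)
    fix k
    have "y $ k = x $ k" if "k < N" using arg_cong[OF y(2), of "\<lambda>f. f $ k"] that by simp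
    then show "x $ k = (y + fps_X ^ N * fps_shift N (x - y)) $ k"
      by (simp add: fps_X_power_mult_nth)
  qed
  with y(1) show "\<exists>y\<in>S. \<exists>z. x = y + fps_X ^ N * z" by blast
next
  assume "\<forall>N. \<exists>y\<in>S. \<exists>z. x = y + fps_X ^ N * z"
  then obtain y z where y: "\<And>N. y N \<in> S" "\<And>N. x = y N + fps_X ^ N * z N" by metis
  have "y \<longlonglongrightarrow> x"
  proof (rule tendsto_fpsI)
    fix n
    show "\<forall>\<^sub>F N in sequentially. y N $ n = x $ n"
    proof (rule eventually_sequentiallyI[of "Suc n"])
      fix N assume "Suc n \<le> N"
      then have "(fps_X ^ N * z N) $ n = 0" by (simp add: fps_X_power_mult_nth)
      moreover have "x $ n = y N $ n + (fps_X ^ N * z N) $ n" by (metis fps_add_nth y(2))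
      ultimately show "y N $ n = x $ n" by simp
    qed
  qed
  with y(1) show "x \<in> closure S" by (auto simp: closure_sequential)
qed

lemma two_sided_ideal_mult:
  "x \<in> two_sided_ideal S \<Longrightarrow> a * x * b \<in> two_sided_ideal S"
proof (induction rule: two_sided_ideal.induct)
  case (gen r c d)
  then have "(a * c) * r * (d * b) \<in> two_sided_ideal S" by (rule two_sided_ideal.gen)
  then show ?case by (simp add: mult.assoc)
qed (simp_all add: two_sided_ideal.zero two_sided_ideal.add distrib_left distrib_right)

lemma JJ_iff: "x \<in> JJ \<longleftrightarrow> (\<forall>N. \<exists>y\<in>two_sided_ideal rels. \<exists>z. x = y + fps_X ^ N * z)"
  by (simp add: JJ_def mem_closure_fps)

lemma JJ_ideal: "x \<in> two_sided_ideal rels \<Longrightarrow> x \<in> JJ"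
  by (metis JJ_def closure_subset subsetD)

lemma JJ_rels: "x \<in> rels \<Longrightarrow> x \<in> JJ"
  using JJ_ideal two_sided_ideal.gen[of x rels 1 1] by simp

lemma JJ_zero: "0 \<in> JJ"
  by (simp add: JJ_ideal two_sided_ideal.zero)

lemma JJ_add:
  assumes "x \<in> JJ" "y \<in> JJ" shows "x + y \<in> JJ"
  unfolding JJ_iff
proof
  fix N
  obtain a b c d where "a \<in> two_sided_ideal rels" "x = a + fps_X ^ N * b"
    "c \<in> two_sided_ideal rels" "y = c + fps_X ^ N * d"
    using assms unfolding JJ_iff by meson
  then show "\<exists>w\<in>two_sided_ideal rels. \<exists>z. x + y = w + fps_X ^ N * z"
    by (intro bexI[of _ "a + c"] exI[of _ "b + d"]) (auto simp: two_sided_ideal.add distrib_left)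
qed

lemma JJ_mult:
  assumes "x \<in> JJ" shows "a * x * b \<in> JJ"
  unfolding JJ_iff
proof
  fix N
  obtain y z where y: "y \<in> two_sided_ideal rels" "x = y + fps_X ^ N * z"
    using assms unfolding JJ_iff by meson
  then have "a * x * b = a * y * b + fps_X ^ N * (a * z * b)"
    by (simp only: distrib_left distrib_right mult.assoc mult_X_power_left)
  with y(1) show "\<exists>w\<in>two_sided_ideal rels. \<exists>z. a * x * b = w + fps_X ^ N * z"
    using two_sided_ideal_mult by blast
qed

lemma JJ_minus: "x \<in> JJ \<Longrightarrow> - x \<in> JJ"
  using JJ_mult[of x "-1" 1] by simp

lemma JJ_diff: "x \<in> JJ \<Longrightarrow> y \<in> JJ \<Longrightarrow> x - y \<in> JJ"
  using JJ_add[of x "- y"] JJ_minus[of y] by simp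

lemma JJ_closed:
  assumes "\<And>N. \<exists>y\<in>JJ. \<exists>z. x = y + fps_X ^ N * z"
  shows "x \<in> JJ"
  unfolding JJ_iff
proof
  fix N
  obtain y z where y: "y \<in> JJ" "x = y + fps_X ^ N * z" using assms by blast
  then obtain y' z' where "y' \<in> two_sided_ideal rels" "y = y' + fps_X ^ N * z'"
    unfolding JJ_iff by blast
  with y show "\<exists>y\<in>two_sided_ideal rels. \<exists>z. x = y + fps_X ^ N * z"
    by (intro bexI[of _ y'] exI[of _ "z' + z"]) (auto simp: distrib_left add.assoc)
qed

lemma JJ_sum: "(\<And>i. i \<in> A \<Longrightarrow> f i \<in> JJ) \<Longrightarrow> sum f A \<in> JJ"
  by (induction A rule: infinite_finite_induct) (simp_all add: JJ_zero JJ_add)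

text \<open>The reason why exponentials make sense on classes: partial sums lie in the ideal and
  tails are divisible by \<gamma>^N, so term-by-term membership passes to the sum.\<close>

lemma JJ_xser:
  assumes "\<And>n. t n \<in> JJ" shows "xser t \<in> JJ"
proof (rule JJ_closed)
  fix N
  have "fps_X ^ n * t n \<in> JJ" for n
    using JJ_mult[OF assms, of "fps_X ^ n" n 1] by simp
  then have "(\<Sum>n<N. fps_X ^ n * t n) \<in> JJ" by (intro JJ_sum)
  then show "\<exists>y\<in>JJ. \<exists>z. xser t = y + fps_X ^ N * z" using xser_split[of t N] by blast
qed

text \<open>Testing the relators is enough because f fixes \<gamma>, hence maps approximations
  modulo \<gamma>^N to approximations modulo \<gamma>^N.\<close>

lemma alg_hom_JJ:
  assumes f: "alg_hom f" and r: "\<And>r. r \<in> rels \<Longrightarrow> f r \<in> JJ" and x: "x \<in> JJ"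
  shows "f x \<in> JJ"
proof (rule JJ_closed)
  fix N
  have I: "f y \<in> JJ" if "y \<in> two_sided_ideal rels" for y
    using that
    by (induction rule: two_sided_ideal.induct)
       (simp_all add: alg_hom_simps[OF f] JJ_zero JJ_add JJ_mult r)
  obtain y z where y: "y \<in> two_sided_ideal rels" "x = y + fps_X ^ N * z"
    using x unfolding JJ_iff by blast
  then have "f x = f y + fps_X ^ N * f z" by (simp add: alg_hom_simps[OF f])
  with I[OF y(1)] show "\<exists>y\<in>JJ. \<exists>z. f x = y + fps_X ^ N * z" by blast
qed

\<comment> \<open>The quotient rings\<close>
quotient_type (overloaded) ('m, 'k) quot =
  "('m::rel_monoid \<Rightarrow>\<^sub>0 'k::comm_complex_algebra) fps" / "\<lambda>x y. x - y \<in> JJ"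
proof (rule equivpI)
  show "reflp (\<lambda>x y. x - y \<in> JJ)" by (simp add: reflp_def JJ_zero)
  show "symp (\<lambda>x y. x - y \<in> JJ)" by (rule sympI) (drule JJ_minus, simp)
  show "transp (\<lambda>x y. x - y \<in> JJ)" by (rule transpI) (drule (1) JJ_add, simp)
qed

text \<open>The class \<open>ring_1\<close> would require 1 \<noteq> 0, that is, a proof that the
  relations do not collapse the algebra; the unit is therefore supplied by
  \<open>monoid_mult\<close>.\<close>

instantiation quot :: (rel_monoid, comm_complex_algebra) "{ring, monoid_mult}"
begin

lift_definition zero_quot :: "('a, 'b) quot" is 0 .
lift_definition one_quot :: "('a, 'b) quot" is 1 .
lift_definition plus_quot :: "('a, 'b) quot \<Rightarrow> ('a, 'b) quot \<Rightarrow> ('a, 'b) quot" is "(+)"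
  by (simp add: add_diff_add JJ_add)
lift_definition minus_quot :: "('a, 'b) quot \<Rightarrow> ('a, 'b) quot \<Rightarrow> ('a, 'b) quot" is "(-)"
proof -
  fix x x' y y' :: "('a \<Rightarrow>\<^sub>0 'b) fps"
  assume "x - x' \<in> JJ" "y - y' \<in> JJ"
  then have "(x - x') - (y - y') \<in> JJ" by (rule JJ_diff)
  then show "x - y - (x' - y') \<in> JJ" by (simp add: algebra_simps)
qed
lift_definition uminus_quot :: "('a, 'b) quot \<Rightarrow> ('a, 'b) quot" is uminus
  by (drule JJ_minus) (simp add: algebra_simps)
lift_definition times_quot :: "('a, 'b) quot \<Rightarrow> ('a, 'b) quot \<Rightarrow> ('a, 'b) quot" is "(*)"
proof -
  fix x x' y y' :: "('a \<Rightarrow>\<^sub>0 'b) fps"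
  assume "x - x' \<in> JJ" "y - y' \<in> JJ"
  then have "1 * (x - x') * y + x' * (y - y') * 1 \<in> JJ" by (intro JJ_add JJ_mult)
  then show "x * y - x' * y' \<in> JJ" by (simp add: algebra_simps)
qed

instance
  by standard (transfer, simp add: algebra_simps JJ_zero)+

end

definition pr :: "('m::rel_monoid \<Rightarrow>\<^sub>0 'k::comm_complex_algebra) fps \<Rightarrow> ('m, 'k) quot" where
  "pr = abs_quot"

lemma pr_eq_iff: "pr x = pr y \<longleftrightarrow> x - y \<in> JJ"
  by (simp add: pr_def quot.abs_eq_iff)

lemma pr_surj: "\<exists>x. u = pr x"
  by (induct u rule: quot.abs_induct) (auto simp: pr_def)

lemma pr_add: "pr (x + y) = pr x + pr y"
  and pr_mult: "pr (x * y) = pr x * pr y"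
  and pr_diff: "pr (x - y) = pr x - pr y"
  and pr_minus: "pr (- x) = - pr x"
  and pr_0: "pr 0 = 0"
  and pr_1: "pr 1 = 1"
  by (simp_all add: pr_def plus_quot.abs_eq times_quot.abs_eq minus_quot.abs_eq uminus_quot.abs_eq
      zero_quot.abs_eq one_quot.abs_eq)

lemma pr_power: "pr (x ^ n) = pr x ^ n"
  by (induction n) (simp_all add: pr_1 pr_mult)

lemma pr_sum: "pr (sum f A) = (\<Sum>i\<in>A. pr (f i))"
  by (induction A rule: infinite_finite_induct) (simp_all add: pr_0 pr_add)

lemmas pr_simps = pr_add pr_mult pr_diff pr_minus pr_0 pr_1 pr_power pr_sum

lemma pr_xser_cong: "(\<And>n. pr (t n) = pr (t' n)) \<Longrightarrow> pr (xser t) = pr (xser t')"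
  by (simp add: pr_eq_iff xser_diff JJ_xser)

lemma pr_alg_hom_cong:
  assumes "alg_hom f" "\<And>r. r \<in> rels \<Longrightarrow> pr (f r) = 0" "pr x = pr y"
  shows "pr (f x) = pr (f y)"
proof -
  have "f r \<in> JJ" if "r \<in> rels" for r
    using assms(2)[OF that] pr_eq_iff[of "f r" 0] by (simp add: pr_0)
  then have "f (x - y) \<in> JJ"
    using assms(3) by (rule_tac alg_hom_JJ[OF assms(1)]) (simp_all add: pr_eq_iff)
  then show ?thesis by (simp add: pr_eq_iff alg_hom_simps[OF assms(1)])
qed

lemma eqU1_iff: "x \<approx>\<^sub>1 y \<longleftrightarrow> pr x = pr y"
  by (simp add: eqU1_def pr_eq_iff JJ_def rels_gword)

lemma eqU2_iff: "x \<approx>\<^sub>2 y \<longleftrightarrow> pr x = pr y"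
  by (simp add: eqU2_def pr_eq_iff JJ_def rels_prod)

lemma eqU3_iff: "x \<approx>\<^sub>3 y \<longleftrightarrow> pr x = pr y"
  by (simp add: eqU3_def pr_eq_iff JJ_def rels_prod3)

definition sc :: "'k::comm_complex_algebra fps \<Rightarrow> ('m::rel_monoid, 'k) quot" where
  "sc c = pr (scal c)"

section \<open>The q-exponential\<close>

text \<open>Scalars act in three settings: on themselves, in the completed free algebras and in the
  quotients. Abstracting from these gives one q-binomial theorem for all three.\<close>

locale central_hom =
  fixes \<sigma> :: "'c::comm_ring_1 \<Rightarrow> 'r::{ring,monoid_mult}"
  assumes add: "\<sigma> (a + b) = \<sigma> a + \<sigma> b"
    and mult: "\<sigma> (a * b) = \<sigma> a * \<sigma> b"
    and one: "\<sigma> 1 = 1"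
    and central: "\<sigma> a * x = x * \<sigma> a"
begin

lemma left: "x * (\<sigma> a * y) = \<sigma> a * (x * y)"
  by (metis central mult.assoc)

lemma zero: "\<sigma> 0 = 0"
  using add[of 0 0] by simp

lemma mult': "\<sigma> a * (\<sigma> b * x) = \<sigma> (a * b) * x"
  by (simp add: mult mult.assoc)

lemma mult_mult: "(\<sigma> a * x) * (\<sigma> b * y) = \<sigma> (a * b) * (x * y)"
  by (simp only: mult.assoc left[of x] mult)

end

text \<open>The coefficients 1/[n;s]!, characterised by their recursion; the sum of s^i over i \<le>
  n is the bracket [n+1]. With s = 1 they are 1/n!, so ordinary exponentials of commuting elements
  are covered as well.\<close>

locale q_exp_coeff =
  fixes s :: "'c::comm_ring_1" and c :: "nat \<Rightarrow> 'c"
  assumes c_0: "c 0 = 1"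
    and c_Suc: "c (Suc n) * (\<Sum>i\<le>n. s ^ i) = c n"
    and bracket_unit: "\<exists>j. j * (\<Sum>i\<le>n. s ^ i) = 1"
begin

lemma bracket_add: "k \<le> Suc n \<Longrightarrow>
  (\<Sum>i<k. s ^ i) + s ^ k * (\<Sum>i<Suc n - k. s ^ i) = (\<Sum>i\<le>n. s ^ i)"
proof -
  assume k: "k \<le> Suc n"
  have S: "(\<Sum>i<k + m. s ^ i) = (\<Sum>i<k. s ^ i) + (\<Sum>i<m. s ^ (k + i))" for m
    by (induction m) (simp_all add: add.assoc)
  have "(\<Sum>i\<le>n. s ^ i) = (\<Sum>i<k + (Suc n - k). s ^ i)" using k by (simp add: lessThan_Suc_atMost)
  also note S
  finally show ?thesis by (simp add: power_add sum_distrib_left)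
qed

text \<open>Multiplying by the unit [n+1] makes the induction work: both sides then become (u + v)
  times the case n.\<close>

lemma q_binomial:
  assumes h: "central_hom \<sigma>" and uv: "u * v = \<sigma> s * (v * u)"
  shows "\<sigma> (c n) * (u + v) ^ n = (\<Sum>k\<le>n. (\<sigma> (c k) * v ^ k) * (\<sigma> (c (n - k)) * u ^ (n - k)))"
proof (induction n)
  case 0
  show ?case using c_0 central_hom.one[OF h] by simp
next
  case (Suc n)
  interpret central_hom \<sigma> by (rule h)
  define G where "G n = (\<Sum>k\<le>n. \<sigma> (c k * c (n - k)) * (v ^ k * u ^ (n - k)))" for n
  define b where "b = (\<Sum>i\<le>n. s ^ i)"
  have G: "(\<Sum>k\<le>n. (\<sigma> (c k) * v ^ k) * (\<sigma> (c (n - k)) * u ^ (n - k))) = G n" for n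
    unfolding G_def by (intro sum.cong refl) (simp only: mult_mult)
  have uvk: "u * v ^ k = \<sigma> (s ^ k) * (v ^ k * u)" for k
  proof (induction k)
    case (Suc k)
    have "u * v ^ Suc k = \<sigma> s * (v * (u * v ^ k))"
      by (simp add: mult.assoc[symmetric] uv) 
    then show ?case by (simp add: Suc left[of v] mult' mult.assoc)
  qed (simp add: one)
  have c': "c m = c (Suc m) * (\<Sum>i<Suc m. s ^ i)" for m
    using c_Suc[of m] by (simp add: lessThan_Suc_atMost)
  let ?V = "\<lambda>k. v ^ k * u ^ (Suc n - k)"
  \<comment> \<open>The bracket [n+1] is split as [k] + s^k [n+1-k]. The first part lowers the index
    of \<open>c k\<close> and yields v G n; the second lowers the other index and yields u G n, its
    s^k being the price of moving u past v^k.\<close>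
  have "\<sigma> b * G (Suc n) = (\<Sum>k\<le>Suc n. \<sigma> (((\<Sum>i<k. s ^ i) + s ^ k * (\<Sum>i<Suc n - k. s ^ i))
      * (c k * c (Suc n - k))) * ?V k)"
    unfolding G_def sum_distrib_left[of "\<sigma> b"] mult'
    by (intro sum.cong refl) (simp only: bracket_add b_def atMost_iff)
  also have "\<dots> = (\<Sum>k\<le>Suc n. \<sigma> ((\<Sum>i<k. s ^ i) * c k * c (Suc n - k)) * ?V k)
      + (\<Sum>k\<le>Suc n. \<sigma> (s ^ k * c k * ((\<Sum>i<Suc n - k. s ^ i) * c (Suc n - k))) * ?V k)"
  proof -
    have "\<sigma> ((A + S * B) * (C * D)) * V = \<sigma> (A * C * D) * V + \<sigma> (S * C * (B * D)) * V" for A S B C D V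
      by (simp add: add algebra_simps)
    then show ?thesis by (simp only: sum.distrib[symmetric])
  qed
  also have "(\<Sum>k\<le>Suc n. \<sigma> ((\<Sum>i<k. s ^ i) * c k * c (Suc n - k)) * ?V k) = v * G n"
  proof -
    have "\<sigma> ((\<Sum>i<Suc k. s ^ i) * c (Suc k) * c (Suc n - Suc k)) * ?V (Suc k)
       = v * (\<sigma> (c k * c (n - k)) * (v ^ k * u ^ (n - k)))" for k
      by (simp only: left[of v] mult.commute[of "sum _ _" "c _"] c'[symmetric] diff_Suc_Suc power_Suc mult.assoc)
    then show ?thesis unfolding G_def sum_distrib_left[of v]
      by (subst sum.atMost_Suc_shift) (simp add: zero del: sum.lessThan_Suc)
  qed
  also have "(\<Sum>k\<le>Suc n. \<sigma> (s ^ k * c k * ((\<Sum>i<Suc n - k. s ^ i) * c (Suc n - k))) * ?V k) = u * G n"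
  proof -
    have "\<sigma> (s ^ k * c k * ((\<Sum>i<Suc n - k. s ^ i) * c (Suc n - k))) * ?V k
       = u * (\<sigma> (c k * c (n - k)) * (v ^ k * u ^ (n - k)))" if "k \<le> n" for k
    proof -
      have S: "Suc n - k = Suc (n - k)" using that by simp
      have "u * (\<sigma> (c k * c (n - k)) * (v ^ k * u ^ (n - k)))
        = \<sigma> (c k * c (n - k)) * ((u * v ^ k) * u ^ (n - k))" by (simp only: left[of u] mult.assoc)
      also have "\<dots> = \<sigma> (c k * c (n - k) * s ^ k) * (v ^ k * u ^ Suc (n - k))"
        by (simp add: uvk mult' mult.assoc)
      finally have *: "u * (\<sigma> (c k * c (n - k)) * (v ^ k * u ^ (n - k))) = \<dots>" .
      have "c (n - k) = (\<Sum>i<Suc (n - k). s ^ i) * c (Suc (n - k))"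
        using c'[of "n - k"] by (simp only: mult.commute)
      then show ?thesis unfolding * by (simp only: S mult_ac)
    qed
    then show ?thesis unfolding G_def sum_distrib_left[of u]
      by (subst sum.atMost_Suc) (simp add: zero)
  qed
  also have "v * G n + u * G n = (u + v) * G n" by (simp add: distrib_right add.commute)
  also have "G n = \<sigma> (c n) * (u + v) ^ n" using Suc G by simp
  also have "(u + v) * (\<sigma> (c n) * (u + v) ^ n) = \<sigma> b * (\<sigma> (c (Suc n)) * (u + v) ^ Suc n)"
    using c_Suc[of n] by (simp only: left[of "u + v"] mult' b_def mult.commute[of "sum _ _" "c _"] power_Suc)
  finally have e: "\<sigma> b * G (Suc n) = \<sigma> b * (\<sigma> (c (Suc n)) * (u + v) ^ Suc n)" .
  obtain j where "j * b = 1" using bracket_unit b_def by blast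
  then have "x = \<sigma> j * (\<sigma> b * x)" for x using mult'[of j b x] by (simp add: one)
  then have "G (Suc n) = \<sigma> (c (Suc n)) * (u + v) ^ Suc n" using e by metis
  then show ?case using G by simp
qed

lemma xser_add_commuting:
  assumes "central_hom \<sigma>" and "u * v = \<sigma> s * (v * u)"
  shows "xser (\<lambda>n. \<sigma> (c n) * (u + v) ^ n) = xser (\<lambda>n. \<sigma> (c n) * v ^ n) * xser (\<lambda>n. \<sigma> (c n) * u ^ n)"
  by (simp add: xser_mult q_binomial[OF assms])

end

lemma central_hom_scal: "central_hom scal"
  by standard (simp_all only: scal_add scal_mult scal_1, rule scal_commute)

lemma central_hom_sc: "central_hom sc"
proof
  fix a b :: "'a fps" and x :: "('b, 'a) quot"
  show "sc a * x = x * sc a"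
    using pr_surj[of x] by (metis sc_def scal_commute pr_mult)
qed (simp_all add: sc_def pr_simps scal_add scal_mult)

lemma central_hom_id: "central_hom (\<lambda>x. x)"
  by standard (simp_all add: mult.commute)

interpretation sc: central_hom sc by (rule central_hom_sc)

text \<open>The series with coefficients c evaluated at \<gamma>u. The representative is arbitrary;
  term-by-term congruence makes the class independent of it, as \<open>ps_pr\<close>
  records.\<close>

definition ps :: "(nat \<Rightarrow> 'k::comm_complex_algebra fps) \<Rightarrow> ('m::rel_monoid, 'k) quot \<Rightarrow> ('m, 'k) quot" where
  "ps c u = pr (xser (\<lambda>n. scal (c n) * (SOME a. u = pr a) ^ n))"

lemma ps_pr: "ps c (pr a) = pr (xser (\<lambda>n. scal (c n) * a ^ n))"
proof -
  have "pr a = pr (SOME b. pr a = pr b)" by (rule someI) (rule refl)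
  then show ?thesis unfolding ps_def by (intro pr_xser_cong) (simp add: pr_simps)
qed

text \<open>The relation passes to powers, hence to series. With w = u it expresses commutation,
  with w a shift of u it exponentiates a weight relation, and with v an exponential it is a
  conjugation.\<close>

lemma ps_intertwine:
  assumes "u * v = v * w" shows "ps c u * v = v * ps c w"
proof -
  obtain a b d where uvw [simp]: "u = pr a" "v = pr b" "w = pr d" using pr_surj by metis
  have p: "u ^ n * v = v * w ^ n" for n
  proof (induction n)
    case (Suc n)
    then have "u ^ Suc n * v = (u * v) * w ^ n" by (simp only: power_Suc mult.assoc)
    then show ?case by (simp only: assms power_Suc mult.assoc)
  qed simp
  have "pr (xser (\<lambda>n. (scal (c n) * a ^ n) * b)) = pr (xser (\<lambda>n. b * (scal (c n) * d ^ n)))"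
    by (rule pr_xser_cong) (use p in \<open>simp add: mult_scal_left[of b] mult.assoc pr_simps\<close>)
  then show ?thesis by (simp add: ps_pr xser_mult_left xser_mult_right flip: pr_mult)
qed

lemma ps_0: "c 0 = 1 \<Longrightarrow> ps c 0 = 1"
proof -
  assume c: "c 0 = 1"
  have "xser (\<lambda>n. scal (c n) * 0 ^ n) = 1"
    by (rule trans[OF _ xser_single]) (rule arg_cong[where f = xser], auto simp: fun_eq_iff power_0_left c)
  then show ?thesis using ps_pr[of c 0] by (metis pr_0 pr_1)
qed

lemma ps_add:
  assumes c: "q_exp_coeff s c" and uv: "u * v = sc s * (v * u)"
  shows "ps c (u + v) = ps c v * ps c u"
proof -
  interpret q_exp_coeff s c by (rule c)
  obtain a b where [simp]: "u = pr a" "v = pr b" using pr_surj by metis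
  have "pr (xser (\<lambda>n. scal (c n) * (a + b) ^ n)) =
      pr (xser (\<lambda>n. \<Sum>k\<le>n. (scal (c k) * b ^ k) * (scal (c (n - k)) * a ^ (n - k))))"
    using q_binomial[OF central_hom_sc uv]
    by (intro pr_xser_cong) (simp add: pr_simps sc_def)
  then show ?thesis
    by (simp add: ps_pr xser_mult flip: pr_mult pr_add)
qed

section \<open>Scalars\<close>

lemma fps_X_cancel:
  fixes x y :: "'a::ring_1 fps"
  assumes "fps_X * x = fps_X * y" shows "x = y"
proof (rule fps_ext)
  fix n
  have "(fps_X * x) $ Suc n = (fps_X * y) $ Suc n" using assms by simp
  then show "x $ n = y $ n" by simp
qed

lemma quo_eqI:
  assumes "b * x = a" and "\<And>y. b * y = b * x \<Longrightarrow> y = x"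
  shows "a \<oslash> b = x"
  unfolding quo_def
proof (rule the_equality)
  show "y = x" if "b * y = a" for y
    by (rule assms(2)) (simp only: that assms(1))
qed (rule assms(1))

lemma quo_unit:
  fixes b :: "'a::comm_ring_1"
  assumes "j * b = 1" shows "a \<oslash> b = j * a"
proof (rule quo_eqI)
  show "b * (j * a) = a" using assms by (simp add: mult.assoc[symmetric] mult.commute[of b])
  show "y = j * a" if "b * y = b * (j * a)" for y
  proof -
    have "j * b * y = j * b * (j * a)" using that by (simp only: mult.assoc)
    then show ?thesis by (simp add: assms)
  qed
qed

lemma fps_unit:
  fixes f :: "'a::comm_ring_1 fps"
  assumes "f $ 0 * y = 1" shows "\<exists>j. j * f = 1"
  using fps_right_inverse[OF assms] by (subst (asm) mult.commute) (rule exI)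

lemma of_nat_Suc_of_cplx:
  "(of_nat (Suc n) :: 'k::comm_complex_algebra) * of_cplx (1 / of_nat (Suc n)) = 1"
proof -
  have "(of_cplx (of_nat (Suc n) * (1 / of_nat (Suc n))) :: 'k) = 1"
    by (simp add: of_cplx_1 del: of_nat_Suc)
  then show ?thesis by (simp only: of_cplx_mult of_cplx_of_nat)
qed

section \<open>Exponentials of scalars; exact division by omega and s - 1\<close>

definition ec :: "nat \<Rightarrow> 'k::comm_complex_algebra fps" where
  "ec n = fps_const (of_cplx (1 / fact n))"

lemma q_exp_coeff_ec: "q_exp_coeff 1 (ec :: nat \<Rightarrow> 'k::comm_complex_algebra fps)"
proof
  have B: "(\<Sum>i\<le>n. 1 ^ i) = fps_const (of_nat (Suc n) :: 'k)" for n
    by (simp add: fps_of_nat del: of_nat_Suc)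
  show "ec 0 = (1 :: 'k fps)" by (simp add: ec_def of_cplx_1)
  fix n
  have "1 / fact (Suc n) * of_nat (Suc n) = (1 / fact n :: complex)"
    by (simp add: fact_Suc del: of_nat_Suc)
  then have "(of_cplx (1 / fact (Suc n) * of_nat (Suc n)) :: 'k) = of_cplx (1 / fact n)" by (rule arg_cong)
  then show "ec (Suc n) * (\<Sum>i\<le>n. 1 ^ i) = (ec n :: 'k fps)"
    by (simp only: B ec_def fps_const_mult of_cplx_mult of_cplx_of_nat)
  have "fps_const (of_cplx (1 / of_nat (Suc n))) * (\<Sum>i\<le>n. 1 ^ i) = (1 :: 'k fps)"
    unfolding B fps_const_mult by (subst mult.commute) (simp only: of_nat_Suc_of_cplx fps_const_1_eq_1)
  then show "\<exists>j. j * (\<Sum>i\<le>n. 1 ^ i) = (1 :: 'k fps)" ..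
qed

text \<open>This is e^(\<gamma>c), that is q^c; the powers of \<gamma> are supplied by
  \<open>xser\<close>. Hence \<open>qz 1\<close> is q, and \<open>qz \<beta>\<close> is e^B when B =
  \<gamma>\<beta>.\<close>

definition qz :: "'k::comm_complex_algebra fps \<Rightarrow> 'k fps" where
  "qz c = xser (\<lambda>n. ec n * c ^ n)"

lemma qz_add: "qz (a + b) = qz a * qz b"
  using q_exp_coeff.xser_add_commuting[OF q_exp_coeff_ec central_hom_id, of b a]
  by (simp add: qz_def add.commute mult.commute)

lemma qz_0 [simp]: "qz 0 = 1"
  unfolding qz_def
  by (rule trans[OF _ xser_single]) (rule arg_cong[where f = xser], auto simp: fun_eq_iff power_0_left ec_def of_cplx_1)

lemma qz_minus: "qz (- a) * qz a = 1"
  using qz_add[of "- a" a] by simp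

lemma qz_nat_mult: "qz (of_nat n * a) = qz a ^ n"
  by (induction n) (simp_all add: qz_add distrib_right)

lemma qz_nth_0 [simp]: "qz c $ 0 = 1"
  by (simp add: qz_def xser_def ec_def of_cplx_1)

lemma qz_nth_1: "qz c $ Suc 0 = c $ 0"
  by (simp add: qz_def xser_def ec_def of_cplx_1)

lemma qq_eq: "qq = (qz 1 :: 'k::comm_complex_algebra fps)"
proof -
  have "(qz 1 :: 'k fps) = xser (\<lambda>n. fps_const (qq $ n))" by (simp add: qz_def ec_def qq_def)
  then show ?thesis by (simp add: xser_const)
qed

lemma quo_qz: "a \<oslash> qz c = qz (- c) * a"
  by (rule quo_unit) (rule qz_minus)

lemma omega_eq: "omega = qz 1 - qz (- 1)"
  by (simp add: omega_def qq_eq quo_qz)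

lemma two_unit: "(2 :: 'k::comm_complex_algebra) * of_cplx (1 / 2) = 1"
  using of_nat_Suc_of_cplx[of 1, where 'k = 'k] by simp

lemma fps_eq_X_shift:
  fixes f :: "'a::ring_1 fps"
  assumes "f $ 0 = 0" shows "f = fps_X * fps_shift 1 f"
proof (rule fps_ext)
  show "f $ n = (fps_X * fps_shift 1 f) $ n" for n by (cases n) (simp_all add: assms)
qed

text \<open>Divisors such as omega = 2\<gamma> + ... and s - 1 are \<gamma> times a unit, so
  cancelling them amounts to cancelling \<gamma>, which is possible in every ring of power
  series.\<close>

lemma X_times_unit:
  fixes f :: "'a::comm_ring_1 fps"
  assumes "f $ 0 = 0" "f $ Suc 0 * y = 1"
  shows "\<exists>w j. f = fps_X * w \<and> j * w = 1"
proof -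
  have f: "f = fps_X * fps_shift 1 f"
    by (rule fps_eq_X_shift) (rule assms(1))
  have "fps_shift 1 f $ 0 * y = 1" using assms(2) by simp
  then obtain j where "j * fps_shift 1 f = 1" using fps_unit by blast
  then show ?thesis by (intro exI[of _ "fps_shift 1 f"] exI[of _ j] conjI f)
qed

lemma omega_X_unit: obtains w j where "omega = fps_X * w" "j * w = (1::'k::comm_complex_algebra fps)"
proof -
  have "(omega::'k fps) $ 0 = 0" "(omega::'k fps) $ Suc 0 = 2"
    by (simp_all add: omega_eq qz_nth_1)
  then have "\<exists>w j. (omega :: 'k fps) = fps_X * w \<and> j * w = 1"
    by (intro X_times_unit[where y = "of_cplx (1 / 2)"]) (simp_all only: two_unit)
  then show thesis by (elim exE conjE) (rule that)
qed

lemma scal_X_unit_cancel: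
  fixes x y :: "('m::monoid_add \<Rightarrow>\<^sub>0 'k::comm_ring_1) fps"
  assumes f: "f = fps_X * w" "j * w = 1" and eq: "scal f * x = scal f * y"
  shows "x = y"
proof -
  have "fps_X * (scal w * x) = fps_X * (scal w * y)"
    using eq f(1) by (simp add: scal_mult mult.assoc)
  then have "scal w * x = scal w * y" by (rule fps_X_cancel)
  then have "scal (j * w) * x = scal (j * w) * y" by (simp add: scal_mult mult.assoc)
  then show ?thesis by (simp add: f(2))
qed

lemma scal_omega_cancel: "scal omega * x = scal omega * y \<Longrightarrow> x = y"
  by (rule omega_X_unit) (rule scal_X_unit_cancel)

lemma omega_cancel: "omega * x = omega * (y::'k::comm_complex_algebra fps) \<Longrightarrow> x = y"
proof (rule omega_X_unit)
  fix w j :: "'k fps"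
  assume eq: "omega * x = omega * y" and w: "omega = fps_X * w" "j * w = 1"
  have "fps_X * (w * x) = fps_X * (w * y)" using eq unfolding w(1) mult.assoc .
  then have "w * x = w * y" by (rule fps_X_cancel)
  then have "j * w * x = j * w * y" by (simp add: mult.assoc)
  then show "x = y" using \<open>j * w = 1\<close> by simp
qed

lemma q_pow_eq_xser': "q_pow x = xser (\<lambda>n. scal (ec n) * x ^ n)"
  by (simp add: q_pow_eq_xser cst_def ec_def)

lemma q_pow_scal: "q_pow (scal c) = scal (qz c)"
  by (simp add: q_pow_eq_xser' qz_def X_linear_xser[OF X_linear_scal] scal_mult scal_power)

lemma q_pow_add: "a * b = b * a \<Longrightarrow> q_pow (a + b) = q_pow a * q_pow b"
  using q_exp_coeff.xser_add_commuting[OF q_exp_coeff_ec central_hom_scal, of b a]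
  by (simp add: q_pow_eq_xser' add.commute)

lemma q_pow_nth_0: "q_pow x $ 0 = 1"
  by (simp add: q_pow_eq_xser' xser_def ec_def of_cplx_1 scal_const)

definition q_num :: "('m::monoid_add \<Rightarrow>\<^sub>0 'k::comm_complex_algebra) fps \<Rightarrow> ('m \<Rightarrow>\<^sub>0 'k) fps" where
  "q_num h = (q_pow h - q_pow (- h)) \<oslash> scal omega"

text \<open>Both powers of q have constant coefficient 1, so \<gamma> divides their difference, and
  omega is \<gamma> times a unit. The quotient thus exists, and cancellation makes it
  unique.\<close>

lemma omega_q_num: "scal omega * q_num h = q_pow h - q_pow (- h)"
proof (rule omega_X_unit)
  fix w j :: "'b fps"
  assume w: "omega = fps_X * w" "j * w = 1"
  let ?d = "q_pow h - q_pow (- h)"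
  have "?d = fps_X * fps_shift 1 ?d"
    by (rule fps_eq_X_shift) (simp add: q_pow_nth_0)
  moreover have "scal omega * (scal j * fps_shift 1 ?d) = fps_X * (scal (j * w) * fps_shift 1 ?d)"
    by (simp only: w(1) mult.commute[of j w] scal_mult scal_X mult.assoc)
  ultimately have x: "scal omega * (scal j * fps_shift 1 ?d) = ?d" by (simp add: w(2))
  have "q_num h = scal j * fps_shift 1 ?d"
    unfolding q_num_def by (rule quo_eqI[OF x]) (rule scal_omega_cancel)
  then show ?thesis by (simp only: x)
qed

lemma bracket_nth_0: "s $ 0 = 1 \<Longrightarrow> (\<Sum>i\<le>n. s ^ i) $ 0 = (of_nat (Suc n) :: 'k::comm_ring_1)"
proof -
  assume s: "s $ 0 = 1"
  have "(s ^ i) $ 0 = 1" for i by (induction i) (simp_all add: s)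
  then show ?thesis by (simp add: fps_sum_nth)
qed

text \<open>Here s = 1 + s_1 \<gamma> + ... with s_1 invertible and y its inverse. Then s - 1 is
  \<gamma> times a unit, and the bracket [m] with m > 0 is a unit because its constant coefficient
  is m, which is invertible in K. Both q^2 and q^(-2) are of this kind.\<close>

context
  fixes s :: "'k::comm_complex_algebra fps" and y :: 'k
  assumes s0: "s $ 0 = 1" and s1: "s $ Suc 0 * y = 1"
begin

lemma quo_bracket: "(s ^ m - 1) \<oslash> (s - 1) = (\<Sum>i<m. s ^ i)"
proof (rule quo_eqI)
  show "(s - 1) * (\<Sum>i<m. s ^ i) = s ^ m - 1" by (simp only: power_diff_1_eq)
  have "\<exists>w j. s - 1 = fps_X * w \<and> j * w = 1"
    by (rule X_times_unit[where y = y]) (simp_all add: s0 s1)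
  then obtain w j where w: "s - 1 = fps_X * w" "j * w = 1" by (elim exE conjE)
  fix z assume "(s - 1) * z = (s - 1) * (\<Sum>i<m. s ^ i)"
  then have "w * z = w * (\<Sum>i<m. s ^ i)" by (rule_tac fps_X_cancel) (simp add: w(1) mult.assoc)
  then have "j * w * z = j * w * (\<Sum>i<m. s ^ i)" by (simp add: mult.assoc)
  then show "z = (\<Sum>i<m. s ^ i)" by (simp add: w(2))
qed

lemma q_fact_Suc: "q_fact (Suc n) s = q_fact n s * (\<Sum>i\<le>n. s ^ i)"
  by (simp add: q_fact_def quo_bracket lessThan_Suc_atMost)

lemma bracket_unit: "\<exists>j. j * (\<Sum>i\<le>n. s ^ i) = 1"
  by (rule fps_unit[where y = "of_cplx (1 / of_nat (Suc n))"])
     (simp only: bracket_nth_0[OF s0] of_nat_Suc_of_cplx)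

lemma q_fact_unit: "\<exists>j. j * q_fact n s = 1"
proof (induction n)
  case 0
  show ?case by (simp add: q_fact_def)
next
  case (Suc n)
  then obtain j where j: "j * q_fact n s = 1" by blast
  obtain k where k: "k * (\<Sum>i\<le>n. s ^ i) = 1" using bracket_unit[of n] by blast
  have "(j * k) * (q_fact n s * (\<Sum>i\<le>n. s ^ i)) = (j * q_fact n s) * (k * (\<Sum>i\<le>n. s ^ i))"
    by (simp only: mult_ac)
  then have "(j * k) * q_fact (Suc n) s = 1" by (simp only: q_fact_Suc j k mult_1)
  then show ?case by blast
qed

lemma quo_q_fact: "1 \<oslash> q_fact n s * q_fact n s = 1"
proof -
  obtain j where j: "j * q_fact n s = 1" using q_fact_unit[of n] by blast
  show ?thesis by (simp only: quo_unit[OF j] mult_1_right j)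
qed

lemma quo_q_fact_0: "1 \<oslash> q_fact 0 s = 1"
  using quo_q_fact[of 0] by (simp add: q_fact_def)

lemma quo_q_fact_Suc: "1 \<oslash> q_fact (Suc n) s * (\<Sum>i\<le>n. s ^ i) = 1 \<oslash> q_fact n s"
proof -
  have "(1 \<oslash> q_fact n s * q_fact n s) * (1 \<oslash> q_fact (Suc n) s * (\<Sum>i\<le>n. s ^ i)) =
      1 \<oslash> q_fact n s * (1 \<oslash> q_fact (Suc n) s * (q_fact n s * (\<Sum>i\<le>n. s ^ i)))"
    by (simp only: mult_ac)
  then show ?thesis by (simp only: q_fact_Suc[symmetric] quo_q_fact mult_1_right mult_1)
qed

lemma quo_q_fact_1: "1 \<oslash> q_fact (Suc 0) s = 1"
  using quo_q_fact_Suc[of 0] by (simp add: quo_q_fact_0)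

lemma q_exp_coeff_q_fact: "q_exp_coeff s (\<lambda>n. 1 \<oslash> q_fact n s)"
  by standard (simp_all only: quo_q_fact_0 quo_q_fact_Suc bracket_unit)

end

lemma qq_power2: "(qq::'k::comm_complex_algebra fps) ^ 2 = qz 2"
  using qz_nat_mult[of 2 "1::'k fps"] by (simp add: qq_eq)

lemma quo_qq_power2: "1 \<oslash> (qq::'k::comm_complex_algebra fps) ^ 2 = qz (- 2)"
  by (simp add: qq_power2 quo_qz)

definition qc :: "nat \<Rightarrow> 'k::comm_complex_algebra fps" where
  "qc n = 1 \<oslash> q_fact n (qq ^ 2)"

lemma q_exp_coeff_qc: "q_exp_coeff (qq ^ 2) (qc :: nat \<Rightarrow> 'k::comm_complex_algebra fps)"
proof -
  have qc: "qc = (\<lambda>n. 1 \<oslash> q_fact n (qz 2 :: 'k fps))"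
    by (rule ext) (simp only: qc_def qq_power2)
  have "qz 2 $ Suc 0 * of_cplx (1 / 2) = (1::'k)"
    by (simp only: qz_nth_1 fps_numeral_nth_0 two_unit)
  then show ?thesis
    unfolding qc qq_power2 by (rule q_exp_coeff_q_fact[OF qz_nth_0])
qed

section \<open>Exponentials in the quotient algebras\<close>

text \<open>On classes, \<open>KU u\<close> is q^u and \<open>QU u\<close> is exp_s(\<gamma>u) with
  s = q^2. Writing \<mu> = \<gamma>m and B = \<gamma>\<beta> brings every factor of the twist into
  one of these two forms.\<close>

abbreviation KU :: "('m::rel_monoid, 'k::comm_complex_algebra) quot \<Rightarrow> ('m, 'k) quot" where
  "KU \<equiv> ps ec"

abbreviation QU :: "('m::rel_monoid, 'k::comm_complex_algebra) quot \<Rightarrow> ('m, 'k) quot" where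
  "QU \<equiv> ps qc"

lemma pr_q_pow: "pr (q_pow a) = KU (pr a)"
  by (simp add: ps_pr q_pow_eq_xser')

lemma pr_q_exp: "pr (q_exp (qq ^ 2) (fps_X * a)) = QU (pr a)"
  by (simp add: ps_pr q_exp_eq_xser qc_def)

lemma ps_commute: "u * v = v * u \<Longrightarrow> ps c u * v = v * ps c u"
  by (rule ps_intertwine)

lemma ps_commute2: "u * v = v * u \<Longrightarrow> ps c u * ps d v = ps d v * ps c u"
  using ps_commute[of v u d] by (intro ps_commute) simp

lemma KU_0 [simp]: "KU 0 = 1"
  by (rule ps_0) (simp add: ec_def of_cplx_1)

lemma KU_add: "u * v = v * u \<Longrightarrow> KU (u + v) = KU u * KU v"
  using ps_add[OF q_exp_coeff_ec, of v u] by (simp add: sc.one add.commute)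

lemma KU_sc: "KU (sc c) = sc (qz c)"
  by (simp add: sc_def q_pow_scal flip: pr_q_pow)

lemma KU_shift: "u * v = v * (u + w) \<Longrightarrow> u * w = w * u \<Longrightarrow> KU u * v = v * (KU u * KU w)"
  using ps_intertwine[of u v "u + w" ec] by (simp add: KU_add)

lemma KU_shift_sc: "u * v = v * (u + sc c) \<Longrightarrow> KU u * v = sc (qz c) * (v * KU u)"
  by (subst KU_shift[of u v "sc c"])
     (simp_all only: sc.central KU_sc mult.assoc)

lemma QU_add: "u * v = sc (qq ^ 2) * (v * u) \<Longrightarrow> QU (u + v) = QU v * QU u"
  by (rule ps_add[OF q_exp_coeff_qc])

section \<open>The relations in one tensor factor\<close>

lemma assoc_rule: "a * b = c \<Longrightarrow> a * (b * x) = c * (x::'a::semigroup_mult)"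
  by (simp add: mult.assoc[symmetric])

abbreviation cz :: "complex \<Rightarrow> 'k::comm_complex_algebra fps" where
  "cz z \<equiv> fps_const (of_cplx z)"

lemma relators_intros:
  "i \<in> {1..3} \<Longrightarrow> j \<in> {1..3} \<Longrightarrow> comm (ee i) (ee j) \<in> relators"
  "i \<in> {1..3} \<Longrightarrow> j \<in> {1..2} \<Longrightarrow> comm (ee i) (er j) - cst (wt i j) * er j \<in> relators"
  "i \<in> {1..3} \<Longrightarrow> j \<in> {1..2} \<Longrightarrow> comm (ee i) (fr j) + cst (wt i j) * fr j \<in> relators"
  "i \<in> {1..2} \<Longrightarrow> j \<in> {1..2} \<Longrightarrow>
    comm (er i) (fr j) - cst (of_bool (i = j)) * q_num (hh i) \<in> relators"
  "k \<in> {1..2} \<Longrightarrow> l \<in> {1..2} \<Longrightarrow> k \<noteq> l \<Longrightarrow> q_serre (er k) (er l) \<in> relators"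
  "k \<in> {1..2} \<Longrightarrow> l \<in> {1..2} \<Longrightarrow> k \<noteq> l \<Longrightarrow> q_serre (fr k) (fr l) \<in> relators"
  unfolding relators_def q_num_def by blast+

lemma sc_2: "sc 2 = 1 + 1"
  using sc.add[of 1 1] by (simp add: sc.one)

lemma sc_minus: "sc (- c) = - sc c"
  by (simp add: sc_def scal_minus pr_simps)

text \<open>L places an element into one tensor factor and passes to its class. The consequences of
  the relations are derived once and used for both factors of the square and all three of the
  cube.\<close>

locale factor_map =
  fixes L :: "'k::comm_complex_algebra cfree \<Rightarrow> ('m::rel_monoid, 'k) quot"
  assumes ex_leg: "\<exists>\<iota>\<in>legs. \<forall>x. L x = pr (leg \<iota> x)"
begin

lemma ex_hom: "\<exists>f. alg_hom f \<and> (\<forall>x. L x = pr (f x)) \<and> (\<forall>r\<in>relators. f r \<in> rels)"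
proof -
  obtain \<iota> :: "gword \<Rightarrow> 'm" where "\<iota> \<in> legs" "\<forall>x. L x = pr (leg \<iota> x)" using ex_leg by blast
  then show ?thesis
    by (intro exI[of _ "leg \<iota>"]) (auto simp: rels_def intro: alg_hom_leg legs_zero legs_add)
qed

lemma add: "L (x + y) = L x + L y" and mult: "L (x * y) = L x * L y"
  and diff: "L (x - y) = L x - L y" and minus: "L (- x) = - L x"
  and one: "L 1 = 1" and zero: "L 0 = 0" and scal: "L (scal c) = sc c"
  and cst: "L (cst z) = sc (cz z)" and power: "L (x ^ n) = L x ^ n"
  and q_pow: "L (q_pow x) = KU (L x)"
proof -
  obtain f where f: "alg_hom f" and L: "\<And>x. L x = pr (f x)" using ex_hom by blast
  note s = alg_hom_simps[OF f] alg_hom_q_pow[OF f] pr_simps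
  show "L (x + y) = L x + L y" "L (x * y) = L x * L y" "L (x - y) = L x - L y" "L (- x) = - L x"
    "L 1 = 1" "L 0 = 0" "L (scal c) = sc c" "L (cst z) = sc (cz z)" "L (x ^ n) = L x ^ n"
    "L (q_pow x) = KU (L x)"
    unfolding L by (simp_all only: s sc_def cst_def pr_q_pow)
qed

lemmas simps = add mult diff minus one zero scal cst power q_pow

lemma relator: "r \<in> relators \<Longrightarrow> L r = 0"
proof -
  obtain f where L: "\<And>x. L x = pr (f x)" and r: "\<And>r. r \<in> relators \<Longrightarrow> f r \<in> rels" using ex_hom by blast
  assume "r \<in> relators"
  then have "f r - 0 \<in> JJ" using JJ_rels[OF r] by simp
  then show ?thesis unfolding L pr_0[symmetric] pr_eq_iff .
qed

lemma ee_ee: "i \<in> {1..3} \<Longrightarrow> j \<in> {1..3} \<Longrightarrow> L (ee i) * L (ee j) = L (ee j) * L (ee i)"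
  using relator[OF relators_intros(1)[of i j]] by (simp add: comm_def simps)

lemma ee_er:
  assumes "i \<in> {1..3}" "j \<in> {1..2}"
  shows "L (ee i) * L (er j) = L (er j) * (L (ee i) + sc (cz (wt i j)))"
proof -
  have "L (ee i) * L (er j) - L (er j) * L (ee i) - sc (cz (wt i j)) * L (er j) = 0"
    using relator[OF relators_intros(2)[OF assms]] by (simp only: comm_def simps)
  then show ?thesis by (simp only: sc.central distrib_left) (simp add: algebra_simps)
qed

lemma ee_fr:
  assumes "i \<in> {1..3}" "j \<in> {1..2}"
  shows "L (ee i) * L (fr j) = L (fr j) * (L (ee i) + sc (- cz (wt i j)))"
proof -
  have "L (ee i) * L (fr j) - L (fr j) * L (ee i) + sc (cz (wt i j)) * L (fr j) = 0"
    using relator[OF relators_intros(3)[OF assms]] by (simp only: comm_def simps)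
  then show ?thesis
    by (simp only: sc.central distrib_left sc_minus) (simp add: algebra_simps eq_neg_iff_add_eq_0)
qed

lemma er_fr:
  assumes "i \<in> {1..2}" "j \<in> {1..2}"
  shows "L (er i) * L (fr j) - L (fr j) * L (er i) = (if i = j then L (q_num (hh i)) else 0)"
  using relator[OF relators_intros(4)[OF assms]]
  by (cases "i = j") (simp_all add: comm_def simps sc.zero of_cplx_1 sc.one)

lemma serre:
  assumes "k \<in> {1..2}" "l \<in> {1..2}" "k \<noteq> l"
  shows "L (er k) ^ 2 * L (er l) - sc (qz 1 + qz (- 1)) * (L (er k) * L (er l) * L (er k))
      + L (er l) * L (er k) ^ 2 = 0"
    and "L (fr k) ^ 2 * L (fr l) - sc (qz 1 + qz (- 1)) * (L (fr k) * L (fr l) * L (fr k))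
      + L (fr l) * L (fr k) ^ 2 = 0"
  using relator[OF relators_intros(5)[OF assms]] relator[OF relators_intros(6)[OF assms]]
  by (simp_all only: q_serre_def simps qq_eq quo_qz mult_1_right)

lemma ee_er':
  "L (ee 1) * L (er 1) = L (er 1) * (L (ee 1) + 1)"
  "L (ee 2) * L (er 1) = L (er 1) * (L (ee 2) - 1)"
  "L (ee 3) * L (er 1) = L (er 1) * L (ee 3)"
  "L (ee 1) * L (er 2) = L (er 2) * L (ee 1)"
  "L (ee 2) * L (er 2) = L (er 2) * (L (ee 2) + 1)"
  "L (ee 3) * L (er 2) = L (er 2) * (L (ee 3) - 1)"
proof -
  have "sc (cz (- 1)) = (- 1 :: ('m, 'k) quot)"
    by (simp add: sc_def scal_minus pr_simps of_cplx_minus of_cplx_1 flip: fps_const_neg)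
  then show
    "L (ee 1) * L (er 1) = L (er 1) * (L (ee 1) + 1)"
    "L (ee 2) * L (er 1) = L (er 1) * (L (ee 2) - 1)"
    "L (ee 3) * L (er 1) = L (er 1) * L (ee 3)"
    "L (ee 1) * L (er 2) = L (er 2) * L (ee 1)"
    "L (ee 2) * L (er 2) = L (er 2) * (L (ee 2) + 1)"
    "L (ee 3) * L (er 2) = L (er 2) * (L (ee 3) - 1)"
    using ee_er[of 1 1] ee_er[of 2 1] ee_er[of 3 1] ee_er[of 1 2] ee_er[of 2 2] ee_er[of 3 2]
    by (simp_all add: wt_def sc.zero of_cplx_1 sc.one)
qed

lemma ee_fr':
  "L (ee 1) * L (fr 1) = L (fr 1) * (L (ee 1) - 1)"
  "L (ee 2) * L (fr 1) = L (fr 1) * (L (ee 2) + 1)"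
  "L (ee 3) * L (fr 1) = L (fr 1) * L (ee 3)"
  "L (ee 1) * L (fr 2) = L (fr 2) * L (ee 1)"
  "L (ee 2) * L (fr 2) = L (fr 2) * (L (ee 2) - 1)"
  "L (ee 3) * L (fr 2) = L (fr 2) * (L (ee 3) + 1)"
proof -
  have "sc (- 1) = (- 1 :: ('m, 'k) quot)"
    by (simp add: sc_def scal_minus pr_simps)
  then show
    "L (ee 1) * L (fr 1) = L (fr 1) * (L (ee 1) - 1)"
    "L (ee 2) * L (fr 1) = L (fr 1) * (L (ee 2) + 1)"
    "L (ee 3) * L (fr 1) = L (fr 1) * L (ee 3)"
    "L (ee 1) * L (fr 2) = L (fr 2) * L (ee 1)"
    "L (ee 2) * L (fr 2) = L (fr 2) * (L (ee 2) - 1)"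
    "L (ee 3) * L (fr 2) = L (fr 2) * (L (ee 3) + 1)"
    using ee_fr[of 1 1] ee_fr[of 2 1] ee_fr[of 3 1] ee_fr[of 1 2] ee_fr[of 2 2] ee_fr[of 3 2]
    by (simp_all add: wt_def sc.zero of_cplx_1 of_cplx_minus sc.one)
qed

text \<open>The numbers 2 and - 1 are the entries of the Cartan matrix.\<close>

lemma hh_er:
  assumes "i \<in> {1..2}" "j \<in> {1..2}"
  shows "L (hh i) * L (er j) = L (er j) * (L (hh i) + sc (if i = j then 2 else - 1))"
proof -
  have *: "i = 1 \<or> i = 2" "j = 1 \<or> j = 2" using assms by auto
  have S: "Suc (Suc 0) = 2" "Suc 2 = 3" by simp_all
  show ?thesis using *
    by (elim disjE) (simp_all add: hh_def diff S ee_er'[unfolded One_nat_def] ee_er' sc_2 sc_minus sc.one algebra_simps)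
qed

lemma hh_fr:
  assumes "i \<in> {1..2}" "j \<in> {1..2}"
  shows "L (hh i) * L (fr j) = L (fr j) * (L (hh i) + sc (- (if i = j then 2 else - 1)))"
proof -
  have *: "i = 1 \<or> i = 2" "j = 1 \<or> j = 2" using assms by auto
  have S: "Suc (Suc 0) = 2" "Suc 2 = 3" by simp_all
  show ?thesis using *
    by (elim disjE) (simp_all add: hh_def diff S ee_fr'[unfolded One_nat_def] ee_fr' sc_2 sc_minus sc.one algebra_simps)
qed

lemma KU_hh_er:
  assumes "i \<in> {1..2}" "j \<in> {1..2}"
  shows "KU (L (hh i)) * L (er j) = sc (qz (if i = j then 2 else - 1)) * (L (er j) * KU (L (hh i)))"
    and "L (er j) * KU (- L (hh i)) = sc (qz (if i = j then 2 else - 1)) * (KU (- L (hh i)) * L (er j))"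
proof -
  let ?c = "(if i = j then 2 else - 1) :: 'k fps"
  show "KU (L (hh i)) * L (er j) = sc (qz ?c) * (L (er j) * KU (L (hh i)))"
    by (rule KU_shift_sc[OF hh_er[OF assms]])
  have "- L (hh i) * L (er j) = L (er j) * (- L (hh i) + sc (- ?c))"
    by (simp only: mult_minus_left hh_er[OF assms] sc_minus) (simp only: distrib_left mult_minus_right minus_add_distrib)
  from KU_shift_sc[OF this] have "sc (qz ?c) * (KU (- L (hh i)) * L (er j)) =
      sc (qz ?c * qz (- ?c)) * (L (er j) * KU (- L (hh i)))"
    by (simp only: sc.mult mult.assoc)
  then show "L (er j) * KU (- L (hh i)) = sc (qz ?c) * (KU (- L (hh i)) * L (er j))"
    using qz_minus[of "- ?c"] by (simp only: minus_minus sc.one mult_1)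
qed

lemma KU_hh_fr:
  assumes "i \<in> {1..2}" "j \<in> {1..2}"
  shows "KU (L (hh i)) * L (fr j) = sc (qz (- (if i = j then 2 else - 1))) * (L (fr j) * KU (L (hh i)))"
    and "KU (- L (hh i)) * L (fr j) = sc (qz (if i = j then 2 else - 1)) * (L (fr j) * KU (- L (hh i)))"
proof -
  let ?c = "(if i = j then 2 else - 1) :: 'k fps"
  show "KU (L (hh i)) * L (fr j) = sc (qz (- ?c)) * (L (fr j) * KU (L (hh i)))"
    by (rule KU_shift_sc[OF hh_fr[OF assms]])
  have "- L (hh i) * L (fr j) = L (fr j) * (- L (hh i) + sc (- (- ?c)))"
    by (simp only: mult_minus_left hh_fr[OF assms] sc_minus) (simp only: distrib_left mult_minus_right minus_add_distrib)
  from KU_shift_sc[OF this]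
  show "KU (- L (hh i)) * L (fr j) = sc (qz ?c) * (L (fr j) * KU (- L (hh i)))" by (simp only: minus_minus)
qed

lemma hh_hh: "i \<in> {1..2} \<Longrightarrow> j \<in> {1..2} \<Longrightarrow> L (hh i) * L (hh j) = L (hh j) * L (hh i)"
  and ee_hh: "l \<in> {1..3} \<Longrightarrow> j \<in> {1..2} \<Longrightarrow> L (ee l) * L (hh j) = L (hh j) * L (ee l)"
  using ee_ee[of i j] ee_ee[of i "j + 1"] ee_ee[of "i + 1" j] ee_ee[of "i + 1" "j + 1"]
    ee_ee[of l j] ee_ee[of l "j + 1"]
  by (simp_all add: hh_def diff algebra_simps)

lemma KU_hh_ee:
  assumes "l \<in> {1..3}" "j \<in> {1..2}"
  shows "KU (L (hh j)) * L (ee l) = L (ee l) * KU (L (hh j))"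
    and "KU (- L (hh j)) * L (ee l) = L (ee l) * KU (- L (hh j))"
  by (rule ps_commute; simp only: mult_minus_left mult_minus_right ee_hh[OF assms])+

end

section \<open>The coproduct is well defined\<close>

lemma alg_hom_Delta: "alg_hom Delta"
  unfolding Delta_def
proof (rule alg_hom_lin_ext)
  show "Delta_word 0 = 1" by (simp add: zero_gword_def)
  show "Delta_word (u + v) = Delta_word u * Delta_word v" for u v by (cases u; cases v) simp
qed

lemma Delta_gen_eq: "Delta (gen g) = Delta_gen g"
  by (simp add: Delta_def gen_def)

lemma alg_hom_commute:
  fixes f :: "('m::monoid_add \<Rightarrow>\<^sub>0 'k::comm_complex_algebra) fps \<Rightarrow> ('n::monoid_add \<Rightarrow>\<^sub>0 'k) fps"
  assumes f: "alg_hom f" and w: "\<And>w. f (mono_of w) * z = z * f (mono_of w)"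
  shows "f x * z = z * f x"
proof (rule X_linear_eqI[where x = x])
  show "X_linear (\<lambda>x. f x * z)" by (rule X_linear_comp[OF X_linear_mult_right alg_hom_X_linear[OF f]])
  show "X_linear (\<lambda>x. z * f x)" by (rule X_linear_comp[OF X_linear_mult_left alg_hom_X_linear[OF f]])
  show "f (scal (fps_const a) * mono_of w) * z = z * f (scal (fps_const a) * mono_of w)" for a w
    by (simp only: alg_hom_simps[OF f] mult_scal_left[of z] mult.assoc w)
qed

lemma leg1_leg2_commute: "leg1 (x :: 'k::comm_complex_algebra cfree) * leg2 y = leg2 y * leg1 x"
proof (rule alg_hom_commute[OF alg_hom_leg1])
  fix w
  show "leg1 (mono_of w) * leg2 y = leg2 y * leg1 (mono_of w)"
    by (rule alg_hom_commute[OF alg_hom_leg2, symmetric])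
       (simp add: leg1_def leg2_def mono_of_add[symmetric])
qed

lemma tens_one: "tens x 1 = leg1 x" "tens 1 x = leg2 x"
  by (simp_all add: tens_def alg_hom_simps[OF alg_hom_leg1] alg_hom_simps[OF alg_hom_leg2])

abbreviation (input) La :: "'k::comm_complex_algebra cfree \<Rightarrow> (gword \<times> gword, 'k) quot" where
  "La x \<equiv> pr (leg1 x)"
abbreviation (input) Lb :: "'k::comm_complex_algebra cfree \<Rightarrow> (gword \<times> gword, 'k) quot" where
  "Lb x \<equiv> pr (leg2 x)"

interpretation La: factor_map La
  by standard (auto simp: legs_prod_def legs_gword_def leg_legs)

interpretation Lb: factor_map Lb
  by standard (auto simp: legs_prod_def legs_gword_def leg_legs)

lemma La_Lb: "La x * Lb y = Lb y * La x"
  by (simp add: leg1_leg2_commute flip: pr_mult)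

lemma pr_Delta_gens:
  "i \<in> {1..3} \<Longrightarrow> pr (Delta (ee i)) = La (ee i) + Lb (ee i)"
  "i \<in> {1..2} \<Longrightarrow> pr (Delta (er i)) = La (er i) * KU (Lb (hh i)) + Lb (er i)"
  "i \<in> {1..2} \<Longrightarrow> pr (Delta (fr i)) = La (fr i) + KU (- La (hh i)) * Lb (fr i)"
proof -
  have 3: "i = 1 \<or> i = 2 \<or> i = 3" if "i \<in> {1..3}" for i :: nat using that by auto
  have 2: "i = 1 \<or> i = 2" if "i \<in> {1..2}" for i :: nat using that by auto
  have 4: "hh (Suc 0) = hh 1" by simp
  note s = tens_def pr_simps La.q_pow Lb.q_pow La.one Lb.one La.minus
  show "i \<in> {1..3} \<Longrightarrow> pr (Delta (ee i)) = La (ee i) + Lb (ee i)"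
    by (drule 3) (auto simp: ee_def Delta_gen_eq s)
  show "i \<in> {1..2} \<Longrightarrow> pr (Delta (er i)) = La (er i) * KU (Lb (hh i)) + Lb (er i)"
    by (drule 2) (auto simp: er_def Delta_gen_eq s)
  show "i \<in> {1..2} \<Longrightarrow> pr (Delta (fr i)) = La (fr i) + KU (- La (hh i)) * Lb (fr i)"
    by (drule 2) (auto simp: fr_def Delta_gen_eq s)
qed

lemma Delta_ee: "i \<in> {1..3} \<Longrightarrow> Delta (ee i) = leg1 (ee i) + leg2 (ee i)"
proof -
  have 3: "i = 1 \<or> i = 2 \<or> i = 3" if "i \<in> {1..3}" for i :: nat using that by auto
  show "i \<in> {1..3} \<Longrightarrow> ?thesis"
    by (drule 3) (auto simp: ee_def Delta_gen_eq tens_one)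
qed

lemma Delta_hh: "i \<in> {1..2} \<Longrightarrow> Delta (hh i) = leg1 (hh i) + leg2 (hh i)"
  by (simp add: hh_def alg_hom_simps[OF alg_hom_Delta] alg_hom_simps[OF alg_hom_leg1]
      alg_hom_simps[OF alg_hom_leg2] Delta_ee)

text \<open>In the quotient algebras \<open>\<omega>\<close> might be a zero divisor, so the fraction is treated in the free algebra.\<close>

lemma Delta_q_num:
  assumes "i \<in> {1..2}"
  shows "Delta (q_num (hh i) :: 'k::comm_complex_algebra cfree) =
    leg1 (q_num (hh i)) * leg2 (q_pow (hh i)) + leg1 (q_pow (- hh i)) * leg2 (q_num (hh i))"
proof (rule scal_omega_cancel)
  let ?h = "hh i :: 'k cfree"
  note D = alg_hom_simps[OF alg_hom_Delta] alg_hom_q_pow[OF alg_hom_Delta]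
  note l1 = alg_hom_simps[OF alg_hom_leg1] and l2 = alg_hom_simps[OF alg_hom_leg2]
  have c: "leg1 ?h * leg2 ?h = leg2 ?h * leg1 ?h" by (rule leg1_leg2_commute)
  have e: "q_pow (leg1 ?h + leg2 ?h) = leg1 (q_pow ?h) * leg2 (q_pow ?h)"
    "q_pow (- leg1 ?h - leg2 ?h) = leg1 (q_pow (- ?h)) * leg2 (q_pow (- ?h))"
    using q_pow_add[OF c] q_pow_add[of "- leg1 ?h" "- leg2 ?h"]
    by (simp_all add: c alg_hom_q_pow[OF alg_hom_leg1] alg_hom_q_pow[OF alg_hom_leg2] l1 l2)
  have "scal omega * Delta (q_num ?h) = Delta (scal omega * q_num ?h)" by (simp only: D)
  also have "\<dots> = q_pow (leg1 ?h + leg2 ?h) - q_pow (- leg1 ?h - leg2 ?h)"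
    by (simp add: omega_q_num D Delta_hh[OF assms])
  also have "\<dots> = leg1 (scal omega * q_num ?h) * leg2 (q_pow ?h)
      + leg1 (q_pow (- ?h)) * leg2 (scal omega * q_num ?h)"
    by (simp add: omega_q_num e l1 l2 algebra_simps)
  also have "\<dots> = scal omega * (leg1 (q_num ?h) * leg2 (q_pow ?h) + leg1 (q_pow (- ?h)) * leg2 (q_num ?h))"
    by (simp only: l1 l2 mult.assoc distrib_left mult_scal_left[of "leg1 (q_pow (- ?h))"])
  finally show "scal omega * Delta (q_num ?h) =
    scal omega * (leg1 (q_num ?h) * leg2 (q_pow ?h) + leg1 (q_pow (- ?h)) * leg2 (q_num ?h))" .
qed

text \<open>For \<Delta>(e) = e k + e' and \<Delta>(f) = f + m f', with group-like k and m:
  exchanging e k and m f' costs s when e passes m and the inverse s' when k passes f', so these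
  products drop out of the commutator.\<close>

lemma coproduct_commutator:
  fixes e :: "'a::ring"
  assumes "e * m = s * (m * e)" "k * f' = s' * (f' * k)"
    and c: "\<And>x. s * x = x * s" "\<And>x. s' * x = x * s'" "\<And>x. s * (s' * x) = x"
    and "e * e' = e' * e" "e * f' = f' * e" "f * k = k * f" "f * e' = e' * f"
      "m * k = k * m" "m * e' = e' * m" "m * f' = f' * m"
  shows "(e * k + e') * (f + m * f') - (f + m * f') * (e * k + e') =
    (e * f - f * e) * k + m * (e' * f' - f' * e')"
proof -
  have "(e * k) * (m * f') = (e * m) * (k * f')"
    by (simp only: mult.assoc assms(10)[symmetric, THEN assoc_rule])
  also have "\<dots> = s * (s' * ((m * e) * (f' * k)))"
    unfolding assms(1,2) by (metis c(2) mult.assoc)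
  also have "\<dots> = (m * e) * (f' * k)" by (rule c(3))
  also have "\<dots> = (m * f') * (e * k)"
    by (simp only: mult.assoc assms(7)[THEN assoc_rule])
  finally have x: "(e * k) * (m * f') = (m * f') * (e * k)" .
  have y: "e' * f = f * e'" "(e * k) * f = e * f * k" "e' * (m * f') = m * (e' * f')"
    by (simp_all only: mult.assoc assms(8,9,11)[symmetric] assms(11)[symmetric, THEN assoc_rule])
  show ?thesis by (simp add: distrib_left distrib_right x y) (simp add: algebra_simps)
qed

text \<open>The a's stand for e_i \<otimes> q^(h_i) and the b's for 1 \<otimes> e_i, with s = q and
  s' its inverse. Once all b's are moved to the left, the coefficients of each mixed monomial add up
  to zero. Each monomial has a single factor of index 2, so a2 never meets b2.\<close>

lemma serre_sum:
  fixes a1 :: "'a::ring"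
  assumes c: "\<And>x. x * s = s * x" "\<And>x. x * s' = s' * x" "\<And>x. s * (s' * x) = x"
    and ab: "a1 * b1 = s * (s * (b1 * a1))" "a1 * b2 = s' * (b2 * a1)" "a2 * b1 = s' * (b1 * a2)"
  shows "(a1 + b1) * (a1 + b1) * (a2 + b2) - (s + s') * ((a1 + b1) * (a2 + b2) * (a1 + b1))
      + (a2 + b2) * ((a1 + b1) * (a1 + b1)) =
    (a1 * a1 * a2 - (s + s') * (a1 * a2 * a1) + a2 * (a1 * a1)) +
    (b1 * b1 * b2 - (s + s') * (b1 * b2 * b1) + b2 * (b1 * b1))"
proof -
  have c': "s' * (s * x) = x" for x using c(2)[of s] c(3) by (metis mult.assoc)
  have l: "x * (s * y) = s * (x * y)" "x * (s' * y) = s' * (x * y)" for x y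
    using c by (metis mult.assoc)+
  note r = ab ab[THEN assoc_rule]
    c(1)[of a1] c(1)[of a2] c(1)[of b1] c(1)[of b2] c(2)[of a1] c(2)[of a2] c(2)[of b1] c(2)[of b2]
    l(1)[of a1] l(1)[of a2] l(1)[of b1] l(1)[of b2] l(2)[of a1] l(2)[of a2] l(2)[of b1] l(2)[of b2]
    c(3) c'
  show ?thesis
    by (simp add: distrib_left distrib_right left_diff_distrib right_diff_distrib mult.assoc r)
qed

lemma serre_mult:
  fixes e :: "'a::ring"
  assumes "k * e = e * k" "k * f = f * k" "l * e = e * l" "l * f = f * l" "l * k = k * l"
    and t: "\<And>x. x * t = t * x"
  shows "e * k * (e * k) * (f * l) - t * (e * k * (f * l) * (e * k)) + f * l * (e * k * (e * k)) =
    (e * e * f - t * (e * f * e) + f * (e * e)) * (k * (k * l))"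
  using assms by (simp add: algebra_simps assms(1-5)[THEN assoc_rule])

text \<open>The second form is the mirror image for \<Delta>(f), whose group-like factor sits in the
  other tensor factor.\<close>

lemma coproduct_weight:
  fixes a :: "'a::ring"
  assumes "a * e = e * (a + w)" "a * e' = e' * a" "b * e = e * b" "b * e' = e' * (b + w)"
    "a * k = k * a" "b * k = k * b" "\<And>x. w * x = x * w"
  shows "(a + b) * (e * k + e') = (e * k + e') * ((a + b) + w)"
    and "(b + a) * (e' + k * e) = (e' + k * e) * ((b + a) + w)"
proof -
  have "e * w = w * e" "e * (w * x) = w * (e * x)" "e' * w = w * e'" "k * w = w * k" "k * (w * x) = w * (k * x)" for x
    using assms(7) by (metis mult.assoc)+
  then show "(a + b) * (e * k + e') = (e * k + e') * ((a + b) + w)"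
    and "(b + a) * (e' + k * e) = (e' + k * e) * ((b + a) + w)"
    by (simp_all add: algebra_simps assms(1-6) assms(1-6)[THEN assoc_rule])
qed

lemma serre_coproduct:
  fixes a1 a2 b1 b2 k l :: "('m::rel_monoid, 'k::comm_complex_algebra) quot"
  defines "t \<equiv> sc (qz 1) + sc (qz (- 1))"
  assumes k: "k * b1 = sc (qz 2) * (b1 * k)" "k * b2 = sc (qz (- 1)) * (b2 * k)" "l * b1 = sc (qz (- 1)) * (b1 * l)"
    and ka: "k * a1 = a1 * k" "k * a2 = a2 * k" "l * a1 = a1 * l" "l * a2 = a2 * l" "l * k = k * l"
    and ab: "a1 * b1 = b1 * a1" "a1 * b2 = b2 * a1" "a2 * b1 = b1 * a2"
    and serre: "a1 * a1 * a2 - t * (a1 * a2 * a1) + a2 * (a1 * a1) = 0"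
      "b1 * b1 * b2 - t * (b1 * b2 * b1) + b2 * (b1 * b1) = 0"
  shows "(a1 * k + b1) * (a1 * k + b1) * (a2 * l + b2)
    - t * ((a1 * k + b1) * (a2 * l + b2) * (a1 * k + b1))
    + (a2 * l + b2) * ((a1 * k + b1) * (a1 * k + b1)) = 0"
proof -
  let ?q = "sc (qz 1) :: ('m, 'k) quot" and ?q' = "sc (qz (- 1)) :: ('m, 'k) quot"
  have q2: "sc (qz 2) = ?q * ?q" using qz_add[of "1 :: 'k fps" 1] by (simp add: sc.mult)
  have "(a1 * k + b1) * (a1 * k + b1) * (a2 * l + b2)
    - t * ((a1 * k + b1) * (a2 * l + b2) * (a1 * k + b1))
    + (a2 * l + b2) * ((a1 * k + b1) * (a1 * k + b1)) =
    (a1 * k * (a1 * k) * (a2 * l) - t * (a1 * k * (a2 * l) * (a1 * k)) + a2 * l * (a1 * k * (a1 * k)))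
    + (b1 * b1 * b2 - t * (b1 * b2 * b1) + b2 * (b1 * b1))"
    unfolding t_def
  proof (rule serre_sum)
    show "a1 * k * b1 = ?q * (?q * (b1 * (a1 * k)))"
      by (simp only: mult.assoc k q2 sc.left[of a1] ab[THEN assoc_rule])
    show "a1 * k * b2 = ?q' * (b2 * (a1 * k))" "a2 * l * b1 = ?q' * (b1 * (a2 * l))"
      by (simp_all only: mult.assoc k sc.left[of a1] sc.left[of a2] ab[THEN assoc_rule])
    show "x * ?q = ?q * x" "x * ?q' = ?q' * x" for x by (rule sc.central[symmetric])+
    show "?q * (?q' * x) = x" for x
      using qz_minus[of "1 :: 'k fps"] by (simp only: sc.mult' mult.commute[of "qz 1"] sc.one mult_1)
  qed
  also have "a1 * k * (a1 * k) * (a2 * l) - t * (a1 * k * (a2 * l) * (a1 * k)) + a2 * l * (a1 * k * (a1 * k)) =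
    (a1 * a1 * a2 - t * (a1 * a2 * a1) + a2 * (a1 * a1)) * (k * (k * l))"
  proof (rule serre_mult)
    show "x * t = t * x" for x unfolding t_def sc.add[symmetric] by (rule sc.central[symmetric])
  qed (rule ka)+
  finally show ?thesis by (simp only: serre mult_zero_left add_0)
qed

text \<open>This makes \<Delta> a map on classes. The inverse of F and the axioms for R are given
  modulo the relations only, and \<Delta> has to be applied to such congruences in one tensor
  factor.\<close>

lemma pr_Delta_relator:
  assumes "r \<in> relators" shows "pr (Delta r :: 'k::comm_complex_algebra cfree2) = 0"
proof -
  note D = alg_hom_simps[OF alg_hom_Delta] pr_simps
  have sc: "pr (scal c) = sc c" for c :: "'k fps" by (simp add: sc_def)
  have kc: "KU u * v = v * KU u" if "u * v = v * u" for u v :: "(gword \<times> gword, 'k) quot"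
    by (rule ps_commute[OF that])
  have ab: "Lb x * La y = La y * Lb x" for x y :: "'k cfree" by (rule La_Lb[symmetric])
  have KA: "KU (La x) * Lb y = Lb y * KU (La x)" and KB: "KU (Lb x) * La y = La y * KU (Lb x)"
    and KA': "KU (- La x) * Lb y = Lb y * KU (- La x)"
    and KK: "KU (- La x) * KU (Lb z) = KU (Lb z) * KU (- La x)" for x y z :: "'k cfree"
    by (intro kc ps_commute2; simp add: La_Lb)+
  from assms consider
    (1) i j where "i \<in> {1..3}" "j \<in> {1..3}" "r = comm (ee i) (ee j)"
    | (2) i j where "i \<in> {1..3}" "j \<in> {1..2}" "r = comm (ee i) (er j) - cst (wt i j) * er j"
    | (3) i j where "i \<in> {1..3}" "j \<in> {1..2}" "r = comm (ee i) (fr j) + cst (wt i j) * fr j"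
    | (4) i j where "i \<in> {1..2}" "j \<in> {1..2}"
        "r = comm (er i) (fr j) - cst (of_bool (i = j)) * q_num (hh i)"
    | (5) k l where "k \<in> {1..2}" "l \<in> {1..2}" "k \<noteq> l" "r = q_serre (er k) (er l)"
    | (6) k l where "k \<in> {1..2}" "l \<in> {1..2}" "k \<noteq> l" "r = q_serre (fr k) (fr l)"
    unfolding relators_def q_num_def by blast
  then show ?thesis
  proof cases
    case 1
    then show ?thesis
      by (simp add: comm_def D pr_Delta_gens La.ee_ee[OF 1(1,2)] Lb.ee_ee[OF 1(1,2)]
          ab distrib_left distrib_right del: atLeastAtMost_iff)
  next
    case 2
    let ?w = "sc (cz (wt i j)) :: (gword \<times> gword, 'k) quot"
    have "(La (ee i) + Lb (ee i)) * (La (er j) * KU (Lb (hh j)) + Lb (er j)) =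
        (La (er j) * KU (Lb (hh j)) + Lb (er j)) * ((La (ee i) + Lb (ee i)) + ?w)"
      by (rule coproduct_weight(1))
         (simp_all only: La.ee_er[OF 2(1,2)] Lb.ee_er[OF 2(1,2)] ab KB sc.central
            Lb.KU_hh_ee(1)[OF 2(1,2)])
    then show ?thesis
      unfolding 2(3) comm_def D pr_Delta_gens(1)[OF 2(1)] pr_Delta_gens(2)[OF 2(2)] cst_def sc
      by (simp only: sc.central) (simp add: algebra_simps)
  next
    case 3
    let ?w = "sc (- cz (wt i j)) :: (gword \<times> gword, 'k) quot"
    have "(La (ee i) + Lb (ee i)) * (La (fr j) + KU (- La (hh j)) * Lb (fr j)) =
        (La (fr j) + KU (- La (hh j)) * Lb (fr j)) * ((La (ee i) + Lb (ee i)) + ?w)"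
      by (rule coproduct_weight(2))
         (simp_all only: La.ee_fr[OF 3(1,2)] Lb.ee_fr[OF 3(1,2)] ab KA' sc.central
            La.KU_hh_ee(2)[OF 3(1,2)])
    then show ?thesis
      unfolding 3(3) comm_def D pr_Delta_gens(1)[OF 3(1)] pr_Delta_gens(3)[OF 3(2)] cst_def sc sc_minus
      by (simp only: sc.central) (simp add: algebra_simps)
  next
    case 4
    let ?c = "(if i = j then 2 else - 1) :: 'k fps"
    have ji: "(if j = i then 2 else - 1) = ?c" by simp
    have *: "(La (er i :: 'k cfree) * KU (Lb (hh i)) + Lb (er i)) * (La (fr j) + KU (- La (hh j)) * Lb (fr j))
        - (La (fr j) + KU (- La (hh j)) * Lb (fr j)) * (La (er i) * KU (Lb (hh i)) + Lb (er i)) =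
        (La (er i) * La (fr j) - La (fr j) * La (er i)) * KU (Lb (hh i))
        + KU (- La (hh j)) * (Lb (er i) * Lb (fr j) - Lb (fr j) * Lb (er i))"
    proof (rule coproduct_commutator[of "La (er i)" "KU (- La (hh j))" "sc (qz ?c)" "KU (Lb (hh i))"
          "Lb (fr j)" "sc (qz (- ?c))" "Lb (er i)" "La (fr j)"])
      show "La (er i) * KU (- La (hh j)) = sc (qz ?c) * (KU (- La (hh j)) * La (er i))"
        unfolding ji[symmetric] by (rule La.KU_hh_er(2)[OF 4(2,1)])
      show "KU (Lb (hh i)) * Lb (fr j) = sc (qz (- ?c)) * (Lb (fr j) * KU (Lb (hh i)))"
        by (rule Lb.KU_hh_fr(1)[OF 4(1,2)])
      show "sc (qz ?c) * (sc (qz (- ?c)) * x) = x" for x :: "(gword \<times> gword, 'k) quot"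
        using qz_minus[of "- ?c"] by (simp only: sc.mult' minus_minus sc.one mult_1)
    qed (rule sc.central La_Lb La_Lb[symmetric] KB[symmetric] KA' KK)+
    show ?thesis
      unfolding 4(3) comm_def D pr_Delta_gens(2)[OF 4(1)] pr_Delta_gens(3)[OF 4(2)] *
        La.er_fr[OF 4(1,2)] Lb.er_fr[OF 4(1,2)] Delta_q_num[OF 4(1)] La.q_pow Lb.q_pow La.minus
      by (cases "i = j") (simp_all add: pr_simps)
  next
    case 5
    have kl: "(if k = l then 2 else - 1) = (- 1 :: 'k fps)" "(if l = k then 2 else - 1) = (- 1 :: 'k fps)"
      "(if k = k then 2 else - 1) = (2 :: 'k fps)" using 5(3) by simp_all
    show ?thesis
      unfolding 5(4) q_serre_def D power2_eq_square pr_Delta_gens(2)[OF 5(1)] pr_Delta_gens(2)[OF 5(2)]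
        qq_eq quo_qz mult_1_right sc sc.add
    proof (rule serre_coproduct)
      show "KU (Lb (hh k)) * Lb (er k :: 'k cfree) = sc (qz 2) * (Lb (er k) * KU (Lb (hh k)))"
        "KU (Lb (hh k)) * Lb (er l :: 'k cfree) = sc (qz (- 1)) * (Lb (er l) * KU (Lb (hh k)))"
        "KU (Lb (hh l)) * Lb (er k :: 'k cfree) = sc (qz (- 1)) * (Lb (er k) * KU (Lb (hh l)))"
        unfolding Lb.KU_hh_er(1)[OF 5(1,1)] Lb.KU_hh_er(1)[OF 5(1,2)] Lb.KU_hh_er(1)[OF 5(2,1)] kl by (rule refl)+
      show "KU (Lb (hh l :: 'k cfree)) * KU (Lb (hh k)) = KU (Lb (hh k)) * KU (Lb (hh l))"
        by (rule ps_commute2[OF Lb.hh_hh[OF 5(2,1)]])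
    qed (rule KB La_Lb La.serre(1)[OF 5(1-3), unfolded power2_eq_square sc.add]
        Lb.serre(1)[OF 5(1-3), unfolded power2_eq_square sc.add])+
  next
    case 6
    have kl: "(if k = l then 2 else - 1) = (- 1 :: 'k fps)" "(if l = k then 2 else - 1) = (- 1 :: 'k fps)"
      "(if k = k then 2 else - 1) = (2 :: 'k fps)" using 6(3) by simp_all
    have hh: "- La (hh l :: 'k cfree) * - La (hh k) = - La (hh k) * - La (hh l)"
      by (simp only: mult_minus_left mult_minus_right La.hh_hh[OF 6(2,1)])
    \<comment> \<open>Listing the summands of \<Delta>(f) in the opposite order makes them look like
      those of \<Delta>(e) with the tensor factors exchanged, so that one lemma serves both Serre
      relations.\<close>
    have D': "La (fr i :: 'k cfree) + KU (- La (hh i)) * Lb (fr i) = Lb (fr i) * KU (- La (hh i)) + La (fr i)" for i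
      by (simp only: KA' add.commute)
    show ?thesis
      unfolding 6(4) q_serre_def D power2_eq_square pr_Delta_gens(3)[OF 6(1)] pr_Delta_gens(3)[OF 6(2)]
        qq_eq quo_qz mult_1_right sc sc.add D'
    proof (rule serre_coproduct)
      show "KU (- La (hh k)) * La (fr k :: 'k cfree) = sc (qz 2) * (La (fr k) * KU (- La (hh k)))"
        "KU (- La (hh k)) * La (fr l :: 'k cfree) = sc (qz (- 1)) * (La (fr l) * KU (- La (hh k)))"
        "KU (- La (hh l)) * La (fr k :: 'k cfree) = sc (qz (- 1)) * (La (fr k) * KU (- La (hh l)))"
        unfolding La.KU_hh_fr(2)[OF 6(1,1)] La.KU_hh_fr(2)[OF 6(1,2)] La.KU_hh_fr(2)[OF 6(2,1)] kl by (rule refl)+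
    qed (rule KA' ab ps_commute2[OF hh] La.serre(2)[OF 6(1-3), unfolded power2_eq_square sc.add]
        Lb.serre(2)[OF 6(1-3), unfolded power2_eq_square sc.add])+
  qed
qed

section \<open>The coproduct on tensor factors\<close>

lemma alg_hom_leg_commute:
  "leg12 (x :: 'k::comm_complex_algebra cfree2) * mono_of (0, 0, v) = mono_of (0, 0, v) * leg12 x"
  "leg23 (x :: 'k::comm_complex_algebra cfree2) * mono_of (u, 0, 0) = mono_of (u, 0, 0) * leg23 x"
proof -
  show "leg12 x * mono_of (0, 0, v) = mono_of (0, 0, v) * leg12 x"
    by (rule alg_hom_commute[OF alg_hom_leg12]) (auto simp: leg12_def mono_of_add[symmetric])
  show "leg23 x * mono_of (u, 0, 0) = mono_of (u, 0, 0) * leg23 x"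
    by (rule alg_hom_commute[OF alg_hom_leg23]) (auto simp: leg23_def mono_of_add[symmetric])
qed

lemma alg_hom_tens_id: "alg_hom (tens_id (Delta :: 'k::comm_complex_algebra cfree \<Rightarrow> _))"
  unfolding tens_id_def
proof (rule alg_hom_lin_ext)
  note s = alg_hom_simps[OF alg_hom_leg12] alg_hom_simps[OF alg_hom_Delta]
  show "(case 0 of (u, v) \<Rightarrow> leg12 (Delta (mono_of u :: 'k cfree)) * mono_of (0, 0, v)) = 1"
    by (simp add: case_prod_beta s zero_prod_def[symmetric])
  fix p q :: "gword \<times> gword"
  obtain u v u' v' where [simp]: "p = (u, v)" "q = (u', v')" by fastforce
  have "leg12 (Delta (mono_of u :: 'k cfree)) * leg12 (Delta (mono_of u')) * (mono_of (0, 0, v) * mono_of (0, 0, v'))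
    = leg12 (Delta (mono_of u)) * mono_of (0, 0, v) * (leg12 (Delta (mono_of u')) * mono_of (0, 0, v'))"
    by (simp only: mult.assoc alg_hom_leg_commute[symmetric, THEN assoc_rule])
  then show "(case p + q of (u, v) \<Rightarrow> leg12 (Delta (mono_of u :: 'k cfree)) * mono_of (0, 0, v)) =
      (case p of (u, v) \<Rightarrow> leg12 (Delta (mono_of u)) * mono_of (0, 0, v)) *
      (case q of (u, v) \<Rightarrow> leg12 (Delta (mono_of u)) * mono_of (0, 0, v))"
    by (simp add: mono_of_add[of u] s) (simp add: mono_of_add[symmetric])
qed

lemma alg_hom_id_tens: "alg_hom (id_tens (Delta :: 'k::comm_complex_algebra cfree \<Rightarrow> _))"
  unfolding id_tens_def
proof (rule alg_hom_lin_ext)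
  note s = alg_hom_simps[OF alg_hom_leg23] alg_hom_simps[OF alg_hom_Delta]
  show "(case 0 of (u, v) \<Rightarrow> mono_of (u, 0, 0) * leg23 (Delta (mono_of v :: 'k cfree))) = 1"
    by (simp add: case_prod_beta s zero_prod_def[symmetric])
  fix p q :: "gword \<times> gword"
  obtain u v u' v' where [simp]: "p = (u, v)" "q = (u', v')" by fastforce
  have "(mono_of (u, 0, 0) * mono_of (u', 0, 0)) * (leg23 (Delta (mono_of v :: 'k cfree)) * leg23 (Delta (mono_of v')))
    = mono_of (u, 0, 0) * leg23 (Delta (mono_of v)) * (mono_of (u', 0, 0) * leg23 (Delta (mono_of v')))"
    by (simp only: mult.assoc alg_hom_leg_commute[THEN assoc_rule])
  then show "(case p + q of (u, v) \<Rightarrow> mono_of (u, 0, 0) * leg23 (Delta (mono_of v :: 'k cfree))) =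
      (case p of (u, v) \<Rightarrow> mono_of (u, 0, 0) * leg23 (Delta (mono_of v))) *
      (case q of (u, v) \<Rightarrow> mono_of (u, 0, 0) * leg23 (Delta (mono_of v)))"
    by (simp add: mono_of_add[of v] s) (simp add: mono_of_add[symmetric])
qed

section \<open>Permutations of the tensor factors\<close>

definition tau12 :: "'k::comm_ring_1 cfree3 \<Rightarrow> 'k cfree3" where
  "tau12 = lin_ext (\<lambda>(u, v, w). mono_of (v, u, w))"

definition tau23 :: "'k::comm_ring_1 cfree3 \<Rightarrow> 'k cfree3" where
  "tau23 = lin_ext (\<lambda>(u, v, w). mono_of (u, w, v))"

lemma alg_hom_tau12: "alg_hom tau12" and alg_hom_tau23: "alg_hom tau23"
  unfolding tau12_def tau23_def
  by (rule alg_hom_lin_ext; simp add: case_prod_beta zero_prod_def[symmetric] mono_of_add[symmetric] plus_prod_def)+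

lemma tau_leg:
  "tau12 (leg12 x) = leg12 (flip x)" "tau12 (leg13 x) = leg23 x" "tau12 (leg23 x) = leg13 x"
  "tau23 (leg23 x) = leg23 (flip x)" "tau23 (leg13 x) = leg12 x" "tau23 (leg12 x) = leg13 x"
proof -
  note d = tau12_def tau23_def flip_def leg12_def leg13_def leg23_def
  note c = alg_hom_comp[OF alg_hom_tau12] alg_hom_comp[OF alg_hom_tau23]
    alg_hom_comp[OF alg_hom_leg12 alg_hom_flip] alg_hom_comp[OF alg_hom_leg23 alg_hom_flip]
  show "tau12 (leg12 x) = leg12 (flip x)"
    by (rule alg_hom_eqI[OF c(1)[OF alg_hom_leg12] c(3)]) (auto simp: d)
  show "tau12 (leg13 x) = leg23 x"
    by (rule alg_hom_eqI[OF c(1)[OF alg_hom_leg13] alg_hom_leg23]) (auto simp: d)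
  show "tau12 (leg23 x) = leg13 x"
    by (rule alg_hom_eqI[OF c(1)[OF alg_hom_leg23] alg_hom_leg13]) (auto simp: d)
  show "tau23 (leg23 x) = leg23 (flip x)"
    by (rule alg_hom_eqI[OF c(2)[OF alg_hom_leg23] c(4)]) (auto simp: d)
  show "tau23 (leg13 x) = leg12 x"
    by (rule alg_hom_eqI[OF c(2)[OF alg_hom_leg13] alg_hom_leg12]) (auto simp: d)
  show "tau23 (leg12 x) = leg13 x"
    by (rule alg_hom_eqI[OF c(2)[OF alg_hom_leg12] alg_hom_leg13]) (auto simp: d)
qed

lemma flip_leg: "flip (leg1 x) = leg2 x" "flip (leg2 x) = leg1 x"
proof -
  note d = flip_def leg1_def leg2_def
  show "flip (leg1 x) = leg2 x"
    by (rule alg_hom_eqI[OF alg_hom_comp[OF alg_hom_flip alg_hom_leg1] alg_hom_leg2]) (auto simp: d)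
  show "flip (leg2 x) = leg1 x"
    by (rule alg_hom_eqI[OF alg_hom_comp[OF alg_hom_flip alg_hom_leg2] alg_hom_leg1]) (auto simp: d)
qed

lemma leg_leg:
  "leg13 (leg1 x) = leg12 (leg1 x)" "leg23 (leg1 x) = leg12 (leg2 x)" "leg13 (leg2 x) = leg23 (leg2 x)"
proof -
  note d = leg1_def leg2_def leg12_def leg13_def leg23_def
  show "leg13 (leg1 x) = leg12 (leg1 x)"
    by (rule alg_hom_eqI[OF alg_hom_comp[OF alg_hom_leg13 alg_hom_leg1] alg_hom_comp[OF alg_hom_leg12 alg_hom_leg1]])
       (auto simp: d)
  show "leg23 (leg1 x) = leg12 (leg2 x)"
    by (rule alg_hom_eqI[OF alg_hom_comp[OF alg_hom_leg23 alg_hom_leg1] alg_hom_comp[OF alg_hom_leg12 alg_hom_leg2]])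
       (auto simp: d)
  show "leg13 (leg2 x) = leg23 (leg2 x)"
    by (rule alg_hom_eqI[OF alg_hom_comp[OF alg_hom_leg13 alg_hom_leg2] alg_hom_comp[OF alg_hom_leg23 alg_hom_leg2]])
       (auto simp: d)
qed

lemma tens_id_leg:
  "tens_id Delta (leg1 x) = leg12 (Delta x)" "tens_id Delta (leg2 x) = leg23 (leg2 x)"
  "id_tens Delta (leg1 x) = leg12 (leg1 x)" "id_tens Delta (leg2 x) = leg23 (Delta x)"
proof -
  note d = tens_id_def id_tens_def leg1_def leg2_def leg12_def leg23_def
  note z = alg_hom_simps[OF alg_hom_Delta] alg_hom_simps[OF alg_hom_leg12] alg_hom_simps[OF alg_hom_leg23]
    zero_prod_def[symmetric] mono_of_0
  have 1: "Delta (mono_of (0::gword)) = 1" by (simp add: z)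
  have 2: "mono_of (0, 0, 0) = 1" by (simp add: z)
  note c = alg_hom_comp[OF alg_hom_tens_id alg_hom_leg1] alg_hom_comp[OF alg_hom_tens_id alg_hom_leg2]
    alg_hom_comp[OF alg_hom_id_tens alg_hom_leg1] alg_hom_comp[OF alg_hom_id_tens alg_hom_leg2]
  show "tens_id Delta (leg1 x) = leg12 (Delta x)"
    by (rule alg_hom_eqI[OF c(1) alg_hom_comp[OF alg_hom_leg12 alg_hom_Delta]]) (simp add: tens_id_def leg1_def 2)
  show "tens_id Delta (leg2 x) = leg23 (leg2 x)"
    by (rule alg_hom_eqI[OF c(2) alg_hom_comp[OF alg_hom_leg23 alg_hom_leg2]])
       (simp add: tens_id_def leg2_def 1 z, simp add: leg23_def zero_prod_def)
  show "id_tens Delta (leg1 x) = leg12 (leg1 x)"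
    by (rule alg_hom_eqI[OF c(3) alg_hom_comp[OF alg_hom_leg12 alg_hom_leg1]])
       (simp add: id_tens_def leg1_def 1 z, simp add: leg12_def zero_prod_def)
  show "id_tens Delta (leg2 x) = leg23 (Delta x)"
    by (rule alg_hom_eqI[OF c(4) alg_hom_comp[OF alg_hom_leg23 alg_hom_Delta]]) (simp add: id_tens_def leg2_def 2)
qed

text \<open>After a flip \<Delta> acts on the other factor; the three legs produced are brought into
  order by a cyclic permutation.\<close>

lemma tens_id_flip:
  "tens_id Delta (flip x) = tau23 (tau12 (id_tens Delta x))"
  "id_tens Delta (flip x) = tau12 (tau23 (tens_id Delta x))"
proof -
  note c1 = alg_hom_comp[OF alg_hom_tens_id alg_hom_flip]
    alg_hom_comp[OF alg_hom_tau23 alg_hom_comp[OF alg_hom_tau12 alg_hom_id_tens]]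
  note c2 = alg_hom_comp[OF alg_hom_id_tens alg_hom_flip]
    alg_hom_comp[OF alg_hom_tau12 alg_hom_comp[OF alg_hom_tau23 alg_hom_tens_id]]
  have m: "tau23 (tau12 (mono_of (u, 0, 0))) = mono_of (0, 0, u)"
    "tau12 (tau23 (mono_of (0, 0, u))) = mono_of (u, 0, 0)" for u
    by (simp_all add: tau12_def tau23_def)
  show "tens_id Delta (flip x) = tau23 (tau12 (id_tens Delta x))"
    by (rule alg_hom_eqI[OF c1])
       (auto simp: flip_def tens_id_def id_tens_def alg_hom_mult[OF alg_hom_tau12] alg_hom_mult[OF alg_hom_tau23]
         m tau_leg alg_hom_leg_commute)
  show "id_tens Delta (flip x) = tau12 (tau23 (tens_id Delta x))"
    by (rule alg_hom_eqI[OF c2])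
       (auto simp: flip_def tens_id_def id_tens_def alg_hom_mult[OF alg_hom_tau12] alg_hom_mult[OF alg_hom_tau23]
         m tau_leg alg_hom_leg_commute)
qed

section \<open>Descent of the structure maps to classes\<close>

lemma pr_relator3:
  assumes "r \<in> relators"
  shows "pr (leg12 (leg1 r)) = 0" "pr (leg12 (leg2 r)) = 0" "pr (leg23 (leg2 r)) = 0"
  using assms by (auto simp: rels_prod3 pr_eq_iff[of _ 0, unfolded pr_0] intro!: JJ_rels)

lemma pr_relator2:
  assumes "r \<in> relators"
  shows "pr (leg1 r) = 0" "pr (leg2 r) = 0"
  using assms by (auto simp: rels_prod pr_eq_iff[of _ 0, unfolded pr_0] intro!: JJ_rels)

lemma pr_leg_cong:
  assumes "pr x = pr y"
  shows "pr (leg12 x) = pr (leg12 y)" "pr (leg13 x) = pr (leg13 y)" "pr (leg23 x) = pr (leg23 y)"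
    and "pr (flip x) = pr (flip y)"
  by (rule pr_alg_hom_cong[OF _ _ assms]; auto simp: rels_prod pr_relator3 pr_relator2 leg_leg flip_leg
      intro: alg_hom_leg12 alg_hom_leg13 alg_hom_leg23 alg_hom_flip)+

lemma pr_tens_id_cong:
  assumes "pr x = pr y"
  shows "pr (tens_id Delta x) = pr (tens_id Delta y)" "pr (id_tens Delta x) = pr (id_tens Delta y)"
proof -
  have D: "pr (leg12 (Delta r)) = 0" "pr (leg23 (Delta r)) = 0" if "r \<in> relators" for r :: "'a cfree"
    using pr_leg_cong(1,3)[of "Delta r" 0] pr_Delta_relator[OF that]
    by (simp_all add: pr_simps alg_hom_simps[OF alg_hom_leg12] alg_hom_simps[OF alg_hom_leg23])
  show "pr (tens_id Delta x) = pr (tens_id Delta y)" "pr (id_tens Delta x) = pr (id_tens Delta y)"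
    by (rule pr_alg_hom_cong[OF _ _ assms]; auto simp: rels_prod pr_relator3 tens_id_leg D
      intro: alg_hom_tens_id alg_hom_id_tens)+
qed

lemma pr_tau_cong:
  assumes "pr x = pr y"
  shows "pr (tau12 x) = pr (tau12 y)" "pr (tau23 x) = pr (tau23 y)"
proof -
  have t: "tau12 (leg12 (leg1 r)) = leg12 (leg2 r)" "tau12 (leg12 (leg2 r)) = leg12 (leg1 r)"
    "tau12 (leg23 (leg2 r)) = leg23 (leg2 r)"
    "tau23 (leg12 (leg1 r)) = leg12 (leg1 r)" "tau23 (leg12 (leg2 r)) = leg23 (leg2 r)"
    "tau23 (leg23 (leg2 r)) = leg12 (leg2 r)" for r :: "'a cfree"
    by (simp_all add: tau_leg flip_leg leg_leg)
  show "pr (tau12 x) = pr (tau12 y)" "pr (tau23 x) = pr (tau23 y)"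
    by (rule pr_alg_hom_cong[OF _ _ assms]; auto simp: rels_prod3 pr_relator3 t
      intro: alg_hom_tau12 alg_hom_tau23)+
qed

section \<open>Twisting a universal R-matrix\<close>

lemma pr_X_linear_eqI:
  fixes f g :: "('m::monoid_add \<Rightarrow>\<^sub>0 'k::comm_complex_algebra) fps \<Rightarrow> ('n::rel_monoid \<Rightarrow>\<^sub>0 'k) fps"
  assumes f: "X_linear f" and g: "X_linear g"
    and eq: "\<And>a w. pr (f (scal (fps_const a) * mono_of w)) = pr (g (scal (fps_const a) * mono_of w))"
  shows "pr (f x) = pr (g x)"
proof -
  have c: "pr (f (fps_const p)) = pr (g (fps_const p))" for p
  proof -
    let ?l = "Poly_Mapping.lookup p"
    have "p = (\<Sum>w\<in>Poly_Mapping.keys p. Poly_Mapping.single w (?l w))"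
      by (rule poly_mapping_eqI) (simp add: lookup_sum lookup_single when_def in_keys_iff)
    then have "fps_const p = fps_const (\<Sum>w\<in>Poly_Mapping.keys p. Poly_Mapping.single w (?l w))"
      by simp
    also have "\<dots> = (\<Sum>w\<in>Poly_Mapping.keys p. scal (fps_const (?l w)) * mono_of w)"
      by (rule fps_ext) (simp add: fps_sum_nth scal_const_mono_of)
    finally show ?thesis
      by (simp only: X_linear_sum[OF f] X_linear_sum[OF g] pr_sum eq)
  qed
  have "pr (xser (\<lambda>n. f (fps_const (x $ n)))) = pr (xser (\<lambda>n. g (fps_const (x $ n))))"
    by (rule pr_xser_cong) (rule c)
  then show ?thesis
    by (simp only: X_linear_xser[OF f, symmetric] X_linear_xser[OF g, symmetric] xser_const)
qed

text \<open>Here F and G are just two elements of the completed free algebra, where the twisted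
  coproduct is not multiplicative, so the comparison goes by linearity. It works because G, placed
  in the two legs of the coproduct, commutes with the remaining leg.\<close>

lemma tens_id_twisted:
  "tens_id (twisted_Delta F G) x = leg12 F * tens_id Delta x * leg12 G"
  "id_tens (twisted_Delta F G) x = leg23 F * id_tens Delta x * leg23 G"
proof -
  have X: "X_linear (\<lambda>x. a * f x * b)" if "X_linear f" for f :: "'a cfree2 \<Rightarrow> 'a cfree3" and a b
    by (rule X_linear_comp[OF X_linear_mult_right X_linear_comp[OF X_linear_mult_left that]])
  show "tens_id (twisted_Delta F G) x = leg12 F * tens_id Delta x * leg12 G"
  proof (rule X_linear_eqI[where x = x, OF _ X])
    fix a and w :: "gword \<times> gword"
    show "tens_id (twisted_Delta F G) (scal (fps_const a) * mono_of w)
      = leg12 F * tens_id Delta (scal (fps_const a) * mono_of w) * leg12 G"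
      by (cases w) (simp add: tens_id_def lin_ext_scal_mult twisted_Delta_def alg_hom_mult[OF alg_hom_leg12]
          mult.assoc mult_scal_left[of "leg12 F"] alg_hom_leg_commute[symmetric])
  qed (simp_all only: tens_id_def X_linear_lin_ext)
  show "id_tens (twisted_Delta F G) x = leg23 F * id_tens Delta x * leg23 G"
  proof (rule X_linear_eqI[where x = x, OF _ X])
    fix a and w :: "gword \<times> gword"
    show "id_tens (twisted_Delta F G) (scal (fps_const a) * mono_of w)
      = leg23 F * id_tens Delta (scal (fps_const a) * mono_of w) * leg23 G"
      by (cases w) (simp add: id_tens_def lin_ext_scal_mult twisted_Delta_def alg_hom_mult[OF alg_hom_leg23]
          mult.assoc mult_scal_left[of "leg23 F"] alg_hom_leg_commute[THEN assoc_rule])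
  qed (simp_all only: id_tens_def X_linear_lin_ext)
qed

text \<open>On a word, R and the split factor obey the exchange relation in two legs, while the
  third leg is a spectator commuting with R; linearity and continuity extend this to all x.\<close>

lemma R_intertwines:
  fixes R :: "'k::comm_complex_algebra cfree2"
  assumes "\<And>a. pr (R * Delta a) = pr (flip (Delta a) * R)"
  shows "pr (leg12 R * tens_id Delta x) = pr (tau12 (tens_id Delta x) * leg12 R)"
    and "pr (leg23 R * id_tens Delta x) = pr (tau23 (id_tens Delta x) * leg23 R)"
proof -
  have t: "tau12 (mono_of (0, 0, v)) = mono_of (0, 0, v)" "tau23 (mono_of (u, 0, 0)) = mono_of (u, 0, 0)" for u v
    by (simp_all add: tau12_def tau23_def)
  note T = alg_hom_simps[OF alg_hom_tau12] alg_hom_simps[OF alg_hom_tau23]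
  have l: "pr (leg12 R) * pr (leg12 (Delta a)) = pr (leg12 (flip (Delta a))) * pr (leg12 R)"
    "pr (leg23 R) * pr (leg23 (Delta a)) = pr (leg23 (flip (Delta a))) * pr (leg23 R)" for a
    using pr_leg_cong(1,3)[OF assms[of a]]
    by (simp_all add: alg_hom_mult[OF alg_hom_leg12] alg_hom_mult[OF alg_hom_leg23] pr_mult)
  have c: "pr (leg12 R) * pr (mono_of (0, 0, v)) = pr (mono_of (0, 0, v)) * pr (leg12 R)"
    "pr (leg23 R) * pr (mono_of (u, 0, 0)) = pr (mono_of (u, 0, 0)) * pr (leg23 R)" for u v
    by (simp_all only: pr_mult[symmetric] alg_hom_leg_commute)
  show "pr (leg12 R * tens_id Delta x) = pr (tau12 (tens_id Delta x) * leg12 R)"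
  proof (rule pr_X_linear_eqI[where x = x])
    show "X_linear (\<lambda>x. leg12 R * tens_id Delta x)"
      by (rule X_linear_comp[OF X_linear_mult_left alg_hom_X_linear[OF alg_hom_tens_id]])
    show "X_linear (\<lambda>x. tau12 (tens_id Delta x) * leg12 R)"
      by (rule X_linear_comp[OF X_linear_mult_right alg_hom_X_linear[OF alg_hom_comp[OF alg_hom_tau12 alg_hom_tens_id]]])
    show "pr (leg12 R * tens_id Delta (scal (fps_const a) * mono_of w)) =
      pr (tau12 (tens_id Delta (scal (fps_const a) * mono_of w)) * leg12 R)" for a w
      by (cases w) (simp add: tens_id_def lin_ext_scal_mult T t tau_leg pr_mult mult.assoc
          sc_def[symmetric] sc.left[of "pr (leg12 R)"] l[THEN assoc_rule] c)
  qed
  show "pr (leg23 R * id_tens Delta x) = pr (tau23 (id_tens Delta x) * leg23 R)"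
  proof (rule pr_X_linear_eqI[where x = x])
    show "X_linear (\<lambda>x. leg23 R * id_tens Delta x)"
      by (rule X_linear_comp[OF X_linear_mult_left alg_hom_X_linear[OF alg_hom_id_tens]])
    show "X_linear (\<lambda>x. tau23 (id_tens Delta x) * leg23 R)"
      by (rule X_linear_comp[OF X_linear_mult_right alg_hom_X_linear[OF alg_hom_comp[OF alg_hom_tau23 alg_hom_id_tens]]])
    show "pr (leg23 R * id_tens Delta (scal (fps_const a) * mono_of w)) =
      pr (tau23 (id_tens Delta (scal (fps_const a) * mono_of w)) * leg23 R)" for a w
      by (cases w) (simp add: id_tens_def lin_ext_scal_mult T t tau_leg pr_mult mult.assoc
          sc_def[symmetric] sc.left[of "pr (leg23 R)"] l c(2)[THEN assoc_rule])
  qed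
qed

text \<open>In the first hexagon the permuted cocycle identity rewrites F_12 (\<Delta> \<otimes>
  id)(F_21) as F_31 times a permuted copy S of (\<Delta> \<otimes> id)(F). On the right, the inverse
  cocycle identity lets R_23 and then R_13 pass the coproducts of G; this releases G_13 F_32 and
  turns the rest into the inverse of S. What remains is F_31 R_13 G_13 F_32 R_23 G_23. The second
  hexagon is the mirror image.\<close>

theorem universal_R_matrix_twisted:
  fixes F G R :: "'k::comm_complex_algebra cfree2"
  assumes cocycle: "pr (leg12 F * tens_id Delta F) = pr (leg23 F * id_tens Delta F)"
    and inv: "inverse_in_U2 F G"
    and R: "universal_R_matrix Delta R"
  shows "universal_R_matrix (twisted_Delta F G) (flip F * R * G)"
proof -
  note l = alg_hom_simps[OF alg_hom_leg12] alg_hom_simps[OF alg_hom_leg13] alg_hom_simps[OF alg_hom_leg23]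
    alg_hom_simps[OF alg_hom_flip] alg_hom_simps[OF alg_hom_tens_id] alg_hom_simps[OF alg_hom_id_tens]
    alg_hom_simps[OF alg_hom_tau12] alg_hom_simps[OF alg_hom_tau23]
  have FG: "pr (F * G) = pr 1" "pr (G * F) = pr 1"
    using inv by (simp_all add: inverse_in_U2_def eqU2_iff)
  obtain R' where R': "pr (R * R') = pr 1" "pr (R' * R) = pr 1"
    using R by (auto simp: universal_R_matrix_def inverse_in_U2_def eqU2_iff)
  have RD: "pr (R * Delta a) = pr (flip (Delta a) * R)" for a
    using R by (simp add: universal_R_matrix_def eqU2_iff)
  have RR: "pr (tens_id Delta R) = pr (leg13 R) * pr (leg23 R)" "pr (id_tens Delta R) = pr (leg13 R) * pr (leg12 R)"
    using R by (simp_all add: universal_R_matrix_def eqU3_iff pr_mult)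
  note FG1 = pr_leg_cong[OF FG(1)] pr_tens_id_cong[OF FG(1)]
  note FG2 = pr_leg_cong[OF FG(2)] pr_tens_id_cong[OF FG(2)]
  note fl1 = pr_leg_cong[OF FG1(4)] and fl2 = pr_leg_cong[OF FG2(4)]
  have g12: "pr (leg12 F) * pr (leg12 G) = 1" and g23: "pr (leg23 F) * pr (leg23 G) = 1"
    and g23': "pr (leg23 G) * pr (leg23 F) = 1"
    and tF: "pr (tens_id Delta F) * pr (tens_id Delta G) = 1" "pr (tens_id Delta G) * pr (tens_id Delta F) = 1"
    and iF: "pr (id_tens Delta F) * pr (id_tens Delta G) = 1" "pr (id_tens Delta G) * pr (id_tens Delta F) = 1"
    and gf: "pr (leg12 (flip G)) * pr (leg12 (flip F)) = 1" "pr (leg23 (flip G)) * pr (leg23 (flip F)) = 1"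
    using FG1 FG2 fl1 fl2 by (simp_all add: l pr_mult pr_1)
  have S: "pr (tau23 (tau12 (tens_id Delta F))) * pr (tau23 (tau12 (tens_id Delta G))) = 1"
    using pr_tau_cong(2)[OF pr_tau_cong(1)[OF pr_tens_id_cong(1)[OF FG(1)]]] by (simp add: l pr_mult pr_1)
  have T: "pr (tau12 (tau23 (id_tens Delta F))) * pr (tau12 (tau23 (id_tens Delta G))) = 1"
    using pr_tau_cong(1)[OF pr_tau_cong(2)[OF pr_tens_id_cong(2)[OF FG(1)]]] by (simp add: l pr_mult pr_1)
  \<comment> \<open>Inverting both sides of the cocycle identity gives the companion identity for
    G.\<close>
  have cinv: "pr (tens_id Delta G) * pr (leg12 G) = pr (id_tens Delta G) * pr (leg23 G)"
  proof -
    have "pr (id_tens Delta G) * pr (leg23 G) * (pr (leg12 F) * pr (tens_id Delta F)) = 1"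
      using cocycle by (simp add: pr_mult mult.assoc g23'[THEN assoc_rule] iF)
    then have "pr (id_tens Delta G) * pr (leg23 G) * (pr (leg12 F) * pr (tens_id Delta F))
        * (pr (tens_id Delta G) * pr (leg12 G)) = pr (tens_id Delta G) * pr (leg12 G)" by simp
    then show ?thesis by (simp add: mult.assoc tF[THEN assoc_rule] g12)
  qed
  then have cinv': "pr (tens_id Delta G * leg12 G) = pr (id_tens Delta G * leg23 G)" by (simp add: pr_mult)
  \<comment> \<open>The cocycle identity with its legs permuted cyclically; the left side is what
    the twisted coproduct makes of F_21.\<close>
  have e1: "pr (leg12 F) * pr (tau23 (tau12 (id_tens Delta F))) = pr (leg13 (flip F)) * pr (tau23 (tau12 (tens_id Delta F)))"
    using pr_tau_cong(2)[OF pr_tau_cong(1)[OF cocycle]] by (simp add: l tau_leg pr_mult)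
  have e3: "pr (tau23 (id_tens Delta G)) = pr (tau23 (tens_id Delta G)) * (pr (leg13 G) * pr (leg23 (flip F)))"
  proof -
    have "pr (tau23 (tens_id Delta G)) * pr (leg13 G) = pr (tau23 (id_tens Delta G)) * pr (leg23 (flip G))"
      using pr_tau_cong(2)[OF cinv'] by (simp add: l tau_leg pr_mult)
    then have "pr (tau23 (tens_id Delta G)) * pr (leg13 G) * pr (leg23 (flip F)) =
      pr (tau23 (id_tens Delta G)) * pr (leg23 (flip G)) * pr (leg23 (flip F))" by simp
    then show ?thesis by (simp add: mult.assoc gf)
  qed
  have e4: "pr (leg13 R) * pr (tau23 (tens_id Delta G)) = pr (tau23 (tau12 (tens_id Delta G))) * pr (leg13 R)"
    using pr_tau_cong(2)[OF R_intertwines(1)[OF RD, of G]] by (simp add: l tau_leg pr_mult)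
  have e2: "pr (leg23 R) * pr (id_tens Delta G) = pr (tau23 (id_tens Delta G)) * pr (leg23 R)"
    using R_intertwines(2)[OF RD, of G] by (simp add: pr_mult)
  \<comment> \<open>The primed identities are the mirror versions, for \<Delta> applied to the
    second factor.\<close>
  have e1': "pr (leg23 F) * pr (tau12 (tau23 (tens_id Delta F))) = pr (leg13 (flip F)) * pr (tau12 (tau23 (id_tens Delta F)))"
    using pr_tau_cong(1)[OF pr_tau_cong(2)[OF cocycle]] by (simp add: l tau_leg pr_mult)
  have e3': "pr (tau12 (tens_id Delta G)) = pr (tau12 (id_tens Delta G)) * (pr (leg13 G) * pr (leg12 (flip F)))"
  proof -
    have "pr (tau12 (tens_id Delta G)) * pr (leg12 (flip G)) = pr (tau12 (id_tens Delta G)) * pr (leg13 G)"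
      using pr_tau_cong(1)[OF cinv'] by (simp add: l tau_leg pr_mult)
    then have "pr (tau12 (tens_id Delta G)) * pr (leg12 (flip G)) * pr (leg12 (flip F)) =
      pr (tau12 (id_tens Delta G)) * pr (leg13 G) * pr (leg12 (flip F))" by simp
    then show ?thesis by (simp add: mult.assoc gf)
  qed
  have e4': "pr (leg13 R) * pr (tau12 (id_tens Delta G)) = pr (tau12 (tau23 (id_tens Delta G))) * pr (leg13 R)"
    using pr_tau_cong(1)[OF R_intertwines(2)[OF RD, of G]] by (simp add: l tau_leg pr_mult)
  have e2': "pr (leg12 R) * pr (tens_id Delta G) = pr (tau12 (tens_id Delta G)) * pr (leg12 R)"
    using R_intertwines(1)[OF RD, of G] by (simp add: pr_mult)
  have "pr (tens_id (twisted_Delta F G) (flip F * R * G)) = pr (leg13 (flip F * R * G) * leg23 (flip F * R * G))"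
    by (simp only: tens_id_twisted tens_id_flip l pr_mult RR mult.assoc e1[THEN assoc_rule] cinv
        e2[THEN assoc_rule] e3 e4[THEN assoc_rule] S[THEN assoc_rule] mult_1)
  moreover have "pr (id_tens (twisted_Delta F G) (flip F * R * G)) = pr (leg13 (flip F * R * G) * leg12 (flip F * R * G))"
    by (simp only: tens_id_twisted tens_id_flip l pr_mult RR mult.assoc e1'[THEN assoc_rule] cinv[symmetric]
        e2'[THEN assoc_rule] e3' e4'[THEN assoc_rule] T[THEN assoc_rule] mult_1)
  moreover have "inverse_in_U2 (flip F * R * G) (F * R' * flip G)"
  proof -
    have "pr G * (pr F * x) = x" "pr R * (pr R' * x) = x" "pr (flip G) * (pr (flip F) * x) = x"
      "pr R' * (pr R * x) = x" for x
      using FG(2) FG2(4) R' by (simp_all add: l pr_mult pr_1 mult.assoc[symmetric])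
    moreover have "pr F * pr G = 1" "pr (flip F) * pr (flip G) = 1"
      using FG(1) FG1(4) by (simp_all add: l pr_mult pr_1)
    ultimately show ?thesis by (simp add: inverse_in_U2_def eqU2_iff pr_mult pr_1 mult.assoc)
  qed
  moreover have "pr (flip F * R * G * twisted_Delta F G a) = pr (flip (twisted_Delta F G a) * (flip F * R * G))" for a
  proof -
    have "pr G * (pr F * x) = x" "pr (flip G) * (pr (flip F) * x) = x" for x
      using FG(2) FG2(4) by (simp_all add: l pr_mult pr_1 mult.assoc[symmetric])
    then show ?thesis
      using RD[of a] by (simp add: twisted_Delta_def l pr_mult mult.assoc RD[unfolded pr_mult, THEN assoc_rule])
  qed
  ultimately show ?thesis
    unfolding universal_R_matrix_def eqU2_iff eqU3_iff by blast
qed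

section \<open>The cocycle identity\<close>

text \<open>The double commutant of a family \<open>N\<close> contains every algebraic expression in \<open>N\<close> and its
  exponential, so that commutation needs to be checked on generators only.\<close>

definition bicomm :: "'a::times set \<Rightarrow> 'a set" where
  "bicomm N = {u. \<forall>v. (\<forall>n\<in>N. n * v = v * n) \<longrightarrow> u * v = v * u}"

lemma bicomm_commute:
  assumes "\<And>n m. n \<in> N \<Longrightarrow> m \<in> M \<Longrightarrow> n * m = m * n" "u \<in> bicomm N" "v \<in> bicomm M"
  shows "u * v = v * u"
proof -
  have "v * n = n * v" if "n \<in> N" for n
    using assms(3) assms(1)[OF that] unfolding bicomm_def by fastforce
  then show ?thesis using assms(2) unfolding bicomm_def by fastforce
qed

lemma bicomm_base: "n \<in> N \<Longrightarrow> n \<in> bicomm N"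
  by (simp add: bicomm_def)

lemma bicomm_add: "u \<in> bicomm N \<Longrightarrow> v \<in> bicomm N \<Longrightarrow> u + v \<in> bicomm (N :: 'a::ring set)"
  by (simp add: bicomm_def distrib_left distrib_right)

lemma bicomm_diff: "u \<in> bicomm N \<Longrightarrow> v \<in> bicomm N \<Longrightarrow> u - v \<in> bicomm (N :: 'a::ring set)"
  by (simp add: bicomm_def left_diff_distrib right_diff_distrib)

lemma bicomm_minus: "u \<in> bicomm N \<Longrightarrow> - u \<in> bicomm (N :: 'a::ring set)"
  by (simp add: bicomm_def)

lemma bicomm_mult:
  assumes "u \<in> bicomm N" "v \<in> bicomm N" shows "u * v \<in> bicomm (N :: 'a::ring set)"
  unfolding bicomm_def
proof (intro CollectI allI impI)
  fix w assume "\<forall>n\<in>N. n * w = w * n"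
  then have "u * w = w * u" "v * w = w * v" using assms by (auto simp: bicomm_def)
  then show "u * v * w = w * (u * v)" by (metis mult.assoc)
qed

lemma bicomm_sc: "sc c \<in> bicomm N"
  by (simp add: bicomm_def sc.central)

lemma bicomm_one: "1 \<in> bicomm (N :: 'a::monoid_mult set)"
  by (simp add: bicomm_def)

lemma bicomm_ps: "u \<in> bicomm N \<Longrightarrow> ps c u \<in> bicomm N"
  by (simp add: bicomm_def ps_commute)

lemmas bicomm_intros = bicomm_add bicomm_diff bicomm_minus bicomm_mult bicomm_sc bicomm_one bicomm_ps

lemma KU_shift_one: "u * v = v * (u + (1 + 1)) \<Longrightarrow> KU u * v = sc (qq ^ 2) * (v * KU u)"
  using KU_shift_sc[of u v 2] by (simp add: sc_2 qq_power2)

text \<open>The part of the threefold tensor power that the twist meets: the e_ii in each factor,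
  e_1 in the first two (\<open>ex\<close>, \<open>ey\<close>) and f_2 in the last two
  (\<open>fy\<close>, \<open>fz\<close>). The middle factor is the only one where e_1 and f_2 occur
  together; \<open>eyfy\<close> is their relation there.\<close>

locale three_factors =
  fixes x1 x2 x3 ex y1 y2 y3 ey fy z1 z2 z3 fz :: "('m::rel_monoid, 'k::comm_complex_algebra) quot"
  assumes XY: "a \<in> {ex, x1, x2, x3} \<Longrightarrow> b \<in> {ey, fy, y1, y2, y3} \<Longrightarrow> a * b = b * a"
    and XZ: "a \<in> {ex, x1, x2, x3} \<Longrightarrow> b \<in> {fz, z1, z2, z3} \<Longrightarrow> a * b = b * a"
    and YZ: "a \<in> {ey, fy, y1, y2, y3} \<Longrightarrow> b \<in> {fz, z1, z2, z3} \<Longrightarrow> a * b = b * a"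
    and XX: "a \<in> {x1, x2, x3} \<Longrightarrow> b \<in> {x1, x2, x3} \<Longrightarrow> a * b = b * a"
    and YY: "a \<in> {y1, y2, y3} \<Longrightarrow> b \<in> {y1, y2, y3} \<Longrightarrow> a * b = b * a"
    and ZZ: "a \<in> {z1, z2, z3} \<Longrightarrow> b \<in> {z1, z2, z3} \<Longrightarrow> a * b = b * a"
    and ex: "x1 * ex = ex * (x1 + 1)" "x2 * ex = ex * (x2 - 1)" "x3 * ex = ex * x3"
    and ey: "y1 * ey = ey * (y1 + 1)" "y2 * ey = ey * (y2 - 1)" "y3 * ey = ey * y3"
    and fy: "y1 * fy = fy * y1" "y2 * fy = fy * (y2 - 1)" "y3 * fy = fy * (y3 + 1)"
    and fz: "z1 * fz = fz * z1" "z2 * fz = fz * (z2 - 1)" "z3 * fz = fz * (z3 + 1)"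
    and eyfy: "ey * fy = fy * ey"
begin

abbreviation "GX \<equiv> {ex, x1, x2, x3}"
abbreviation "GY \<equiv> {ey, fy, y1, y2, y3}"
abbreviation "GZ \<equiv> {fz, z1, z2, z3}"
abbreviation "Car \<equiv> {x1, x2, x3, y1, y2, y3, z1, z2, z3}"

lemma Car_commute: "a \<in> Car \<Longrightarrow> b \<in> Car \<Longrightarrow> a * b = b * a"
  using XY[of a b] XZ[of a b] YZ[of a b] XY[of b a] XZ[of b a] YZ[of b a] XX[of a b] YY[of a b] ZZ[of a b]
  by (simp only: insert_iff empty_iff) metis

lemma bicomm_Car: "u \<in> bicomm Car \<Longrightarrow> v \<in> bicomm Car \<Longrightarrow> u * v = v * u"
  by (rule bicomm_commute[OF Car_commute])

lemma bicomm_XY: "u \<in> bicomm GX \<Longrightarrow> v \<in> bicomm GY \<Longrightarrow> u * v = v * u"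
  by (rule bicomm_commute[OF XY])

lemma bicomm_XZ: "u \<in> bicomm GX \<Longrightarrow> v \<in> bicomm GZ \<Longrightarrow> u * v = v * u"
  by (rule bicomm_commute[OF XZ])

lemma bicomm_YZ: "u \<in> bicomm GY \<Longrightarrow> v \<in> bicomm GZ \<Longrightarrow> u * v = v * u"
  by (rule bicomm_commute[OF YZ])

lemma bicomm_bases:
  "x1 \<in> bicomm Car" "x2 \<in> bicomm Car" "x3 \<in> bicomm Car"
  "y1 \<in> bicomm Car" "y2 \<in> bicomm Car" "y3 \<in> bicomm Car"
  "z1 \<in> bicomm Car" "z2 \<in> bicomm Car" "z3 \<in> bicomm Car"
  "x1 \<in> bicomm GX" "x2 \<in> bicomm GX" "x3 \<in> bicomm GX" "ex \<in> bicomm GX"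
  "y1 \<in> bicomm GY" "y2 \<in> bicomm GY" "y3 \<in> bicomm GY" "ey \<in> bicomm GY" "fy \<in> bicomm GY"
  "z1 \<in> bicomm GZ" "z2 \<in> bicomm GZ" "z3 \<in> bicomm GZ" "fz \<in> bicomm GZ"
  by (rule bicomm_base; simp)+

lemmas bicomms = bicomm_intros bicomm_bases

lemma KK: "u \<in> bicomm Car \<Longrightarrow> v \<in> bicomm Car \<Longrightarrow> KU u * KU v = KU (u + v)"
  by (rule KU_add[symmetric, OF bicomm_Car])

lemma Kshift:
  "u * v = v * (u + w) \<Longrightarrow> u \<in> bicomm Car \<Longrightarrow> w \<in> bicomm Car \<Longrightarrow> KU u * v = v * KU (u + w)"
  by (simp add: KU_shift[OF _ bicomm_Car] KK)

lemma cross: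
  "y1 * ex = ex * y1" "y2 * ex = ex * y2" "y3 * ex = ex * y3"
  "z1 * ex = ex * z1" "z2 * ex = ex * z2" "z3 * ex = ex * z3"
  "x1 * ey = ey * x1" "x2 * ey = ey * x2" "x3 * ey = ey * x3"
  "z1 * ey = ey * z1" "z2 * ey = ey * z2" "z3 * ey = ey * z3"
  "x1 * fy = fy * x1" "x2 * fy = fy * x2" "x3 * fy = fy * x3"
  "z1 * fy = fy * z1" "z2 * fy = fy * z2" "z3 * fy = fy * z3"
  "x1 * fz = fz * x1" "x2 * fz = fz * x2" "x3 * fz = fz * x3"
  "y1 * fz = fz * y1" "y2 * fz = fz * y2" "y3 * fz = fz * y3"
  by (simp_all add: XY[of ex, symmetric] XZ[of ex, symmetric] XY XZ YZ YZ[of ey, symmetric] YZ[of fy, symmetric])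

lemmas moves = cross ex ey fy fz cross[THEN assoc_rule] ex[THEN assoc_rule] ey[THEN assoc_rule]
  fy[THEN assoc_rule] fz[THEN assoc_rule]
  sc.left[of ex] sc.left[of ey] sc.left[of fy] sc.left[of fz]
  sc.central[symmetric, of ex] sc.central[symmetric, of ey] sc.central[symmetric, of fy] sc.central[symmetric, of fz]
  distrib_left distrib_right left_diff_distrib right_diff_distrib mult.assoc mult_1_left mult_1_right

end

text \<open>With h = 1/2 this is the exponent of F^(1) divided by \<gamma>, as a bilinear form in
  the Cartan elements of two factors. Applying \<Delta> to one factor means inserting sums such as
  x_i + y_i.\<close>

definition rbil :: "'k::comm_complex_algebra fps \<Rightarrow> ('m::rel_monoid, 'k) quot \<Rightarrow> ('m, 'k) quot \<Rightarrow> ('m, 'k) quot \<Rightarrow>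
    ('m, 'k) quot \<Rightarrow> ('m, 'k) quot \<Rightarrow> ('m, 'k) quot \<Rightarrow> ('m, 'k) quot" where
  "rbil h x1 x2 x3 y1 y2 y3 =
     sc h * ((x1 * y2 - x2 * y1) + (x1 * y3 - x3 * y1) + (x2 * y3 - x3 * y2))"

text \<open>The corresponding form for F^(3), with \<beta> = B/\<gamma>; the sums of three terms are
  C in either factor.\<close>

definition wbil :: "'k::comm_complex_algebra fps \<Rightarrow> ('m::rel_monoid, 'k) quot \<Rightarrow> ('m, 'k) quot \<Rightarrow> ('m, 'k) quot \<Rightarrow>
    ('m, 'k) quot \<Rightarrow> ('m, 'k) quot \<Rightarrow> ('m, 'k) quot \<Rightarrow> ('m, 'k) quot" where
  "wbil \<beta> x1 x2 x3 y1 y2 y3 =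
     sc \<beta> * ((x1 - x3) * (y1 + y2 + y3) - (x1 + x2 + x3) * (y1 - y3))"

context three_factors
begin

context
  fixes h \<beta> m :: "'k fps"
  assumes h: "h + h = 1"
begin

lemma half: "sc h * u + sc h * u = u" "sc h * u + (sc h * u + v) = u + v"
proof -
  show *: "sc h * u + sc h * u = u" for u by (simp add: distrib_right[symmetric] sc.add[symmetric] h sc.one)
  show "sc h * u + (sc h * u + v) = u + v" by (simp add: add.assoc[symmetric] *)
qed

definition "hx = sc h * (x1 + x2)"
definition "hy = sc h * (y1 + y2)"
definition "gy = sc h * (y2 + y3)"
definition "gz = sc h * (z2 + z3)"
definition "cy = (y1 + y1) + (y3 + y3)"
definition "E = ex * KU hx"
definition "Ey = ey * KU hy"
definition "Fy = fy * KU gy"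
definition "Fz = fz * KU gz"
text \<open>The exponents of the Cartan tail q^(2 e_11 \<otimes> e_33) F^(1) of the twist, placed in
  the first two factors (\<open>sl\<close>) and in the last two (\<open>sr\<close>). Conjugation by
  the tail is what moves it to the outside.\<close>

definition "sl = (x1 * y3 + x1 * y3) + rbil h x1 x2 x3 y1 y2 y3"
definition "sr = (y1 * z3 + y1 * z3) + rbil h y1 y2 y3 z1 z2 z3"

lemma bicomms_defs:
  "hx \<in> bicomm Car" "hy \<in> bicomm Car" "gy \<in> bicomm Car" "gz \<in> bicomm Car" "cy \<in> bicomm Car"
  "sl \<in> bicomm Car" "sr \<in> bicomm Car"
  "hx \<in> bicomm GX" "hy \<in> bicomm GY" "gy \<in> bicomm GY" "cy \<in> bicomm GY" "gz \<in> bicomm GZ"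
  "E \<in> bicomm GX" "Ey \<in> bicomm GY" "Fy \<in> bicomm GY" "Fz \<in> bicomm GZ"
  unfolding hx_def hy_def gy_def gz_def cy_def E_def Ey_def Fy_def Fz_def sl_def sr_def rbil_def
  by (intro bicomms)+

lemma commutes:
  "E * Ey = Ey * E" "E * Fy = Fy * E" "E * Fz = Fz * E" "E * KU cy = KU cy * E"
  "Ey * Fz = Fz * Ey" "Fy * Fz = Fz * Fy" "KU cy * Fz = Fz * KU cy"
  by (rule bicomm_XY bicomm_XZ bicomm_YZ; intro bicomms bicomms_defs)+

text \<open>Both e_1 and f_2 raise e_11 + e_33 by one, so q^(2(e_11 + e_33)) passes either of them
  at the cost of q^2, exactly the base of the q-exponential.\<close>

lemma Kcy: "KU cy * Ey = sc (qq ^ 2) * (Ey * KU cy)" "KU cy * Fy = sc (qq ^ 2) * (Fy * KU cy)"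
proof -
  have "cy * ey = ey * (cy + (1 + 1))" "cy * fy = fy * (cy + (1 + 1))"
    unfolding cy_def by (simp_all add: moves)
  then have "KU cy * ey = sc (qq ^ 2) * (ey * KU cy)" "KU cy * fy = sc (qq ^ 2) * (fy * KU cy)"
    by (simp_all only: KU_shift_one)
  moreover have "KU hy * KU cy = KU cy * KU hy" "KU gy * KU cy = KU cy * KU gy"
    by (intro bicomm_Car bicomms bicomms_defs)+
  ultimately show "KU cy * Ey = sc (qq ^ 2) * (Ey * KU cy)" "KU cy * Fy = sc (qq ^ 2) * (Fy * KU cy)"
    unfolding Ey_def Fy_def by (simp_all only: mult.assoc[symmetric]) (simp_all only: mult.assoc)
qed

text \<open>Moving either Cartan tail past the other generator costs the same factor q^(-1/2), so
  the relation e_1 f_2 = f_2 e_1 survives the modification of the generators.\<close>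

lemma Fy_Ey: "Fy * Ey = Ey * Fy"
proof -
  have 1: "KU gy * ey = sc (qz (- h)) * (ey * KU gy)"
    by (rule KU_shift_sc) (simp add: gy_def moves sc_minus)
  have 2: "KU hy * fy = sc (qz (- h)) * (fy * KU hy)"
    by (rule KU_shift_sc) (simp add: hy_def moves sc_minus)
  have 3: "KU gy * KU hy = KU hy * KU gy"
    by (intro bicomm_Car bicomms bicomms_defs)
  have "Fy * Ey = sc (qz (- h)) * (fy * ey * (KU gy * KU hy))"
    unfolding Fy_def Ey_def by (simp only: mult.assoc 1[THEN assoc_rule] sc.left[of fy])
  also have "\<dots> = sc (qz (- h)) * (ey * fy * (KU hy * KU gy))"
    by (simp only: eyfy 3)
  also have "\<dots> = Ey * Fy"
    unfolding Fy_def Ey_def by (simp only: mult.assoc 2[THEN assoc_rule] sc.left[of ey])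
  finally show ?thesis .
qed

text \<open>In both q-binomial splittings the factor containing \<open>cy\<close> lands on the
  right, so the two sides of the cocycle identity differ only in the order of the two commuting
  factors.\<close>

lemma QU_sums:
  "QU (sc m * (E * KU cy * Fz + Ey * Fz)) = QU (sc m * (Ey * Fz)) * QU (sc m * (E * KU cy * Fz))"
  "QU (sc m * (E * Fy + E * KU cy * Fz)) = QU (sc m * (E * Fy)) * QU (sc m * (E * KU cy * Fz))"
  "QU (sc m * (E * Fy)) * QU (sc m * (Ey * Fz)) = QU (sc m * (Ey * Fz)) * QU (sc m * (E * Fy))"
proof -
  have ss: "(sc m * a) * (sc m * b) = sc (qq ^ 2) * ((sc m * b) * (sc m * a))" if "a * b = sc (qq ^ 2) * (b * a)" for a b
    by (simp only: sc.mult_mult that) (simp only: sc.mult' mult.commute)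
  have "(E * KU cy * Fz) * (Ey * Fz) = E * (KU cy * Ey) * (Fz * Fz)"
    by (simp only: mult.assoc commutes(5)[symmetric, THEN assoc_rule])
  also have "\<dots> = sc (qq ^ 2) * ((Ey * Fz) * (E * KU cy * Fz))"
    unfolding Kcy by (simp only: mult.assoc sc.left[of E] commutes(1)[THEN assoc_rule] commutes(3)[symmetric, THEN assoc_rule]
        commutes(7)[THEN assoc_rule])
  finally show "QU (sc m * (E * KU cy * Fz + Ey * Fz)) = QU (sc m * (Ey * Fz)) * QU (sc m * (E * KU cy * Fz))"
    unfolding distrib_left by (intro QU_add ss)
  have "(E * KU cy * Fz) * (E * Fy) = E * E * (KU cy * Fy) * Fz"
    by (simp only: mult.assoc commutes(3)[symmetric, THEN assoc_rule] commutes(4)[symmetric, THEN assoc_rule] commutes(6))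
  also have "\<dots> = sc (qq ^ 2) * ((E * Fy) * (E * KU cy * Fz))"
    unfolding Kcy by (simp only: mult.assoc sc.left[of E] commutes(2)[symmetric, THEN assoc_rule])
  finally show "QU (sc m * (E * Fy + E * KU cy * Fz)) = QU (sc m * (E * Fy)) * QU (sc m * (E * KU cy * Fz))"
    by (subst add.commute, unfold distrib_left) (intro QU_add ss)
  have "(E * Fy) * (Ey * Fz) = (Ey * Fz) * (E * Fy)"
    by (simp only: mult.assoc Fy_Ey[THEN assoc_rule] commutes(1)[THEN assoc_rule] commutes(3)[symmetric, THEN assoc_rule] commutes(6))
  then show "QU (sc m * (E * Fy)) * QU (sc m * (Ey * Fz)) = QU (sc m * (Ey * Fz)) * QU (sc m * (E * Fy))"
    by (intro ps_commute2) (simp only: sc.mult_mult)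
qed

lemma sl_Fz: "KU sl * Fz = Fz * KU sl" and sr_E: "KU sr * E = E * KU sr"
proof -
  let ?N = "{x1, x2, x3, y1, y2, y3}" and ?M = "{y1, y2, y3, z1, z2, z3}"
  have N: "x1 \<in> bicomm ?N" "x2 \<in> bicomm ?N" "x3 \<in> bicomm ?N"
    "y1 \<in> bicomm ?N" "y2 \<in> bicomm ?N" "y3 \<in> bicomm ?N" by (rule bicomm_base; simp)+
  have M: "y1 \<in> bicomm ?M" "y2 \<in> bicomm ?M" "y3 \<in> bicomm ?M"
    "z1 \<in> bicomm ?M" "z2 \<in> bicomm ?M" "z3 \<in> bicomm ?M" by (rule bicomm_base; simp)+
  show "KU sl * Fz = Fz * KU sl"
  proof (rule bicomm_commute[OF _ _ bicomms_defs(16)])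
    show "KU sl \<in> bicomm ?N" unfolding sl_def rbil_def by (intro bicomm_intros N)
    show "n * m = m * n" if "n \<in> ?N" "m \<in> GZ" for n m using that XZ[of n m] YZ[of n m] by blast
  qed
  show "KU sr * E = E * KU sr"
  proof (rule bicomm_commute[OF _ _ bicomms_defs(13)])
    show "KU sr \<in> bicomm ?M" unfolding sr_def rbil_def by (intro bicomm_intros M)
    show "n * m = m * n" if "n \<in> ?M" "m \<in> GX" for n m
    proof -
      have "m * n = n * m" using that XZ[of m n] XY[of m n] by blast
      then show ?thesis by (rule sym)
    qed
  qed
qed

text \<open>Conjugation by the tail in legs 1 and 2 turns the two summands coming from \<Delta>(e_1)
  into Q and M: it alters their Cartan exponents and nothing else.\<close>

lemma conj_left:
  "KU sl * ((ex * KU (y1 - y2) + ey) * KU (sc h * ((x1 + y1) + (x2 + y2))) * Fz)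
    = (E * KU cy * Fz + Ey * Fz) * KU sl"
proof -
  let ?g = "sc h * ((x1 + y1) + (x2 + y2))"
  have 1: "sl * ex = ex * (sl + (y3 + y3 + sc h * (y1 + y2)))"
    unfolding sl_def rbil_def by (simp add: moves)
  have 2: "sl * ey = ey * (sl + - (sc h * (x1 + x2)))"
    unfolding sl_def rbil_def by (simp add: moves)
  have K1: "KU sl * ex = ex * KU (sl + (y3 + y3 + sc h * (y1 + y2)))"
    by (rule Kshift[OF 1]) (intro bicomms bicomms_defs)+
  have K2: "KU sl * ey = ey * KU (sl + - (sc h * (x1 + x2)))"
    by (rule Kshift[OF 2]) (intro bicomms bicomms_defs)+
  \<comment> \<open>The y-part of the exponent is 2 y_3 + (y_1 + y_2) + (y_1 - y_2), which is
    \<open>cy\<close>: this is the origin of the middle factor of Q.\<close>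
  have e1: "sl + (y3 + y3 + sc h * (y1 + y2)) + (y1 - y2) + ?g = hx + cy + sl"
    unfolding hx_def cy_def by (simp add: distrib_left algebra_simps half)
  have e2: "sl + - (sc h * (x1 + x2)) + ?g = hy + sl"
    unfolding hy_def by (simp add: distrib_left algebra_simps half)
  have k1: "KU (sl + (y3 + y3 + sc h * (y1 + y2))) * (KU (y1 - y2) * KU ?g) = KU hx * (KU cy * KU sl)"
  proof -
    have "KU (sl + (y3 + y3 + sc h * (y1 + y2))) * (KU (y1 - y2) * KU ?g) =
        KU (sl + (y3 + y3 + sc h * (y1 + y2)) + (y1 - y2) + ?g)"
      by (simp only: mult.assoc[symmetric], (subst KK, (intro bicomms bicomms_defs)+)+) (rule refl)
    moreover have "KU hx * (KU cy * KU sl) = KU (hx + cy + sl)"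
      by (simp only: mult.assoc[symmetric], (subst KK, (intro bicomms bicomms_defs)+)+) (rule refl)
    ultimately show ?thesis by (simp only: e1)
  qed
  have k2: "KU (sl + - (sc h * (x1 + x2))) * KU ?g = KU hy * KU sl"
  proof -
    have "KU (sl + - (sc h * (x1 + x2))) * KU ?g = KU (sl + - (sc h * (x1 + x2)) + ?g)"
      by (rule KK) (intro bicomms bicomms_defs)+
    moreover have "KU hy * KU sl = KU (hy + sl)"
      by (rule KK) (intro bicomms bicomms_defs)+
    ultimately show ?thesis by (simp only: e2)
  qed
  have "KU sl * ((ex * KU (y1 - y2) + ey) * KU ?g * Fz) =
     ex * (KU (sl + (y3 + y3 + sc h * (y1 + y2))) * (KU (y1 - y2) * KU ?g)) * Fz
     + ey * (KU (sl + - (sc h * (x1 + x2))) * KU ?g) * Fz"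
    by (simp only: distrib_left distrib_right mult.assoc K1[THEN assoc_rule] K2[THEN assoc_rule])
  also have "\<dots> = (E * KU cy * Fz + Ey * Fz) * KU sl"
    unfolding k1 k2 E_def Ey_def by (simp only: distrib_right mult.assoc sl_Fz)
  finally show ?thesis .
qed

text \<open>The mirror image in legs 2 and 3, where the summands coming from \<Delta>(f_2) become P
  and Q.\<close>

lemma conj_right:
  "KU sr * (E * ((fy + KU (- (y2 - y3)) * fz) * KU (sc h * ((y2 + z2) + (y3 + z3)))))
    = (E * Fy + E * KU cy * Fz) * KU sr"
proof -
  let ?g = "sc h * ((y2 + z2) + (y3 + z3))"
  have 1: "sr * fy = fy * (sr + - (sc h * (z2 + z3)))"
    unfolding sr_def rbil_def by (simp add: moves)
  have 2: "sr * fz = fz * (sr + (y1 + y1 + sc h * (y2 + y3)))"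
    unfolding sr_def rbil_def by (simp add: moves)
  have K1: "KU sr * fy = fy * KU (sr + - (sc h * (z2 + z3)))"
    by (rule Kshift[OF 1]) (intro bicomms bicomms_defs)+
  have K2: "KU sr * fz = fz * KU (sr + (y1 + y1 + sc h * (y2 + y3)))"
    by (rule Kshift[OF 2]) (intro bicomms bicomms_defs)+
  have e1: "sr + - (sc h * (z2 + z3)) + ?g = gy + sr"
    unfolding gy_def by (simp add: distrib_left algebra_simps half)
  \<comment> \<open>Here the y-part is 2 y_1 + (y_2 + y_3) - (y_2 - y_3), again \<open>cy\<close>,
    so the same Q arises on both sides.\<close>
  have e2: "sr + (y1 + y1 + sc h * (y2 + y3)) + - (y2 - y3) + ?g = cy + gz + sr"
    unfolding gz_def cy_def by (simp add: distrib_left algebra_simps half)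
  have k1: "KU (sr + - (sc h * (z2 + z3))) * KU ?g = KU gy * KU sr"
  proof -
    have "KU (sr + - (sc h * (z2 + z3))) * KU ?g = KU (sr + - (sc h * (z2 + z3)) + ?g)"
      by (rule KK) (intro bicomms bicomms_defs)+
    moreover have "KU gy * KU sr = KU (gy + sr)"
      by (rule KK) (intro bicomms bicomms_defs)+
    ultimately show ?thesis by (simp only: e1)
  qed
  have k2: "KU (sr + (y1 + y1 + sc h * (y2 + y3))) * (KU (- (y2 - y3)) * KU ?g) = KU cy * (KU gz * KU sr)"
  proof -
    have "KU (sr + (y1 + y1 + sc h * (y2 + y3))) * (KU (- (y2 - y3)) * KU ?g) =
        KU (sr + (y1 + y1 + sc h * (y2 + y3)) + - (y2 - y3) + ?g)"
      by (simp only: mult.assoc[symmetric], (subst KK, (intro bicomms bicomms_defs)+)+) (rule refl)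
    moreover have "KU cy * (KU gz * KU sr) = KU (cy + gz + sr)"
      by (simp only: mult.assoc[symmetric], (subst KK, (intro bicomms bicomms_defs)+)+) (rule refl)
    ultimately show ?thesis by (simp only: e2)
  qed
  have c1: "KU (- (y2 - y3)) * fz = fz * KU (- (y2 - y3))" and c2: "KU cy * fz = fz * KU cy"
    by (intro bicomm_YZ bicomms bicomms_defs)+
  have c3: "KU sr * KU (- (y2 - y3)) = KU (- (y2 - y3)) * KU sr"
    by (intro bicomm_Car bicomms bicomms_defs)
  have "KU sr * (E * ((fy + KU (- (y2 - y3)) * fz) * KU ?g)) =
     E * (fy * (KU (sr + - (sc h * (z2 + z3))) * KU ?g))
     + E * (fz * (KU (sr + (y1 + y1 + sc h * (y2 + y3))) * (KU (- (y2 - y3)) * KU ?g)))"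
    by (simp only: distrib_left distrib_right mult.assoc sr_E[THEN assoc_rule] K1[THEN assoc_rule]
        c3[THEN assoc_rule] K2[THEN assoc_rule] c1[THEN assoc_rule])
  also have "\<dots> = (E * Fy + E * KU cy * Fz) * KU sr"
    unfolding k1 k2 Fy_def Fz_def by (simp only: distrib_right mult.assoc c2[THEN assoc_rule])
  finally show ?thesis .
qed

abbreviation "wl \<equiv> wbil \<beta> (x1 + y1) (x2 + y2) (x3 + y3) z1 z2 z3"
abbreviation "wr \<equiv> wbil \<beta> x1 x2 x3 (y1 + z1) (y2 + z2) (y3 + z3)"

lemma bicomm_w: "wl \<in> bicomm Car" "wr \<in> bicomm Car"
  "wbil \<beta> x1 x2 x3 y1 y2 y3 \<in> bicomm Car" "wbil \<beta> y1 y2 y3 z1 z2 z3 \<in> bicomm Car"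
  "rbil h x1 x2 x3 y1 y2 y3 \<in> bicomm Car" "rbil h y1 y2 y3 z1 z2 z3 \<in> bicomm Car"
  "rbil h (x1 + y1) (x2 + y2) (x3 + y3) z1 z2 z3 \<in> bicomm Car"
  "rbil h x1 x2 x3 (y1 + z1) (y2 + z2) (y3 + z3) \<in> bicomm Car"
  unfolding wbil_def rbil_def by (intro bicomms)+

text \<open>C is central, and e_11 - e_33 has weight 1 on e_1 and - 1 on f_2, so the two shifts
  cancel in the product. Hence the factor from F^(3) slides past P and M.\<close>

lemma w_commute: "wl * (E * Fy) = (E * Fy) * wl" "wr * (Ey * Fz) = (Ey * Fz) * wr"
proof -
  let ?z = "sc \<beta> * (z1 + z2 + z3)" and ?x = "sc \<beta> * (x1 + x2 + x3)"
  have l: "wl * ex = ex * (wl + ?z)" "(wl + ?z) * fy = fy * wl"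
    unfolding wbil_def by (simp_all add: moves)
  have r: "wr * ey = ey * (wr - ?x)" "(wr - ?x) * fz = fz * wr"
    unfolding wbil_def by (simp_all add: moves)
  have c: "(wl + ?z) * KU hx = KU hx * (wl + ?z)" "wl * KU gy = KU gy * wl"
    "(wr - ?x) * KU hy = KU hy * (wr - ?x)" "wr * KU gz = KU gz * wr"
    by (intro bicomm_Car bicomms bicomms_defs bicomm_w)+
  show "wl * (E * Fy) = (E * Fy) * wl"
    unfolding E_def Fy_def
    by (simp only: mult.assoc l[THEN assoc_rule] c[THEN assoc_rule] c)
  show "wr * (Ey * Fz) = (Ey * Fz) * wr"
    unfolding Ey_def Fz_def
    by (simp only: mult.assoc r[THEN assoc_rule] c[THEN assoc_rule] c)
qed

theorem cocycle_identity:
  "(KU (wbil \<beta> x1 x2 x3 y1 y2 y3) * (QU (sc m * (E * Fy)) * KU (x1 * y3 + x1 * y3)) * KU (rbil h x1 x2 x3 y1 y2 y3)) *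
   (KU wl * (QU (sc m * ((ex * KU (y1 - y2) + ey) * KU (sc h * ((x1 + y1) + (x2 + y2))) * Fz))
      * KU ((x1 + y1) * z3 + (x1 + y1) * z3)) * KU (rbil h (x1 + y1) (x2 + y2) (x3 + y3) z1 z2 z3)) =
   (KU (wbil \<beta> y1 y2 y3 z1 z2 z3) * (QU (sc m * (Ey * Fz)) * KU (y1 * z3 + y1 * z3)) * KU (rbil h y1 y2 y3 z1 z2 z3)) *
   (KU wr * (QU (sc m * (E * ((fy + KU (- (y2 - y3)) * fz) * KU (sc h * ((y2 + z2) + (y3 + z3))))))
      * KU (x1 * (y3 + z3) + x1 * (y3 + z3))) * KU (rbil h x1 x2 x3 (y1 + z1) (y2 + z2) (y3 + z3)))"
proof -
  let ?V = "(ex * KU (y1 - y2) + ey) * KU (sc h * ((x1 + y1) + (x2 + y2))) * Fz"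
  let ?V' = "E * ((fy + KU (- (y2 - y3)) * fz) * KU (sc h * ((y2 + z2) + (y3 + z3))))"
  let ?P = "sc m * (E * Fy)" and ?B = "sc m * (Ey * Fz)" and ?Q = "sc m * (E * KU cy * Fz)"
  let ?r1 = "rbil h (x1 + y1) (x2 + y2) (x3 + y3) z1 z2 z3"
  let ?r2 = "rbil h x1 x2 x3 (y1 + z1) (y2 + z2) (y3 + z3)"
  have QV: "KU sl * QU (sc m * ?V) = QU ?B * QU ?Q * KU sl"
  proof -
    have "QU (sc m * (E * KU cy * Fz + Ey * Fz)) * KU sl = KU sl * QU (sc m * ?V)"
      by (rule ps_intertwine) (simp only: sc.left[of "KU sl"] conj_left, simp only: mult.assoc)
    then show ?thesis by (simp only: QU_sums)
  qed
  have QV': "KU sr * QU (sc m * ?V') = QU ?P * QU ?Q * KU sr"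
  proof -
    have "QU (sc m * (E * Fy + E * KU cy * Fz)) * KU sr = KU sr * QU (sc m * ?V')"
      by (rule ps_intertwine) (simp only: sc.left[of "KU sr"] conj_right, simp only: mult.assoc)
    then show ?thesis by (simp only: QU_sums)
  qed
  have w: "QU ?P * KU wl = KU wl * QU ?P" "QU ?B * KU wr = KU wr * QU ?B"
    by (intro ps_commute2; simp only: sc.left[of wl] sc.left[of wr] w_commute mult.assoc)+
  have s: "KU (x1 * y3 + x1 * y3) * KU (rbil h x1 x2 x3 y1 y2 y3) = KU sl"
    "KU (y1 * z3 + y1 * z3) * KU (rbil h y1 y2 y3 z1 z2 z3) = KU sr"
    unfolding sl_def sr_def by (rule KK; intro bicomms bicomm_w)+
  have sw: "KU sl * KU wl = KU wl * KU sl" "KU sr * KU wr = KU wr * KU sr"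
    by (intro bicomm_Car bicomms bicomms_defs bicomm_w)+
  have t1: "KU sl * (KU ((x1 + y1) * z3 + (x1 + y1) * z3) * KU ?r1) =
      KU (sl + ((x1 + y1) * z3 + (x1 + y1) * z3) + ?r1)"
    by (simp only: mult.assoc[symmetric], (subst KK, (intro bicomms bicomms_defs bicomm_w)+)+) (rule refl)
  have t2: "KU sr * (KU (x1 * (y3 + z3) + x1 * (y3 + z3)) * KU ?r2) =
      KU (sr + (x1 * (y3 + z3) + x1 * (y3 + z3)) + ?r2)"
    by (simp only: mult.assoc[symmetric], (subst KK, (intro bicomms bicomms_defs bicomm_w)+)+) (rule refl)
  \<comment> \<open>By bilinearity both sides are the sum of one form over the three pairs of
    factors; the exponents of F^(3) agree below for the same reason.\<close>
  have t: "sl + ((x1 + y1) * z3 + (x1 + y1) * z3) + ?r1 = sr + (x1 * (y3 + z3) + x1 * (y3 + z3)) + ?r2"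
    unfolding sl_def sr_def rbil_def by (simp add: algebra_simps)
  have u: "KU (wbil \<beta> x1 x2 x3 y1 y2 y3) * KU wl = KU (wbil \<beta> y1 y2 y3 z1 z2 z3) * KU wr"
  proof -
    have "wbil \<beta> x1 x2 x3 y1 y2 y3 + wl = wbil \<beta> y1 y2 y3 z1 z2 z3 + wr"
      unfolding wbil_def by (simp add: algebra_simps)
    then show ?thesis by (simp only: KK bicomm_w)
  qed
  \<comment> \<open>With the q-exponentials made opaque, only the exchange rules between whole
    factors remain for the final rearrangement. \<open>B\<close> is the factor belonging to
    M.\<close>
  define V W P B Q where defs: "V = QU (sc m * ?V)" "W = QU (sc m * ?V')" "P = QU ?P" "B = QU ?B" "Q = QU ?Q"
  note [folded defs] = QV QV' w QU_sums(3)
  note f = this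
  have "(KU (wbil \<beta> x1 x2 x3 y1 y2 y3) * (P * KU (x1 * y3 + x1 * y3)) * KU (rbil h x1 x2 x3 y1 y2 y3)) *
      (KU wl * (V * KU ((x1 + y1) * z3 + (x1 + y1) * z3)) * KU ?r1) =
    (KU (wbil \<beta> x1 x2 x3 y1 y2 y3) * KU wl) * (P * (B * (Q * (KU sl * (KU ((x1 + y1) * z3 + (x1 + y1) * z3) * KU ?r1)))))"
    by (simp only: mult.assoc s[THEN assoc_rule] sw[THEN assoc_rule] f[THEN assoc_rule])
  also have "\<dots> = (KU (wbil \<beta> y1 y2 y3 z1 z2 z3) * KU wr) *
      (B * (P * (Q * (KU sr * (KU (x1 * (y3 + z3) + x1 * (y3 + z3)) * KU ?r2)))))"
    by (simp only: t1 t2 t u f(5)[THEN assoc_rule] mult.assoc)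
  also have "\<dots> = (KU (wbil \<beta> y1 y2 y3 z1 z2 z3) * (B * KU (y1 * z3 + y1 * z3)) * KU (rbil h y1 y2 y3 z1 z2 z3)) *
      (KU wr * (W * KU (x1 * (y3 + z3) + x1 * (y3 + z3))) * KU ?r2)"
    by (simp only: mult.assoc s[THEN assoc_rule] sw[THEN assoc_rule] f(1-4)[THEN assoc_rule])
  finally show ?thesis unfolding defs .
qed

end
end

section \<open>The twist\<close>

abbreviation (input) X3 :: "'k::comm_complex_algebra cfree \<Rightarrow> (gword \<times> gword \<times> gword, 'k) quot" where
  "X3 x \<equiv> pr (leg12 (leg1 x))"
abbreviation (input) Y3 :: "'k::comm_complex_algebra cfree \<Rightarrow> (gword \<times> gword \<times> gword, 'k) quot" where
  "Y3 x \<equiv> pr (leg12 (leg2 x))"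
abbreviation (input) Z3 :: "'k::comm_complex_algebra cfree \<Rightarrow> (gword \<times> gword \<times> gword, 'k) quot" where
  "Z3 x \<equiv> pr (leg23 (leg2 x))"

interpretation X3: factor_map X3
  by standard (auto simp: legs_prod_def legs_gword_def leg_legs image_Un image_image zero_prod_def)
interpretation Y3: factor_map Y3
  by standard (auto simp: legs_prod_def legs_gword_def leg_legs image_Un image_image zero_prod_def)
interpretation Z3: factor_map Z3
  by standard (auto simp: legs_prod_def legs_gword_def leg_legs image_Un image_image zero_prod_def)

lemma X3_Y3_Z3: "X3 x * Y3 y = Y3 y * X3 x" "X3 x * Z3 y = Z3 y * X3 x" "Y3 x * Z3 y = Z3 y * Y3 x"
proof -
  show "X3 x * Y3 y = Y3 y * X3 x"
    by (simp only: pr_mult[symmetric] alg_hom_mult[OF alg_hom_leg12, symmetric] leg1_leg2_commute)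
  show "X3 x * Z3 y = Z3 y * X3 x"
    by (simp only: pr_mult[symmetric] leg_leg[symmetric] alg_hom_mult[OF alg_hom_leg13, symmetric] leg1_leg2_commute)
  show "Y3 x * Z3 y = Z3 y * Y3 x"
    by (simp only: pr_mult[symmetric] leg_leg(2)[symmetric] alg_hom_mult[OF alg_hom_leg23, symmetric] leg1_leg2_commute)
qed

interpretation U3: three_factors "X3 (ee 1)" "X3 (ee 2)" "X3 (ee 3)" "X3 (er 1)"
  "Y3 (ee 1)" "Y3 (ee 2)" "Y3 (ee 3)" "Y3 (er 1)" "Y3 (fr 2)"
  "Z3 (ee 1)" "Z3 (ee 2)" "Z3 (ee 3)" "Z3 (fr 2)"
proof
  have "Y3 (er 1) * Y3 (fr 2) - Y3 (fr 2) * Y3 (er 1) = 0"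
    using Y3.er_fr[of 1 2] by simp
  then show "Y3 (er 1) * Y3 (fr 2) = Y3 (fr 2) * Y3 (er 1)" by simp
qed (auto simp: X3_Y3_Z3 X3.ee_er' Y3.ee_er' Y3.ee_fr' Z3.ee_fr' X3.ee_er'[unfolded One_nat_def] Y3.ee_er'[unfolded One_nat_def] Y3.ee_fr'[unfolded One_nat_def] Z3.ee_fr'[unfolded One_nat_def] X3.ee_ee Y3.ee_ee Z3.ee_ee)

lemma twist_eq:
  "twist (fps_X * m) (fps_X * \<beta>) =
    q_pow (scal \<beta> * ((ee 1 - ee 3) \<and>\<^sub>\<otimes> CC)) *
    (q_exp (qq ^ 2) (fps_X * (scal m * (e1_tilde \<otimes> f2_tilde))) * q_pow (2 * (ee 1 \<otimes> ee 3))) *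
    q_pow (cst (1/2) * (ee 1 \<and>\<^sub>\<otimes> ee 2 + ee 1 \<and>\<^sub>\<otimes> ee 3 + ee 2 \<and>\<^sub>\<otimes> ee 3))"
proof -
  have "cst (1/2) * fps_X * x = fps_X * (cst (1/2) * x)" for x :: "'a cfree2"
    by (metis fps_mult_fps_X_commute mult.assoc)
  then show ?thesis
    by (simp only: twist_def twist1_def twist2_def twist3_def scal_mult scal_X mult.assoc[of fps_X] exp_ad_X)
qed

text \<open>An arbitrary \<phi> is allowed because the twist enters the cocycle identity through
  four homomorphisms: two leg embeddings and \<Delta> applied to either factor.\<close>

lemma pr_alg_hom_twist:
  fixes \<phi> :: "'k::comm_complex_algebra cfree2 \<Rightarrow> ('m::rel_monoid \<Rightarrow>\<^sub>0 'k) fps"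
  assumes f: "alg_hom \<phi>"
  defines "P \<equiv> \<lambda>a. pr (\<phi> (leg1 a))" and "Q \<equiv> \<lambda>a. pr (\<phi> (leg2 a))"
  shows "pr (\<phi> (twist (fps_X * m) (fps_X * \<beta>))) =
    KU (wbil \<beta> (P (ee 1)) (P (ee 2)) (P (ee 3)) (Q (ee 1)) (Q (ee 2)) (Q (ee 3))) *
    (QU (sc m * (P e1_tilde * Q f2_tilde)) * KU (P (ee 1) * Q (ee 3) + P (ee 1) * Q (ee 3))) *
    KU (rbil (cz (1/2)) (P (ee 1)) (P (ee 2)) (P (ee 3)) (Q (ee 1)) (Q (ee 2)) (Q (ee 3)))"
proof -
  note s = alg_hom_simps[OF f] pr_simps alg_hom_simps[OF alg_hom_leg1] alg_hom_simps[OF alg_hom_leg2]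
  have "pr (2 :: ('m \<Rightarrow>\<^sub>0 'k) fps) = 1 + 1"
    by (simp only: one_add_one[symmetric] pr_simps)
  then have two: "pr (2 :: ('m \<Rightarrow>\<^sub>0 'k) fps) * u = u + u" for u
    by (simp add: distrib_right)
  have sc: "pr (scal c) = sc c" "pr (cst z) = sc (cz z)" for c :: "'k fps" and z
    by (simp_all add: sc_def cst_def)
  show ?thesis
    unfolding twist_eq alg_hom_mult[OF f] alg_hom_q_pow[OF f] alg_hom_q_exp[OF f] pr_mult pr_q_pow pr_q_exp
    by (simp only: wedge_def tens_def CC_def s two sc wbil_def rbil_def P_def Q_def)
qed

lemma alg_hom_tilde:
  fixes f :: "'k::comm_complex_algebra cfree \<Rightarrow> ('m::rel_monoid \<Rightarrow>\<^sub>0 'k) fps"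
  assumes f: "alg_hom f"
  shows "pr (f e1_tilde) = pr (f (er 1)) * KU (sc (cz (1/2)) * (pr (f (ee 1)) + pr (f (ee 2))))"
    and "pr (f f2_tilde) = pr (f (fr 2)) * KU (sc (cz (1/2)) * (pr (f (ee 2)) + pr (f (ee 3))))"
  by (simp_all only: e1_tilde_def f2_tilde_def alg_hom_simps[OF f] alg_hom_q_pow[OF f] pr_mult pr_add pr_q_pow)
     (simp_all only: sc_def cst_def)

lemma Delta_er1: "Delta (er 1) = leg1 (er 1) * leg2 (q_pow (ee 1 - ee 2)) + leg2 (er 1)"
  and Delta_fr2: "Delta (fr 2) = leg1 (fr 2) + leg1 (q_pow (- (ee 2 - ee 3))) * leg2 (fr 2)"
proof -
  have S: "Suc (Suc 0) = 2" "Suc 2 = 3" by simp_all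
  show "Delta (er 1) = leg1 (er 1) * leg2 (q_pow (ee 1 - ee 2)) + leg2 (er 1)"
    and "Delta (fr 2) = leg1 (fr 2) + leg1 (q_pow (- (ee 2 - ee 3))) * leg2 (fr 2)"
    by (simp_all add: er_def fr_def Delta_gen_eq tens_def hh_def S
        alg_hom_simps[OF alg_hom_leg1] alg_hom_simps[OF alg_hom_leg2])
qed

lemma twist_cocycle:
  "pr (leg12 (twist (fps_X * m) (fps_X * \<beta>)) * tens_id Delta (twist (fps_X * m) (fps_X * \<beta>))) =
   pr (leg23 (twist (fps_X * m) (fps_X * \<beta>)) * id_tens Delta (twist (fps_X * m) (fps_X * \<beta> :: 'k::comm_complex_algebra fps)))"
proof -
  have half: "cz (1/2) + cz (1/2) = (1 :: 'k fps)"
    by (simp add: of_cplx_add[symmetric] of_cplx_1)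
  note l12 = alg_hom_simps[OF alg_hom_leg12] alg_hom_q_pow[OF alg_hom_leg12]
  note l23 = alg_hom_simps[OF alg_hom_leg23] alg_hom_q_pow[OF alg_hom_leg23]
  note t = alg_hom_tilde[OF alg_hom_comp[OF alg_hom_leg12 alg_hom_leg1]]
    alg_hom_tilde[OF alg_hom_comp[OF alg_hom_leg12 alg_hom_leg2]]
    alg_hom_tilde[OF alg_hom_comp[OF alg_hom_leg23 alg_hom_leg2]]
    alg_hom_tilde[OF alg_hom_comp[OF alg_hom_leg12 alg_hom_Delta]]
    alg_hom_tilde[OF alg_hom_comp[OF alg_hom_leg23 alg_hom_Delta]]
  have D: "pr (leg12 (Delta (ee 1))) = X3 (ee 1) + Y3 (ee 1)" "pr (leg12 (Delta (ee 2))) = X3 (ee 2) + Y3 (ee 2)"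
    "pr (leg12 (Delta (ee 3))) = X3 (ee 3) + Y3 (ee 3)"
    "pr (leg23 (Delta (ee 1))) = Y3 (ee 1) + Z3 (ee 1)" "pr (leg23 (Delta (ee 2))) = Y3 (ee 2) + Z3 (ee 2)"
    "pr (leg23 (Delta (ee 3))) = Y3 (ee 3) + Z3 (ee 3)"
    "pr (leg12 (Delta (er 1))) = X3 (er 1) * KU (Y3 (ee 1) - Y3 (ee 2)) + Y3 (er 1)"
    "pr (leg23 (Delta (fr 2))) = Y3 (fr 2) + KU (- (Y3 (ee 2) - Y3 (ee 3))) * Z3 (fr 2)"
    unfolding Delta_er1 Delta_fr2
    by (simp_all add: Delta_ee l12 l23 pr_simps leg_leg alg_hom_q_pow[OF alg_hom_leg1] alg_hom_q_pow[OF alg_hom_leg2]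
        alg_hom_simps[OF alg_hom_leg1] alg_hom_simps[OF alg_hom_leg2] pr_q_pow)
  show ?thesis
    unfolding pr_mult pr_alg_hom_twist[OF alg_hom_leg12] pr_alg_hom_twist[OF alg_hom_leg23]
      pr_alg_hom_twist[OF alg_hom_tens_id] pr_alg_hom_twist[OF alg_hom_id_tens] tens_id_leg leg_leg t D
    by (rule U3.cocycle_identity[OF half, unfolded U3.E_def[OF half] U3.Ey_def[OF half] U3.Fy_def[OF half]
      U3.Fz_def[OF half] U3.hx_def[OF half] U3.hy_def[OF half] U3.gy_def[OF half] U3.gz_def[OF half]])
qed

section \<open>Invertibility and the counit conditions\<close>

lemma qc_0: "qc 0 = (1 :: 'k::comm_complex_algebra fps)"
  by (rule q_exp_coeff.c_0[OF q_exp_coeff_qc])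

text \<open>The twist is congruent to 1 modulo \<gamma>, so it is invertible already in the
  completed free algebra, before passing to classes.\<close>

lemma twist_invertible: "\<exists>G. twist (fps_X * m) (fps_X * \<beta>) * G = 1 \<and> G * twist (fps_X * m) (fps_X * \<beta>) = 1"
proof -
  let ?F = "twist (fps_X * m) (fps_X * \<beta>)"
  have "q_exp (qq ^ 2) (fps_X * x) $ 0 = 1" for x :: "'a cfree2"
    unfolding q_exp_eq_xser qc_def[symmetric] by (simp add: xser_def qc_0)
  then have F0: "?F $ 0 = 1" by (simp add: twist_eq q_pow_nth_0)
  then have F0': "1 * ?F $ 0 = 1" "?F $ 0 * 1 = 1" by simp_all
  have "?F * fps_right_inverse ?F 1 = 1" by (rule fps_right_inverse[OF F0'(2)])
  moreover have "fps_left_inverse ?F 1 * ?F = 1" by (rule fps_left_inverse[OF F0'(1)])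
  ultimately show ?thesis
    unfolding fps_left_inverse_eq_fps_right_inverse[OF F0'] by (intro exI conjI)
qed

lemma counit_word_add: "counit_word (u + v) = counit_word u * (counit_word v :: 'k::comm_ring_1 fps)"
  by (cases u; cases v) simp

lemma counit_word_0: "counit_word 0 = 1"
  by (simp add: zero_gword_def)

lemma alg_hom_counit: "alg_hom counit_tens_id" "alg_hom id_tens_counit"
  unfolding counit_tens_id_def id_tens_counit_def
  by (rule alg_hom_lin_ext; simp add: case_prod_beta zero_prod_def counit_word_0 counit_word_add scal_mult
      mono_of_add plus_prod_def central_hom.mult_mult[OF central_hom_scal])+

lemma counit_leg:
  "counit_tens_id (leg2 x) = x" "counit_tens_id (leg1 (gen g)) = 0"
  "id_tens_counit (leg1 x) = x" "id_tens_counit (leg2 (gen g)) = 0"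
proof -
  show "counit_tens_id (leg2 x) = x"
    by (rule alg_hom_eqI[OF alg_hom_comp[OF alg_hom_counit(1) alg_hom_leg2] alg_hom_id])
       (simp add: counit_tens_id_def leg2_def counit_word_0)
  show "id_tens_counit (leg1 x) = x"
    by (rule alg_hom_eqI[OF alg_hom_comp[OF alg_hom_counit(2) alg_hom_leg1] alg_hom_id])
       (simp add: id_tens_counit_def leg1_def counit_word_0)
  show "counit_tens_id (leg1 (gen g)) = 0" "id_tens_counit (leg2 (gen g)) = 0"
    by (simp_all add: counit_tens_id_def id_tens_counit_def leg1_def leg2_def gen_def)
qed

lemma q_exp_0: "q_exp (qq ^ 2) 0 = (1 :: ('m::monoid_add \<Rightarrow>\<^sub>0 'k::comm_complex_algebra) fps)"
proof -
  have "q_exp (qq ^ 2) (fps_X * 0) = (1 :: ('m \<Rightarrow>\<^sub>0 'k) fps)"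
    unfolding q_exp_eq_xser qc_def[symmetric]
    by (rule trans[OF _ xser_single], rule arg_cong[where f = xser]) (auto simp: fun_eq_iff power_0_left qc_0)
  then show ?thesis by simp
qed

text \<open>Every term of every exponent contains a generator in each tensor factor, so the counit
  in either factor annihilates all exponents, again before passing to classes.\<close>

lemma counit_twist:
  "counit_tens_id (twist (fps_X * m) (fps_X * \<beta>)) = 1"
  "id_tens_counit (twist (fps_X * m) (fps_X * \<beta>)) = 1"
proof -
  note c1 = alg_hom_simps[OF alg_hom_counit(1)] alg_hom_q_pow[OF alg_hom_counit(1)] alg_hom_q_exp[OF alg_hom_counit(1)]
  note c2 = alg_hom_simps[OF alg_hom_counit(2)] alg_hom_q_pow[OF alg_hom_counit(2)] alg_hom_q_exp[OF alg_hom_counit(2)]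
  note l = alg_hom_simps[OF alg_hom_leg1] alg_hom_simps[OF alg_hom_leg2]
  have z: "counit_tens_id (leg1 (ee i)) = 0" "counit_tens_id (leg1 (er i)) = 0"
    "id_tens_counit (leg2 (ee i)) = 0" "id_tens_counit (leg2 (fr i)) = 0" for i
    by (simp_all only: ee_def er_def fr_def counit_leg)
  show "counit_tens_id (twist (fps_X * m) (fps_X * \<beta>)) = 1"
    unfolding twist_eq
    by (simp only: c1 wedge_def tens_def CC_def e1_tilde_def l counit_leg z mult_zero_left mult_zero_right
        add_0 diff_0_right diff_self q_pow_0 q_exp_0 mult_1 mult_1_right)
  show "id_tens_counit (twist (fps_X * m) (fps_X * \<beta>)) = 1"
    unfolding twist_eq
    by (simp only: c2 wedge_def tens_def CC_def f2_tilde_def l counit_leg z mult_zero_left mult_zero_right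
        add_0 diff_0_right diff_self q_pow_0 q_exp_0 mult_1 mult_1_right)
qed

lemma twisting_element_twist: "twisting_element (twist (fps_X * m) (fps_X * \<beta>))"
  unfolding twisting_element_def eqU1_iff eqU3_iff
proof (intro conjI)
  from twist_invertible obtain G where G: "twist (fps_X * m) (fps_X * \<beta>) * G = 1"
    "G * twist (fps_X * m) (fps_X * \<beta>) = 1" by metis
  have "inverse_in_U2 (twist (fps_X * m) (fps_X * \<beta>)) G"
    unfolding inverse_in_U2_def eqU2_iff G by (intro conjI refl)
  then show "\<exists>G. inverse_in_U2 (twist (fps_X * m) (fps_X * \<beta>)) G" by (rule exI)
  show "pr (counit_tens_id (twist (fps_X * m) (fps_X * \<beta>))) = pr 1"
    "pr (id_tens_counit (twist (fps_X * m) (fps_X * \<beta>))) = pr 1"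
    unfolding counit_twist by (rule refl)+
  show "pr (leg12 (twist (fps_X * m) (fps_X * \<beta>)) * tens_id Delta (twist (fps_X * m) (fps_X * \<beta>))) =
    pr (leg23 (twist (fps_X * m) (fps_X * \<beta>)) * id_tens Delta (twist (fps_X * m) (fps_X * \<beta>)))"
    by (rule twist_cocycle)
qed

section \<open>Matrix representations\<close>

unbundle no fps_syntax
unbundle vec_syntax

text \<open>Matrix entries are linear forms with values in the base ring itself, whereas
  \<open>lin_ext\<close> takes values in a completed monoid algebra.\<close>

definition lin_form :: "('m \<Rightarrow> 'k) \<Rightarrow> ('m::monoid_add \<Rightarrow>\<^sub>0 'k::comm_ring_1) fps \<Rightarrow> 'k fps" where
  "lin_form \<phi> x = Abs_fps (\<lambda>n. \<Sum>w\<in>Poly_Mapping.keys (fps_nth x n). Poly_Mapping.lookup (fps_nth x n) w * \<phi> w)"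

lemma lin_form_superset:
  assumes "finite S" "Poly_Mapping.keys p \<subseteq> S"
  shows "(\<Sum>w\<in>Poly_Mapping.keys p. Poly_Mapping.lookup p w * \<phi> w) = (\<Sum>w\<in>S. Poly_Mapping.lookup p w * (\<phi> w :: 'k::comm_ring_1))"
  by (rule sum.mono_neutral_left) (use assms in \<open>auto simp: in_keys_iff\<close>)

lemma X_linear_lin_form: "X_linear (lin_form \<phi>)"
  unfolding X_linear_def
proof (intro conjI allI)
  fix x y
  have "(\<Sum>w\<in>Poly_Mapping.keys (p + q). Poly_Mapping.lookup (p + q) w * \<phi> w) =
    (\<Sum>w\<in>Poly_Mapping.keys p. Poly_Mapping.lookup p w * \<phi> w) + (\<Sum>w\<in>Poly_Mapping.keys q. Poly_Mapping.lookup q w * \<phi> w)" for p q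
    by (subst (1 2 3) lin_form_superset[where S = "Poly_Mapping.keys p \<union> Poly_Mapping.keys q"])
       (use keys_add[of p q] in \<open>auto simp: lookup_add sum.distrib[symmetric] distrib_right\<close>)
  then show "lin_form \<phi> (x + y) = lin_form \<phi> x + lin_form \<phi> y"
    by (intro fps_ext) (simp add: lin_form_def)
  show "lin_form \<phi> (fps_X * x) = fps_X * lin_form \<phi> x"
    by (rule fps_ext) (simp add: lin_form_def)
qed

lemma lin_form_base: "lin_form \<phi> (scal (fps_const a) * mono_of w) = fps_const (a * \<phi> w)"
  by (rule fps_ext) (simp add: scal_const_mono_of lin_form_def)

lemma lin_form_scal: "lin_form \<phi> (scal c * x) = c * lin_form \<phi> x"
proof -
  have "lin_form \<phi> (scal (fps_const a) * x) = fps_const a * lin_form \<phi> x" for a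
    by (rule X_linear_eqI[OF X_linear_comp[OF X_linear_lin_form X_linear_mult_left]
          X_linear_comp[OF X_linear_mult_left X_linear_lin_form]])
       (simp add: mult.assoc[symmetric] scal_mult[symmetric] lin_form_base)
  then show ?thesis
    by (rule X_linear_eqI_const[OF X_linear_comp[OF X_linear_lin_form X_linear_comp[OF X_linear_mult_right X_linear_scal]]
          X_linear_mult_right])
qed

definition rep :: "('m \<Rightarrow> 'k ^ 'n ^ 'n) \<Rightarrow> ('m::monoid_add \<Rightarrow>\<^sub>0 'k::comm_ring_1) fps \<Rightarrow> 'k fps ^ 'n ^ 'n" where
  "rep M x = (\<chi> a b. lin_form (\<lambda>w. M w $ a $ b) x)"

definition dg :: "('n::finite \<Rightarrow> 'a::zero) \<Rightarrow> 'a ^ 'n ^ 'n" where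
  "dg d = (\<chi> a b. if a = b then d a else 0)"

lemma dg_nth [simp]: "dg d $ a $ b = (if a = b then d a else 0)"
  by (simp add: dg_def)

lemma dg_mult: "(dg d ** A) $ a $ b = d a * (A :: 'a::semiring_1 ^ 'n::finite ^ 'n) $ a $ b"
  by (simp add: matrix_matrix_mult_def if_distrib[where f = "\<lambda>x. x * _"] cong: if_cong)

lemma dg_dg: "dg d ** dg e = dg (\<lambda>a. d a * (e a :: 'a::semiring_1))"
  by (simp add: vec_eq_iff dg_mult)

lemma fps_const_sum: "fps_const (sum f A) = (\<Sum>i\<in>A. fps_const (f i))"
  by (rule fps_ext) (simp add: fps_sum_nth)

locale matrix_rep =
  fixes M :: "'m::monoid_add \<Rightarrow> 'k::comm_complex_algebra ^ 'n::finite ^ 'n"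
  assumes M_0: "M 0 = mat 1" and M_add: "M (u + v) = M u ** M v"
begin

lemma X_linear_rep: "X_linear (\<lambda>x. rep M x $ a $ b)"
  by (simp add: rep_def X_linear_lin_form)

lemma rep_add: "rep M (x + y) = rep M x + rep M y"
  by (simp add: vec_eq_iff X_linear_add[OF X_linear_rep])

lemma rep_0: "rep M 0 = 0"
  by (simp add: vec_eq_iff X_linear_zero[OF X_linear_rep])

lemma rep_diff: "rep M (x - y) = rep M x - rep M y"
  using rep_add[of "x - y" y] by simp

lemma rep_minus: "rep M (- x) = - rep M x"
  using rep_diff[of 0 x] by (simp add: rep_0)

lemma rep_scal: "rep M (scal c * x) $ a $ b = c * rep M x $ a $ b"
  by (simp add: rep_def lin_form_scal)

lemma rep_base: "rep M (scal (fps_const c) * mono_of w) $ a $ b = fps_const (c * M w $ a $ b)"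
  by (simp add: rep_def lin_form_base)

lemma rep_mono: "rep M (mono_of w) $ a $ b = fps_const (M w $ a $ b)"
  using rep_base[of 1 w] by simp

lemma rep_1: "rep M 1 = mat 1"
  using rep_mono[of 0] by (simp add: vec_eq_iff M_0 mat_def)

lemma rep_mult: "rep M (x * y) = rep M x ** rep M y"
proof -
  have "rep M (x * y) $ a $ b = (rep M x ** rep M y) $ a $ b" for a b
  proof (rule X_linear_eqI[where x = x])
    show "X_linear (\<lambda>x. rep M (x * y) $ a $ b)"
      by (rule X_linear_comp[OF X_linear_rep X_linear_mult_right])
    show "X_linear (\<lambda>x. (rep M x ** rep M y) $ a $ b)"
      by (simp add: X_linear_def matrix_matrix_mult_def rep_add distrib_right sum.distrib
          X_linear_X[OF X_linear_rep] sum_distrib_left mult.assoc)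
    fix c :: 'k and u
    have "rep M (mono_of u * y) $ a $ b = (rep M (mono_of u) ** rep M y) $ a $ b"
    proof (rule X_linear_eqI[where x = y])
      show "X_linear (\<lambda>y. rep M (mono_of u * y) $ a $ b)"
        by (rule X_linear_comp[OF X_linear_rep X_linear_mult_left])
      show "X_linear (\<lambda>y. (rep M (mono_of u) ** rep M y) $ a $ b)"
        by (simp add: X_linear_def matrix_matrix_mult_def rep_add distrib_left sum.distrib
            X_linear_X[OF X_linear_rep] sum_distrib_left mult.left_commute)
      fix d :: 'k and v
      have "mono_of u * (scal (fps_const d) * mono_of v) = scal (fps_const d) * mono_of (u + v)"
        by (simp only: mono_of_add mult_scal_left)
      then show "rep M (mono_of u * (scal (fps_const d) * mono_of v)) $ a $ b =
          (rep M (mono_of u) ** rep M (scal (fps_const d) * mono_of v)) $ a $ b"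
        by (simp add: rep_base rep_mono M_add matrix_matrix_mult_def fps_const_sum
            sum_distrib_left mult.left_commute)
    qed
    then show "rep M (scal (fps_const c) * mono_of u * y) $ a $ b =
        (rep M (scal (fps_const c) * mono_of u) ** rep M y) $ a $ b"
      by (simp add: mult.assoc rep_scal matrix_matrix_mult_def sum_distrib_left)
  qed
  then show ?thesis by (simp add: vec_eq_iff)
qed

lemma rep_power_dg: "rep M x = dg d \<Longrightarrow> rep M (x ^ n) = dg (\<lambda>a. d a ^ n)"
  by (induction n) (simp_all add: rep_mult dg_dg rep_1, simp add: mat_def dg_def)

lemma rep_q_pow:
  assumes "rep M x = dg d" shows "rep M (q_pow x) = dg (\<lambda>a. qz (d a))"
proof -
  have "rep M (q_pow x) $ a $ b = (if a = b then qz (d a) else 0)" for a b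
  proof -
    have "rep M (q_pow x) $ a $ b = xser (\<lambda>n. ec n * (if a = b then d a ^ n else 0))"
      by (simp add: q_pow_eq_xser' X_linear_xser[OF X_linear_rep] rep_scal rep_power_dg[OF assms])
    then show ?thesis
      using xser_single[of "0 :: 'k fps"] by (simp add: qz_def)
  qed
  then show ?thesis by (simp add: vec_eq_iff)
qed

text \<open>On a matrix of square zero the series stops after the linear term, so q-exponentials of
  every base have the same value there.\<close>

lemma rep_xser_nilpotent:
  assumes N: "rep M x ** rep M x = 0" and c: "c 0 = 1" "c (Suc 0) = 1"
  shows "rep M (xser (\<lambda>n. scal (c n) * x ^ n)) $ a $ b = (mat 1 $ a $ b) + fps_X * rep M x $ a $ b"
proof -
  have 2: "rep M (x ^ Suc (Suc n)) = 0" for n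
    by (simp add: rep_mult matrix_mul_assoc N)
  have p: "rep M (x ^ n) $ a $ b = (if n = 0 then mat 1 $ a $ b else if n = 1 then rep M x $ a $ b else 0)" for n
  proof (cases n)
    case (Suc k)
    then show ?thesis by (cases k) (auto simp: 2 simp del: power_Suc)
  qed (simp add: rep_1)
  have "rep M (xser (\<lambda>n. scal (c n) * x ^ n)) $ a $ b =
      xser (\<lambda>n. if n = 0 then mat 1 $ a $ b else if n = 1 then rep M x $ a $ b else 0)"
    unfolding X_linear_xser[OF X_linear_rep] rep_scal
    by (rule arg_cong[where f = xser]) (auto simp: fun_eq_iff p c)
  then show ?thesis by (simp only: xser_two)
qed

end

text \<open>The entries of the representation commute with multiplication by \<gamma>, so killing
  the relators implies killing the closure of their ideal. It is applied to F G, which is 1 modulo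
  the relations.\<close>

lemma rep_JJ:
  fixes M :: "'m::rel_monoid \<Rightarrow> 'k::comm_complex_algebra ^ 'n::finite ^ 'n"
  assumes "matrix_rep M" and r: "\<And>r. r \<in> rels \<Longrightarrow> rep M r = 0" and eq: "pr x = pr y"
  shows "rep M x = rep M y"
proof -
  interpret matrix_rep M by fact
  have I: "rep M z = 0" if "z \<in> two_sided_ideal rels" for z
    using that by (induction rule: two_sided_ideal.induct) (simp_all add: rep_0 rep_add rep_mult r)
  have "rep M (x - y) $ a $ b = 0" for a b
  proof (rule fps_eqI_mod)
    fix N
    obtain z w where z: "z \<in> two_sided_ideal rels" "x - y = z + fps_X ^ N * w"
      using eq unfolding pr_eq_iff JJ_iff by blast
    have "rep M (x - y) $ a $ b - 0 = fps_X ^ N * rep M w $ a $ b"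
      unfolding z(2) X_linear_add[OF X_linear_rep] X_linear_X_power[OF X_linear_rep] I[OF z(1)] by simp
    then show "\<exists>z. rep M (x - y) $ a $ b - 0 = fps_X ^ N * z" by blast
  qed
  then have "rep M (x - y) = 0" by (simp add: vec_eq_iff)
  then show ?thesis by (simp add: rep_diff)
qed

section \<open>The fundamental representation\<close>

lemma rho_word_add: "rho_word (u + v) = rho_word u ** (rho_word v :: 'k::comm_ring_1 ^ 3 ^ 3)"
proof -
  have "foldr (\<lambda>g M. rho_gen g ** M) (g @ h) (mat 1) =
      foldr (\<lambda>g M. rho_gen g ** M) g (mat 1) ** (foldr (\<lambda>g M. rho_gen g ** M) h (mat 1) :: 'k ^ 3 ^ 3)" for g h
    by (induction g) (simp_all add: matrix_mul_assoc)
  then show ?thesis by (cases u; cases v) simp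
qed

lemma rho_word_0: "rho_word 0 = mat 1"
  by (simp add: zero_gword_def)

lemma kron_nth: "(A \<otimes>\<^sub>m B) $ a $ b = A $ fst a $ fst b * B $ snd a $ snd b"
  by (simp add: kron_def)

lemma kron_mult: "(A ** B) \<otimes>\<^sub>m (C ** D) = (A \<otimes>\<^sub>m C) ** (B \<otimes>\<^sub>m (D :: 'k::comm_ring_1 ^ 3 ^ 3))"
  by (simp add: vec_eq_iff kron_nth matrix_matrix_mult_def sum_product sum.cartesian_product case_prod_beta
      UNIV_Times_UNIV mult_ac)

interpretation rho1: matrix_rep "rho_word :: gword \<Rightarrow> 'k::comm_complex_algebra ^ 3 ^ 3"
  by standard (rule rho_word_0 rho_word_add)+

abbreviation (input) rho1 :: "'k::comm_complex_algebra cfree \<Rightarrow> 'k fps ^ 3 ^ 3" where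
  "rho1 \<equiv> rep rho_word"

definition rho_word2 :: "gword \<times> gword \<Rightarrow> 'k::comm_ring_1 ^ (3 \<times> 3) ^ (3 \<times> 3)" where
  "rho_word2 w = rho_word (fst w) \<otimes>\<^sub>m rho_word (snd w)"

interpretation rho2: matrix_rep "rho_word2 :: gword \<times> gword \<Rightarrow> 'k::comm_complex_algebra ^ (3 \<times> 3) ^ (3 \<times> 3)"
proof
  show "rho_word2 0 = mat 1"
    by (auto simp: rho_word2_def rho_word_0 vec_eq_iff kron_nth mat_def prod_eq_iff)
  show "rho_word2 (u + v) = rho_word2 u ** rho_word2 v" for u v
    by (simp add: rho_word2_def rho_word_add kron_mult)
qed

lemma rho2_eq: "rho2 x = rep rho_word2 x"
  by (simp add: rho2_def rep_def lin_form_def rho_word2_def case_prod_beta)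

lemma rho2_leg:
  fixes x :: "'k::comm_complex_algebra cfree"
  shows "rho2 (leg1 x) $ a $ b = rho1 x $ fst a $ fst b * (if snd a = snd b then 1 else 0)"
  "rho2 (leg2 x) $ a $ b = (if fst a = fst b then 1 else 0) * rho1 x $ snd a $ snd b"
proof -
  show "rho2 (leg1 x) $ a $ b = rho1 x $ fst a $ fst b * (if snd a = snd b then 1 else 0)"
    unfolding rho2_eq
  proof (rule X_linear_eqI[where x = x])
    show "X_linear (\<lambda>x :: 'k cfree. rep rho_word2 (leg1 x) $ a $ b)" by (rule X_linear_comp[OF rho2.X_linear_rep alg_hom_X_linear[OF alg_hom_leg1]])
    show "X_linear (\<lambda>x. rho1 x $ fst a $ fst b * (if snd a = snd b then 1 else 0))"
      by (rule X_linear_comp[OF X_linear_mult_right rho1.X_linear_rep])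
  qed (simp add: leg1_def lin_ext_scal_mult rho2.rep_scal rho2.rep_mono rho1.rep_scal rho1.rep_mono,
      simp add: rho_word2_def kron_nth rho_word_0 mat_def)
  show "rho2 (leg2 x) $ a $ b = (if fst a = fst b then 1 else 0) * rho1 x $ snd a $ snd b"
    unfolding rho2_eq
  proof (rule X_linear_eqI[where x = x])
    show "X_linear (\<lambda>x :: 'k cfree. rep rho_word2 (leg2 x) $ a $ b)" by (rule X_linear_comp[OF rho2.X_linear_rep alg_hom_X_linear[OF alg_hom_leg2]])
    show "X_linear (\<lambda>x. (if fst a = fst b then 1 else 0) * rho1 x $ snd a $ snd b)"
      by (rule X_linear_comp[OF X_linear_mult_left rho1.X_linear_rep])
  qed (simp add: leg2_def lin_ext_scal_mult rho2.rep_scal rho2.rep_mono rho1.rep_scal rho1.rep_mono,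
      simp add: rho_word2_def kron_nth rho_word_0 mat_def)
qed

lemma rho2_flip: "rho2 (flip (x :: 'k::comm_complex_algebra cfree2)) $ a $ b = rho2 x $ (snd a, fst a) $ (snd b, fst b)"
  unfolding rho2_eq
proof (rule X_linear_eqI[where x = x])
  show "X_linear (\<lambda>x :: 'k cfree2. rep rho_word2 (flip x) $ a $ b)"
    by (rule X_linear_comp[OF rho2.X_linear_rep alg_hom_X_linear[OF alg_hom_flip]])
  show "rep rho_word2 (flip (scal (fps_const c) * mono_of w)) $ a $ b =
    rep rho_word2 (scal (fps_const c) * mono_of w) $ (snd a, fst a) $ (snd b, fst b)" for c :: 'k and w
    by (cases w) (simp add: flip_def lin_ext_scal_mult rho2.rep_scal rho2.rep_mono,
        simp add: rho_word2_def kron_nth mult.commute)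
qed (rule rho2.X_linear_rep)

text \<open>In the index type the third index is 0; a pair such as (1, 0) below means the basis
  vector v_1 \<otimes> v_3.\<close>

lemma three_simps: "(3::3) = 0" "(of_nat 3 :: 3) = 0" "(of_nat 2 :: 3) = 2" "(of_nat (Suc 0) :: 3) = 1"
  "(1::3) \<noteq> 2" "(2::3) \<noteq> 1" "(1::3) \<noteq> 0" "(0::3) \<noteq> 1" "(2::3) \<noteq> 0" "(0::3) \<noteq> 2"
  by simp_all

lemma rho1_gen: "rho1 (gen g) $ a $ b = fps_const (rho_gen g $ a $ b)"
  by (simp add: gen_def rho1.rep_mono)

lemma mat_unit_nth: "mat_unit i j $ a $ b = (if a = of_nat i \<and> b = of_nat j then 1 else 0)"
  by (simp add: mat_unit_def)

lemma rho1_ee: "i \<in> {1..3} \<Longrightarrow> rho1 (ee i) = mat_unit i i"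
  and rho1_er: "j \<in> {1..2} \<Longrightarrow> rho1 (er j) = mat_unit j (j + 1)"
  and rho1_fr: "j \<in> {1..2} \<Longrightarrow> rho1 (fr j) = mat_unit (j + 1) j"
proof -
  have "i = 1 \<or> i = 2 \<or> i = 3" if "i \<in> {1..3}" using that by auto
  moreover have "j = 1 \<or> j = 2" if "j \<in> {1..2}" using that by auto
  ultimately show "i \<in> {1..3} \<Longrightarrow> rho1 (ee i) = mat_unit i i"
    and "j \<in> {1..2} \<Longrightarrow> rho1 (er j) = mat_unit j (j + 1)"
    and "j \<in> {1..2} \<Longrightarrow> rho1 (fr j) = mat_unit (j + 1) j"
    by (auto simp: vec_eq_iff ee_def er_def fr_def rho1_gen mat_unit_nth numeral_2_eq_2 numeral_3_eq_3)
qed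

lemma fps_const_minus_one: "fps_const (- 1 :: 'a::comm_ring_1) = - 1"
  using fps_const_neg[of "1 :: 'a"] by (simp del: fps_const_neg)

lemma mat_unit_mult:
  assumes "i \<in> {1..3}" "j \<in> {1..3}" "k \<in> {1..3}" "l \<in> {1..3}"
  shows "mat_unit i j ** mat_unit k l = (if j = k then mat_unit i l else (0 :: 'a::comm_ring_1 ^ 3 ^ 3))"
proof -
  have 3: "n = 1 \<or> n = 2 \<or> n = 3" if "n \<in> {1..3}" for n :: nat using that by auto
  have inj: "(of_nat j :: 3) = of_nat k \<longleftrightarrow> j = k"
    using 3[OF assms(2)] 3[OF assms(3)] by (elim disjE) (simp_all add: three_simps)
  have "(mat_unit i j ** mat_unit k l) $ a $ b = (if j = k then mat_unit i l else (0 :: 'a ^ 3 ^ 3)) $ a $ b" for a b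
  proof -
    have "(\<Sum>x\<in>(UNIV :: 3 set). (if a = of_nat i \<and> x = of_nat j then 1 else 0) * (if x = of_nat k \<and> b = of_nat l then 1 else 0)) =
      (\<Sum>x\<in>(UNIV :: 3 set). if x = of_nat j then (if a = of_nat i then 1 else 0) * (if x = of_nat k \<and> b = of_nat l then 1 else (0::'a)) else 0)"
      by (rule sum.cong) auto
    then show ?thesis
      unfolding matrix_matrix_mult_def by (simp only: vec_lambda_beta mat_unit_nth) (simp add: inj mat_unit_nth)
  qed
  then show ?thesis by (simp add: vec_eq_iff)
qed

lemma rho1_hh: "i \<in> {1..2} \<Longrightarrow> rho1 (hh i) =
    dg (\<lambda>a. (if a = of_nat i then 1 else 0) - (if a = of_nat (i + 1) then 1 else 0))"
  by (simp add: hh_def rho1.rep_diff rho1_ee) (auto simp: vec_eq_iff mat_unit_nth)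

text \<open>The eigenvalues n of h_i on the basis are 1, - 1 and 0, where (q^n - q^(-n))/omega
  equals n. The comparison is made after multiplication by omega, which cancels.\<close>

lemma rho1_q_num:
  assumes "i \<in> {1..2}"
  shows "rho1 (q_num (hh i) :: 'k::comm_complex_algebra cfree) = mat_unit i i - mat_unit (i + 1) (i + 1)"
proof -
  have i: "i = 1 \<or> i = 2" using assms by auto
  let ?d = "\<lambda>a::3. (if a = of_nat i then 1 else 0) - (if a = of_nat (i + 1) then 1 else 0) :: 'k fps"
  have m: "rho1 (- hh i) = dg (\<lambda>a. - ?d a)"
    unfolding rho1.rep_minus rho1_hh[OF assms] by (simp add: vec_eq_iff)
  have "rho1 (q_num (hh i :: 'k cfree)) $ a $ b = (mat_unit i i - mat_unit (i + 1) (i + 1)) $ a $ b" for a b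
  proof (rule omega_cancel)
    have "omega * rho1 (q_num (hh i :: 'k cfree)) $ a $ b = rho1 (scal omega * q_num (hh i :: 'k cfree)) $ a $ b"
      by (simp only: rho1.rep_scal)
    also have "\<dots> = (if a = b then qz (?d a) - qz (- ?d a) else 0)"
      unfolding omega_q_num rho1.rep_diff rho1.rep_q_pow[OF rho1_hh[OF assms]] rho1.rep_q_pow[OF m] by simp
    also have "\<dots> = omega * (mat_unit i i - mat_unit (i + 1) (i + 1)) $ a $ b"
      using i by (elim disjE) (auto simp: mat_unit_nth omega_eq three_simps numeral_2_eq_2[symmetric])
    finally show "omega * rho1 (q_num (hh i :: 'k cfree)) $ a $ b = omega * (mat_unit i i - mat_unit (i + 1) (i + 1)) $ a $ b" .
  qed
  then show ?thesis by (simp add: vec_eq_iff)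
qed

lemma (in matrix_rep) rep_scal': "rep M (scal c * x) = c \<cdot>\<^sub>m rep M x"
  by (simp add: vec_eq_iff mat_scale_def rep_scal)

lemma mat_scale_simps [simp]: "(0 :: 'a::comm_ring_1) \<cdot>\<^sub>m A = 0" "(1 :: 'a::comm_ring_1) \<cdot>\<^sub>m A = A" "c \<cdot>\<^sub>m (0 :: 'a::comm_ring_1 ^ 'n ^ 'm) = 0"
  "(- 1 :: 'a::comm_ring_1) \<cdot>\<^sub>m A = - A"
  by (simp_all add: mat_scale_def vec_eq_iff)

lemma rho1_relator:
  assumes "r \<in> relators" shows "rho1 r = 0"
proof -
  note s0 = comm_def cst_def q_serre_def rho1.rep_diff rho1.rep_add rho1.rep_scal'
  note s = rho1.rep_diff rho1.rep_add rho1.rep_mult power2_eq_square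
  from assms consider
    (1) i j where "i \<in> {1..3}" "j \<in> {1..3}" "r = comm (ee i) (ee j)"
    | (2) i j where "i \<in> {1..3}" "j \<in> {1..2}" "r = comm (ee i) (er j) - cst (wt i j) * er j"
    | (3) i j where "i \<in> {1..3}" "j \<in> {1..2}" "r = comm (ee i) (fr j) + cst (wt i j) * fr j"
    | (4) i j where "i \<in> {1..2}" "j \<in> {1..2}"
        "r = comm (er i) (fr j) - cst (of_bool (i = j)) * q_num (hh i)"
    | (5) k l where "k \<in> {1..2}" "l \<in> {1..2}" "k \<noteq> l" "r = q_serre (er k) (er l)"
    | (6) k l where "k \<in> {1..2}" "l \<in> {1..2}" "k \<noteq> l" "r = q_serre (fr k) (fr l)"
    unfolding relators_def q_num_def by blast
  then show ?thesis
  proof cases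
    case 1
    then show ?thesis by (simp add: comm_def s rho1_ee mat_unit_mult)
  next
    case 2
    then have "i \<noteq> j + 1 \<or> i \<noteq> j" "j + 1 \<in> {1..3}" "j \<in> {1..3}" by auto
    with 2 show ?thesis
      by (cases "i = j"; cases "i = j + 1"; simp only: s0)
         (simp_all add: s rho1_ee rho1_er[unfolded Suc_eq_plus1] mat_unit_mult wt_def of_cplx_1 of_cplx_minus fps_const_minus_one)
  next
    case 3
    then have "i \<noteq> j + 1 \<or> i \<noteq> j" "j + 1 \<in> {1..3}" "j \<in> {1..3}" by auto
    with 3 show ?thesis
      by (cases "i = j"; cases "i = j + 1"; simp only: s0)
         (simp_all add: s rho1_ee rho1_fr[unfolded Suc_eq_plus1] mat_unit_mult wt_def of_cplx_1 of_cplx_minus fps_const_minus_one)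
  next
    case 4
    then have "j + 1 \<in> {1..3}" "j \<in> {1..3}" "i + 1 \<in> {1..3}" "i \<in> {1..3}" by auto
    with 4 show ?thesis
      by (simp only: s0, cases "i = j") (simp_all add: s rho1_er rho1_fr mat_unit_mult rho1_q_num of_cplx_1)
  next
    case 5
    then have "k = 1 \<and> l = 2 \<or> k = 2 \<and> l = 1" by auto
    then show ?thesis unfolding 5(4) s0 by (elim disjE) (simp_all add: s rho1_er mat_unit_mult)
  next
    case 6
    then have "k = 1 \<and> l = 2 \<or> k = 2 \<and> l = 1" by auto
    then show ?thesis unfolding 6(4) s0 by (elim disjE) (simp_all add: s rho1_fr mat_unit_mult)
  qed
qed

lemma rho2_cong: "pr x = pr y \<Longrightarrow> rho2 x = rho2 y"
  unfolding rho2_eq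
proof (rule rep_JJ[OF rho2.matrix_rep_axioms])
  fix r :: "'a cfree2" assume "r \<in> rels"
  then have "rho2 r $ a $ b = 0" for a b
    by (auto simp: rels_prod rho2_leg rho1_relator)
  then show "rep rho_word2 r = 0" by (simp add: vec_eq_iff rho2_eq)
qed

lemma rho2_tens: "rho2 (x \<otimes> y) = rho1 x \<otimes>\<^sub>m rho1 y"
proof -
  have "rho2 (x \<otimes> y) $ a $ b = (rho1 x \<otimes>\<^sub>m rho1 y) $ a $ b" for a b
  proof -
    have "rho2 (x \<otimes> y) $ a $ b = (\<Sum>c\<in>UNIV. rho2 (leg1 x) $ a $ c * rho2 (leg2 y) $ c $ b)"
      by (simp add: tens_def rho2_eq rho2.rep_mult matrix_matrix_mult_def)
    also have "\<dots> = (\<Sum>c\<in>UNIV. if c = (fst b, snd a) then rho1 x $ fst a $ fst b * rho1 y $ snd a $ snd b else 0)"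
      by (rule sum.cong) (auto simp: rho2_leg)
    finally show ?thesis by (simp add: kron_nth)
  qed
  then show ?thesis by (simp add: vec_eq_iff)
qed

section \<open>The matrices of the twist and of the R-matrix\<close>

text \<open>The shape of the twist and of each q-exponential factor of R_S in the representation;
  products with such a matrix have explicit entries.\<close>

definition de :: "('n::finite \<Rightarrow> 'a::comm_ring_1) \<Rightarrow> 'n \<Rightarrow> 'n \<Rightarrow> 'a \<Rightarrow> 'a ^ 'n ^ 'n" where
  "de f p q z = (\<chi> a b. (if a = b then f a else 0) + (if a = p \<and> b = q then z else 0))"

lemma de_nth: "de f p q z $ a $ b = (if a = b then f a else 0) + (if a = p \<and> b = q then z else 0)"
  by (simp add: de_def)

lemma de_mult_left: "(de f p q z ** A) $ a $ b = f a * A $ a $ b + (if a = p then z * A $ q $ b else 0)"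
proof -
  have "(\<Sum>c\<in>UNIV. ((if a = c then f a else 0) + (if a = p \<and> c = q then z else 0)) * A $ c $ b) =
    (\<Sum>c\<in>UNIV. if c = a then f a * A $ c $ b else 0) + (\<Sum>c\<in>UNIV. if c = q then (if a = p then z * A $ c $ b else 0) else 0)"
    unfolding sum.distrib[symmetric] by (rule sum.cong) (auto simp: distrib_right)
  then show ?thesis by (simp add: matrix_matrix_mult_def de_nth)
qed

lemma de_mult_right: "(A ** de f p q z) $ a $ b = A $ a $ b * f b + (if b = q then A $ a $ p * z else 0)"
proof -
  have "(\<Sum>c\<in>UNIV. A $ a $ c * ((if c = b then f c else 0) + (if c = p \<and> b = q then z else 0))) =
    (\<Sum>c\<in>UNIV. if c = b then A $ a $ c * f c else 0) + (\<Sum>c\<in>UNIV. if c = p then (if b = q then A $ a $ c * z else 0) else 0)"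
    unfolding sum.distrib[symmetric] by (rule sum.cong) (auto simp: distrib_left)
  then show ?thesis by (simp add: matrix_matrix_mult_def de_nth)
qed


context
  fixes m \<beta> :: "'k::comm_complex_algebra fps"
begin

text \<open>The eigenvalue of e_ii on the basis vector v_a.\<close>

definition ind :: "nat \<Rightarrow> 3 \<Rightarrow> 'k fps" where
  "ind i a = (if a = of_nat i then 1 else 0)"

lemma ind_values:
  "ind 1 1 = 1" "ind 1 2 = 0" "ind 1 0 = 0" "ind 2 1 = 0" "ind 2 2 = 1" "ind 2 0 = 0"
  "ind 3 1 = 0" "ind 3 2 = 0" "ind 3 0 = 1"
  by (simp_all add: ind_def three_simps)

text \<open>This is the action of C in the fundamental representation.\<close>

lemma ind_sum: "ind 1 a + ind 2 a + ind 3 a = 1"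
proof -
  have "\<forall>a. ind 1 a + ind 2 a + ind 3 a = 1"
    unfolding forall_3 three_simps(1) by (simp add: ind_values[unfolded One_nat_def])
  then show ?thesis ..
qed

lemma dg_add: "dg d + dg e = dg (\<lambda>a. d a + (e a :: 'k fps))"
  and dg_diff: "dg d - dg e = dg (\<lambda>a. d a - (e a :: 'k fps))"
  and dg_scale: "c \<cdot>\<^sub>m dg d = dg (\<lambda>a. c * (d a :: 'k fps))"
  and dg_minus: "- dg d = dg (\<lambda>a. - (d a :: 'k fps))"
  by (simp_all add: vec_eq_iff mat_scale_def)

lemma rho1_ee_dg: "rho1 (ee 1) = dg (ind 1)" "rho1 (ee 2) = dg (ind 2)" "rho1 (ee 3) = dg (ind 3)"
  by (auto simp: rho1_ee vec_eq_iff mat_unit_nth ind_def)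

lemma kron_dg: "dg d \<otimes>\<^sub>m dg e = dg (\<lambda>a. d (fst a) * (e (snd a) :: 'k fps))"
  by (auto simp: vec_eq_iff kron_nth prod_eq_iff)

lemmas rho2_diag = rho2.rep_diff rho2.rep_add rho2.rep_scal' rho2_tens[unfolded rho2_eq] rho1.rep_add rho1.rep_diff
  rho1_ee_dg dg_add dg_diff dg_scale dg_minus kron_dg

lemma rho2_q_exp_nilpotent:
  assumes N: "rho2 x ** rho2 x = 0" and s: "s = qz 2 \<or> s = qz (- 2)"
  shows "rho2 (q_exp s (fps_X * x)) $ a $ b = mat 1 $ a $ b + fps_X * rho2 (x :: 'k cfree2) $ a $ b"
proof -
  have "fps_nth s 0 = 1" using s by auto
  \<comment> \<open>The witness is the inverse of the linear coefficient of s, which is 2 or -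
    2.\<close>
  moreover have "fps_nth s (Suc 0) * (if s = qz 2 then of_cplx (1/2) else - of_cplx (1/2)) = 1"
    using s by (auto simp: qz_nth_1 two_unit)
  ultimately show ?thesis
    unfolding rho2_eq q_exp_eq_xser
    by (intro rho2.rep_xser_nilpotent) (use N in \<open>simp_all add: rho2_eq quo_q_fact_0 quo_q_fact_1\<close>)
qed

text \<open>The eigenvalue of the Cartan part of the twist on a basis vector of the tensor square.
  In the exponent of F^(3) the factor C acts as 1, which leaves e_11 - e_33.\<close>

definition fd :: "3 \<times> 3 \<Rightarrow> 'k fps" where
  "fd a = qz (\<beta> * ((ind 1 (fst a) - ind 3 (fst a)) - (ind 1 (snd a) - ind 3 (snd a)))) *
     (qz (2 * (ind 1 (fst a) * ind 3 (snd a))) *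
      qz (cz (1/2) * ((ind 1 (fst a) * ind 2 (snd a) - ind 2 (fst a) * ind 1 (snd a)) +
        (ind 1 (fst a) * ind 3 (snd a) - ind 3 (fst a) * ind 1 (snd a)) +
        (ind 2 (fst a) * ind 3 (snd a) - ind 3 (fst a) * ind 2 (snd a)))))"

lemma rho1_tilde:
  "rho1 (e1_tilde :: 'k cfree) $ a $ b = (if a = 1 \<and> b = 2 then qz (cz (1/2)) else 0)"
  "rho1 (f2_tilde :: 'k cfree) $ a $ b = (if a = 0 \<and> b = 2 then qz (cz (1/2)) else 0)"
proof -
  have q: "rho1 (q_pow (cst (1/2) * (ee 1 + ee 2))) = dg (\<lambda>a. qz (cz (1/2) * (ind 1 a + ind 2 a)))"
    "rho1 (q_pow (cst (1/2) * (ee 2 + ee 3))) = dg (\<lambda>a. qz (cz (1/2) * (ind 2 a + ind 3 a)))"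
    by (intro rho1.rep_q_pow, simp only: cst_def rho1.rep_scal' rho1.rep_add rho1_ee_dg dg_add dg_scale)+
  have e: "rho1 (er 1 :: 'k cfree) = mat_unit 1 2" "rho1 (fr 2 :: 'k cfree) = mat_unit 3 2"
    by (simp_all add: rho1_er rho1_fr numeral_2_eq_2[symmetric])
  have r: "(A ** dg d) $ a $ b = A $ a $ b * (d b :: 'k fps)" for A :: "'k fps ^ 3 ^ 3" and d
    using de_mult_right[of A d 1 1 0 a b] by (simp add: de_def dg_def)
  show "rho1 (e1_tilde :: 'k cfree) $ a $ b = (if a = 1 \<and> b = 2 then qz (cz (1/2)) else 0)"
    unfolding e1_tilde_def rho1.rep_mult q r e
    by (auto simp: mat_unit_nth three_simps ind_values[unfolded One_nat_def] numeral_2_eq_2[symmetric])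
  show "rho1 (f2_tilde :: 'k cfree) $ a $ b = (if a = 0 \<and> b = 2 then qz (cz (1/2)) else 0)"
    unfolding f2_tilde_def rho1.rep_mult q r e
    by (auto simp: mat_unit_nth three_simps ind_values[unfolded One_nat_def])
qed

text \<open>The modified generators give q E_12 \<otimes> E_32, each tail contributing q^(1/2). On
  the row v_1 \<otimes> v_3 the eigenvalue of F^(3) is e^(2B), and on the column v_2 \<otimes> v_2
  the Cartan factors to the right act as 1.\<close>

lemma rho2_twist:
  "rho2 (twist (fps_X * m) (fps_X * \<beta>)) = de fd (1, 0) (2, 2) (qz \<beta> * qz \<beta> * (fps_X * m * qz 1))"
proof -
  let ?x = "scal m * (e1_tilde \<otimes> f2_tilde)"
  have N: "rho2 ?x $ a $ b = (if a = (1, 0) \<and> b = (2, 2) then m * qz 1 else 0)" for a b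
  proof -
    have "qz (cz (1/2)) * qz (cz (1/2)) = (qz 1 :: 'k fps)"
      by (simp add: qz_add[symmetric] of_cplx_add[symmetric] of_cplx_1)
    then show ?thesis
      by (auto simp: rho2_eq rho2.rep_scal rho2_tens[unfolded rho2_eq] kron_nth rho1_tilde prod_eq_iff)
  qed
  have NN: "rho2 ?x ** rho2 ?x = 0"
    by (auto simp: vec_eq_iff matrix_matrix_mult_def N intro!: sum.neutral)
  have E: "rho2 (q_exp (qq ^ 2) (fps_X * ?x)) = de (\<lambda>a. 1) (1, 0) (2, 2) (fps_X * (m * qz 1))"
    using rho2_q_exp_nilpotent[OF NN, of "qz 2"] by (simp add: qq_power2 vec_eq_iff N de_nth mat_def)
  have T: "rho2 (q_pow (scal \<beta> * ((ee 1 - ee 3) \<and>\<^sub>\<otimes> CC))) =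
      dg (\<lambda>a. qz (\<beta> * ((ind 1 (fst a) - ind 3 (fst a)) - (ind 1 (snd a) - ind 3 (snd a)))))"
    unfolding rho2_eq
    by (rule rho2.rep_q_pow)
       (simp only: wedge_def CC_def rho2_diag ind_sum mult_1_left mult_1_right)
  have K: "rho2 (q_pow (2 * (ee 1 \<otimes> ee 3))) = dg (\<lambda>a. qz (2 * (ind 1 (fst a) * ind 3 (snd a))))"
    unfolding rho2_eq
    by (rule rho2.rep_q_pow) (simp only: mult_2 rho2_diag)
  have S: "rho2 (q_pow (cst (1/2) * (ee 1 \<and>\<^sub>\<otimes> ee 2 + ee 1 \<and>\<^sub>\<otimes> ee 3 + ee 2 \<and>\<^sub>\<otimes> ee 3))) =
      dg (\<lambda>a. qz (cz (1/2) * ((ind 1 (fst a) * ind 2 (snd a) - ind 2 (fst a) * ind 1 (snd a)) +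
        (ind 1 (fst a) * ind 3 (snd a) - ind 3 (fst a) * ind 1 (snd a)) +
        (ind 2 (fst a) * ind 3 (snd a) - ind 3 (fst a) * ind 2 (snd a)))))"
    unfolding rho2_eq
    by (rule rho2.rep_q_pow) (simp only: wedge_def cst_def rho2_diag)
  have r: "(A ** dg d) $ a $ b = A $ a $ b * (d b :: 'k fps)" for A :: "'k fps ^ (3 \<times> 3) ^ (3 \<times> 3)" and d a b
    using de_mult_right[of A d a a 0 a b] by (simp add: de_def dg_def)
  have uu: "qz (\<beta> * 2) = qz \<beta> * qz \<beta>" using qz_add[of \<beta> \<beta>] by (simp add: mult_2_right)
  have "rho2 (twist (fps_X * m) (fps_X * \<beta>)) $ a $ b = de fd (1, 0) (2, 2) (qz \<beta> * qz \<beta> * (fps_X * m * qz 1)) $ a $ b" for a b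
    unfolding twist_eq rho2_eq rho2.rep_mult
    unfolding rho2_eq[symmetric] T K S E r dg_mult
    by (auto simp: de_nth fd_def ind_values ind_values[unfolded One_nat_def] uu mult_ac)
  then show ?thesis by (simp add: vec_eq_iff)
qed

lemma fd_values:
  defines "u \<equiv> qz \<beta>" and "u' \<equiv> qz (- \<beta>)" and "s \<equiv> qz (cz (1/2))" and "s' \<equiv> qz (- cz (1/2))"
  shows "fd (1, 1) = 1" "fd (2, 2) = 1" "fd (0, 0) = 1" "fd (1, 2) = u * s" "fd (2, 1) = u' * s'"
    "fd (1, 0) = u * u * (qz 1 * qz 1 * s)" "fd (0, 1) = u' * u' * s'" "fd (2, 0) = u * s" "fd (0, 2) = u' * s'"
proof -
  have uu: "qz (\<beta> * 2) = qz \<beta> * qz \<beta>" "qz (- (\<beta> * 2)) = qz (- \<beta>) * qz (- \<beta>)" "qz 2 = qz 1 * qz (1 :: 'k fps)"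
    using qz_add[of \<beta> \<beta>] qz_add[of "- \<beta>" "- \<beta>"] qz_add[of 1 "1 :: 'k fps"] by (simp_all add: mult_2_right)
  show "fd (1, 1) = 1" "fd (2, 2) = 1" "fd (0, 0) = 1" "fd (1, 2) = u * s" "fd (2, 1) = u' * s'"
    "fd (1, 0) = u * u * (qz 1 * qz 1 * s)" "fd (0, 1) = u' * u' * s'" "fd (2, 0) = u * s" "fd (0, 2) = u' * s'"
    by (simp_all add: fd_def ind_values ind_values[unfolded One_nat_def] uu u_def u'_def s_def s'_def del: fps_const_neg)
qed

lemma rho2_flip_twist:
  "rho2 (flip (twist (fps_X * m) (fps_X * \<beta>))) =
    de (\<lambda>a. fd (snd a, fst a)) (0, 1) (2, 2) (qz \<beta> * qz \<beta> * (fps_X * m * qz 1))"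
  by (auto simp: vec_eq_iff rho2_flip rho2_twist de_nth prod_eq_iff)

text \<open>The eigenvalues of t_0 are 2/3 on v_i \<otimes> v_i and - 1/3 on the other basis
  vectors, which produces c q and c. The off-diagonal parts of the three q-exponentials have
  vanishing products with one another, so their matrix units simply add up.\<close>

lemma rho2_RS:
  defines "c \<equiv> qz (- cz (1/3) :: 'k fps)"
  shows "rho2 (RS_univ :: 'k cfree2) $ a $ b = (if a = b then if fst a = snd a then c * qz 1 else c else 0) +
    (if (a, b) \<in> {((2, 0), (0, 2)), ((1, 0), (0, 1)), ((1, 2), (2, 1))} then c * omega else 0)"
proof -
  let ?t = "cz (1/3) :: 'k fps"
  have t3: "?t + ?t + ?t = 1" by (simp add: of_cplx_add[symmetric] of_cplx_1)
  have t2: "cz (2/3) = ?t + ?t" by (simp add: of_cplx_add[symmetric])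
  have "?t + ?t = - ?t + 1" using t3 by (metis add_diff_cancel_right' diff_conv_add_uminus add.commute)
  then have ct: "qz (2 * ?t) = c * qz 1" unfolding c_def qz_add[symmetric] mult_2 by (rule arg_cong)
  have hh: "rho1 (hh 1 :: 'k cfree) = dg (\<lambda>a. ind 1 a - ind 2 a)" "rho1 (hh 2 :: 'k cfree) = dg (\<lambda>a. ind 2 a - ind 3 a)"
    by (simp_all add: rho1_hh ind_def numeral_2_eq_2[symmetric])
  let ?d = "\<lambda>a :: 3 \<times> 3. (?t + ?t) * ((ind 1 (fst a) - ind 2 (fst a)) * (ind 1 (snd a) - ind 2 (snd a))) +
      ?t * ((ind 1 (fst a) - ind 2 (fst a)) * (ind 2 (snd a) - ind 3 (snd a))) +
      (?t * ((ind 2 (fst a) - ind 3 (fst a)) * (ind 1 (snd a) - ind 2 (snd a))) +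
      (?t + ?t) * ((ind 2 (fst a) - ind 3 (fst a)) * (ind 2 (snd a) - ind 3 (snd a))))"
  have t0: "rho2 (q_pow t0) = dg (\<lambda>a. qz (?d a))"
    unfolding rho2_eq
  proof (rule rho2.rep_q_pow)
    have "{1..2::nat} = {1, 2}" by auto
    then have eq: "t0 = (cst (2/3) * (hh 1 \<otimes> hh 1) + cst (1/3) * (hh 1 \<otimes> hh 2)) +
        (cst (1/3) * (hh 2 \<otimes> hh 1) + cst (2/3) * (hh 2 \<otimes> hh 2) :: 'k cfree2)"
      by (simp add: t0_def cartan_inv_def)
    show "rep rho_word2 t0 = dg ?d"
      by (simp only: eq cst_def t2 rho2.rep_scal' rho2.rep_add rho2_tens[unfolded rho2_eq] hh kron_dg dg_scale dg_add)
  qed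
  have d: "qz (?d a) = (if fst a = snd a then c * qz 1 else c)" for a
  proof -
    have "\<forall>i j. qz (?d (i, j)) = (if i = j then c * qz 1 else c)"
      unfolding forall_3 three_simps(1)
      by (simp add: ind_values ind_values[unfolded One_nat_def] ct del: fps_const_add fps_const_neg flip: c_def)
    then show ?thesis by (metis prod.collapse)
  qed
  have E: "rho2 (q_exp (1 \<oslash> qq ^ 2) (scal omega * x)) = de (\<lambda>a. 1) p q omega"
    if x: "\<And>a b. rho2 (x :: 'k cfree2) $ a $ b = (if a = p \<and> b = q then 1 else 0)" and pq: "p \<noteq> q" for x p q
  proof (rule omega_X_unit)
    fix w j :: "'k fps"
    assume w: "omega = fps_X * w"
    have ox: "scal omega * x = fps_X * (scal w * x)" by (simp add: w scal_mult mult.assoc)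
    have wx: "rho2 (scal w * x) $ a $ b = (if a = p \<and> b = q then w else 0)" for a b
      using x[of a b] by (simp add: rho2_eq rho2.rep_scal)
    have N: "rho2 (scal w * x) ** rho2 (scal w * x) = 0"
      using pq by (auto simp: vec_eq_iff matrix_matrix_mult_def wx intro!: sum.neutral)
    show ?thesis
      unfolding ox quo_qq_power2 using rho2_q_exp_nilpotent[OF N, of "qz (- 2)"]
      by (auto simp: vec_eq_iff wx de_nth mat_def w)
  qed
  note m = mat_unit_mult rho1.rep_mult rho1.rep_diff rho1.rep_scal'
  have e: "rho1 (er 1 :: 'k cfree) = mat_unit 1 2" "rho1 (er 2 :: 'k cfree) = mat_unit 2 3"
    "rho1 (fr 1 :: 'k cfree) = mat_unit 2 1" "rho1 (fr 2 :: 'k cfree) = mat_unit 3 2"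
    by (simp_all add: rho1_er rho1_fr numeral_2_eq_2[symmetric])
  have e13: "rho1 (e13 :: 'k cfree) = mat_unit 1 3" and f13: "rho1 (f13 :: 'k cfree) = mat_unit 3 1"
    unfolding e13_def f13_def rho1.rep_diff rho1.rep_scal' rho1.rep_mult e by (simp_all add: mat_unit_mult)
  have R2: "rho2 (q_exp (1 \<oslash> qq ^ 2) (scal omega * (er 2 \<otimes> fr 2 :: 'k cfree2))) = de (\<lambda>a. 1) (2, 0) (0, 2) omega"
    by (rule E) (auto simp: rho2_tens kron_nth e mat_unit_nth three_simps prod_eq_iff)
  have R13: "rho2 (q_exp (1 \<oslash> qq ^ 2) (scal omega * (e13 \<otimes> f13 :: 'k cfree2))) = de (\<lambda>a. 1) (1, 0) (0, 1) omega"
    by (rule E) (auto simp: rho2_tens kron_nth e13 f13 mat_unit_nth three_simps prod_eq_iff)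
  have R1: "rho2 (q_exp (1 \<oslash> qq ^ 2) (scal omega * (er 1 \<otimes> fr 1 :: 'k cfree2))) = de (\<lambda>a. 1) (1, 2) (2, 1) omega"
    by (rule E) (auto simp: rho2_tens kron_nth e[unfolded One_nat_def] mat_unit_nth three_simps prod_eq_iff)
  show ?thesis
    unfolding RS_univ_def rho2_eq rho2.rep_mult
    unfolding rho2_eq[symmetric] t0 R2 R13 R1 de_mult_right dg_nth d
    by auto
qed

end

section \<open>Comparison with the Cremmer-Gervais matrix\<close>

lemma RS_mat_nth: "(RS_mat :: 'k::comm_complex_algebra fps ^ (3 \<times> 3) ^ (3 \<times> 3)) $ a $ b =
    (if a = b then if fst a = snd a then qq else 1 else 0) +
    (if (a, b) \<in> {((2, 0), (0, 2)), ((1, 0), (0, 1)), ((1, 2), (2, 1))} then omega else 0)"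
proof -
  have s: "{1..3::nat} = {1, 2, 3}" by auto
  have s1: "{(i, j). i \<in> {1..3} \<and> j \<in> {1..3} \<and> i \<noteq> j} = {(1, 2), (1, 3), (2, 1), (2, 3), (3, 1), (3, 2::nat)}"
    unfolding s by auto
  have s2: "{(i, j). i \<in> {1..3} \<and> j \<in> {1..3} \<and> i < j} = {(1, 2), (1, 3), (2, 3::nat)}"
    unfolding s by auto
  have "\<forall>a b. (RS_mat :: 'k fps ^ (3 \<times> 3) ^ (3 \<times> 3)) $ a $ b = (if a = b then if fst a = snd a then qq else 1 else 0) +
    (if (a, b) \<in> {((2, 0), (0, 2)), ((1, 0), (0, 1)), ((1, 2), (2, 1))} then omega else 0)"
    unfolding RS_mat_def s1 s2
    unfolding s split_paired_All forall_3 three_simps(1)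
    by (simp add: mat_scale_def kron_nth mat_unit_nth three_simps[unfolded One_nat_def])
  then show ?thesis by blast
qed

text \<open>Clearing the inverse of F leaves an identity of explicit matrices. Since F fixes the
  entry at v_2 \<otimes> v_2 to be 1, row v_3 \<otimes> v_1 of this column identifies \<nu> with the
  off-diagonal entry of F, and row v_1 \<otimes> v_3 yields the coefficient of E_12 \<otimes>
  E_32.\<close>

lemma Cremmer_Gervais_identity:
  fixes m \<beta> :: "'k::comm_complex_algebra fps"
  defines "F \<equiv> twist (fps_X * m) (fps_X * \<beta>)"
    and "p \<equiv> qz (- \<beta>) * qz (- \<beta>) * qz (- 1)" and "\<nu> \<equiv> qz 1 * (qz \<beta> * qz \<beta>) * (fps_X * m)"
  shows "rho2 (flip F) ** rho2 RS_univ = (qz (- cz (1/3)) \<cdot>\<^sub>m RCG_mat p \<nu>) ** rho2 F"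
proof -
  \<comment> \<open>With u = e^B and s = q^(1/2), their inverses u' and s', and n = \<mu>, all
    entries become polynomials in c and these letters, subject to the inverse relations
    alone.\<close>
  define c u u' s s' n where defs: "c = qz (- cz (1/3) :: 'k fps)" "u = qz \<beta>" "u' = qz (- \<beta>)"
    "s = qz (cz (1/2) :: 'k fps)" "s' = qz (- cz (1/2) :: 'k fps)" "n = fps_X * m"
  have hh: "cz (1/2) + cz (1/2) = (1 :: 'k fps)" by (simp add: of_cplx_add[symmetric] of_cplx_1)
  have hh': "- cz (1/2) + - cz (1/2) = (- 1 :: 'k fps)"
    using hh by (simp add: minus_add_distrib[symmetric] del: fps_const_neg fps_const_add minus_add_distrib)
  have q: "qz 1 = s * s" "qz (- 1) = s' * s'"
    unfolding defs qz_add[symmetric] hh hh' by (rule refl)+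
  have us: "u * u' = 1" "s * s' = 1"
    unfolding defs using qz_minus[of \<beta>] qz_minus[of "cz (1/2) :: 'k fps"] by (simp_all add: mult.commute)
  then have us': "u' * u = 1" "s' * s = 1" "u' * (u * x) = x" "s' * (s * x) = x" for x
    by (simp_all add: mult.assoc[symmetric] mult.commute)
  have qq: "qq = s * s" "omega = s * s - s' * s'" by (simp_all add: qq_eq omega_eq q)
  have p: "p = u' * (u' * (s' * s'))" unfolding p_def q defs(3)[symmetric] by (simp only: mult.assoc)
  have nu: "\<nu> = s * s * (u * u) * n" unfolding \<nu>_def q defs(2,6)[symmetric] ..
  \<comment> \<open>The exact quotients occurring in R_CG have unit divisors, so each becomes
    multiplication by an explicit inverse, built from p = (u' s')^2 and q = s^2.\<close>
  have d: "1 \<oslash> p = u * (u * (s * s))" "p ^ 2 \<oslash> qq = s' * (s' * p ^ 2)"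
    "qq \<oslash> p ^ 2 = (u * (u * (s * s))) ^ 2 * (s * s)" "p ^ 2 \<oslash> qq ^ 2 = (s' * s') ^ 2 * p ^ 2"
  proof -
    have 1: "u * (u * (s * s)) * p = 1" "s' * s' * qq = 1" unfolding p qq by (simp_all add: mult_ac us')
    then have 2: "(u * (u * (s * s))) ^ 2 * p ^ 2 = 1" "(s' * s') ^ 2 * qq ^ 2 = 1"
      by (simp_all only: power_mult_distrib[symmetric] power_one)
    show "1 \<oslash> p = u * (u * (s * s))" "p ^ 2 \<oslash> qq = s' * (s' * p ^ 2)"
      "qq \<oslash> p ^ 2 = (u * (u * (s * s))) ^ 2 * (s * s)" "p ^ 2 \<oslash> qq ^ 2 = (s' * s') ^ 2 * p ^ 2"
      unfolding quo_unit[OF 1(1)] quo_unit[OF 1(2)] quo_unit[OF 2(1)] quo_unit[OF 2(2)]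
      by (simp_all add: mult.assoc qq)
  qed
  define R where "R a b = (if a = b then if fst a = snd a then c * (s * s) else c else 0) +
    (if (a, b) \<in> {((2, 0), (0, 2)), ((1, 0), (0, 1)), ((1, 2), (2, 1))} then c * (s * s - s' * s') else 0)"
    for a b :: "3 \<times> 3"
  have RS: "rho2 RS_univ $ a $ b = R a b" for a b
    unfolding R_def rho2_RS defs(1)[symmetric] q qq ..
  note fd = fd_values[of \<beta>, folded defs, unfolded q]
  let ?z = "u * u * (n * (s * s))"
  \<comment> \<open>The general entry of both products, checked for all 81 index pairs. The extra
    summands come from the single off-diagonal entry of the flipped twist on the left and of the
    twist on the right.\<close>
  have "\<forall>a b. fd \<beta> (snd a, fst a) * R a b + (if a = (0, 1) then ?z * R (2, 2) b else 0) =
    (c \<cdot>\<^sub>m RCG_mat p \<nu>) $ a $ b * fd \<beta> b + (if b = (2, 2) then (c \<cdot>\<^sub>m RCG_mat p \<nu>) $ a $ (1, 0) * ?z else 0)"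
    unfolding RCG_mat_def d split_paired_All forall_3 three_simps(1)
    by (simp add: R_def RS_mat_nth mat_scale_def kron_nth mat_unit_nth three_simps[unfolded One_nat_def] fd
        fd[unfolded One_nat_def] qq p nu us' algebra_simps power2_eq_square)
  then have "(rho2 (flip F) ** rho2 RS_univ) $ a $ b = ((c \<cdot>\<^sub>m RCG_mat p \<nu>) ** rho2 F) $ a $ b" for a b
    unfolding F_def rho2_flip_twist rho2_twist
    unfolding de_mult_left de_mult_right RS defs(2)[symmetric] q
      defs(6)[symmetric] by blast
  then show ?thesis by (simp add: vec_eq_iff defs(1))
qed

text \<open>The inverse of F is determined modulo the relations only, so the claims are made for all
  its representatives G, with c, p and \<nu> independent of the choice.\<close>

theorem mainTheorem2:
  fixes \<mu> B :: "'k::comm_complex_algebra fps"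
  assumes "fps_X dvd \<mu>" and "fps_X dvd B"
  shows "twisting_element (twist \<mu> B) \<and>
    (\<forall>G. inverse_in_U2 (twist \<mu> B) G \<longrightarrow>
       universal_R_matrix Delta (RS_univ :: 'k cfree2) \<longrightarrow>
       universal_R_matrix (twisted_Delta (twist \<mu> B) G) (flip (twist \<mu> B) * RS_univ * G)) \<and>
    (\<exists>c p \<nu>. c dvd 1 \<and> p dvd 1 \<and>
       (\<forall>G. inverse_in_U2 (twist \<mu> B) G \<longrightarrow>
          rho2 (flip (twist \<mu> B) * RS_univ * G) = c \<cdot>\<^sub>m RCG_mat p \<nu>))"
proof -
  obtain m \<beta> where \<mu>: "\<mu> = fps_X * m" and B: "B = fps_X * \<beta>"
    using assms by (auto simp: dvd_def)
  let ?F = "twist \<mu> B"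
  let ?c = "qz (- cz (1/3)) :: 'k fps" and ?p = "qz (- \<beta>) * qz (- \<beta>) * qz (- 1)"
    and ?n = "qz 1 * (qz \<beta> * qz \<beta>) * (fps_X * m)"
  have 1: "twisting_element ?F"
    unfolding \<mu> B by (rule twisting_element_twist)
  have 2: "universal_R_matrix (twisted_Delta ?F G) (flip ?F * RS_univ * G)"
    if "inverse_in_U2 ?F G" "universal_R_matrix Delta (RS_univ :: 'k cfree2)" for G
    by (rule universal_R_matrix_twisted[OF _ that]) (unfold \<mu> B, rule twist_cocycle)
  have 3: "rho2 (flip ?F * RS_univ * G) = ?c \<cdot>\<^sub>m RCG_mat ?p ?n" if "inverse_in_U2 ?F G" for G
  proof -
    \<comment> \<open>The representation is constant on classes, so it turns any G inverting F
      modulo the relations into a genuine inverse matrix.\<close>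
    have FG: "rho2 ?F ** rho2 G = mat 1"
    proof -
      have "rho2 (?F * G) = rho2 1"
        using that by (intro rho2_cong) (simp add: inverse_in_U2_def eqU2_iff)
      then show ?thesis by (simp only: rho2_eq rho2.rep_mult rho2.rep_1)
    qed
    have "rho2 (flip ?F * RS_univ * G) = rho2 (flip ?F) ** rho2 RS_univ ** rho2 G"
      by (simp only: rho2_eq rho2.rep_mult)
    also have "\<dots> = (?c \<cdot>\<^sub>m RCG_mat ?p ?n) ** (rho2 ?F ** rho2 G)"
      unfolding \<mu> B Cremmer_Gervais_identity matrix_mul_assoc ..
    finally show ?thesis unfolding FG by simp
  qed
  have u: "qz x dvd (1 :: 'k fps)" for x
    by (rule dvdI[of _ _ "qz (- x)"]) (simp only: mult.commute[of "qz x"] qz_minus)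
  have 4: "?c dvd 1" "?p dvd 1"
    using u[of "- cz (1/3)"] u[of "- \<beta> + - \<beta> + - 1"] by (simp_all only: qz_add)
  show ?thesis
    by (intro conjI allI impI 1 2 exI[of _ ?c] exI[of _ ?p] exI[of _ ?n] 3 4)
qed

end
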